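(* Let $(\phi,\xi,\eta,g)$ be a contact metric structure on $M^{2n+1}$, with contact subbundle $\mathcal{D}=\operatorname{im}\phi$, $J=\phi|_{\mathcal D}$, and $h=\tfrac12 L_\xi\phi$. (1) The contact metric structure is harmonic if and only if $\tau(\xi)=\phi\,\delta h$ and the $*$-Ricci curvature $\bar\rho^*$ of $\mathcal{D}$ is symmetric. (2) If the structure is $H$-contact, then it is harmonic if and only if $h$ is co-closed (i.e. $\delta h=0$) and $\bar\rho^*$ is symmetric. (3) If the structure is $K$-contact, then it is harmonic if and only if $\bar\rho^*$ is symmetric.
   Context: An almost contact metric structure on a Riemannian manifold $(M^{2n+1},g)$, $g=\langle\,,\rangle$, consists of a $(1,1)$-tensor $\phi$, a unit vector field $\xi$ (the Reeb field) and its dual $1$-form $\eta=g(\xi,\cdot)$, with $\phi^2=-I+\eta\otimes\xi$ and $g(\phi X,\phi Y)=g(X,Y)-\eta(X)\eta(Y)$. It is a contact metric structure if $d\eta=\Phi$, where $\Phi(X,Y)=g(X,\phi Y)$ and $d\eta(X,Y)=\tfrac12\big(X\eta(Y)-Y\eta(X)-\eta([X,Y])\big)$. Everything is smooth. $\nabla$ is the Levi-Civita connection; $\mathcal{D}=\operatorname{im}\phi=\ker\eta$; $J=\phi|_{\mathcal D}$; $\bar\nabla$ is the connection in $\mathcal{D}\to M$ given by $\bar\nabla_XY=(\nabla_XY)_{\mathcal D}$ (orthogonal projection), $X\in TM$, $Y$ a section of $\mathcal D$. $\nabla^2_{X,Y}=\nabla_X\nabla_Y-\nabla_{\nabla_XY}$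 and $\bar\nabla^2_{X,Y}=\bar\nabla_X\bar\nabla_Y-\bar\nabla_{\nabla_XY}$. For a local orthonormal frame $(E_i)$ of $TM$ (sums over repeated indices): $\nabla^*\nabla\xi=-\nabla^2_{E_i,E_i}\xi$, $\bar\nabla^*\bar\nabla J=-\bar\nabla^2_{E_i,E_i}J$, and $$\tau(\xi)=\nabla^*\nabla\xi-|\nabla\xi|^2\xi,\quad \tau(J)=[\bar\nabla^*\bar\nabla J,J],\quad T(\phi)=(\bar\nabla_{E_i}J)\big(\nabla_{E_i}\xi\big),$$ where $[\cdot,\cdot]$ is the commutator of endomorphisms of $\mathcal D$ (note that $\nabla_X\xi\in\mathcal D$). The almost contact metric structure is harmonic if it is given by a harmonic section of the associated bundle with fibre $SO(2n+1)/U(n)$; equivalently (known result, used here as the definition), if both the first harmonic section equation $\tau(\xi)+\tfrac12 J\,T(\phi)=0$ and the second harmonic section equation $\tau(J)=0$ hold. For a contact metric structure, $h=\tfrac12L_\xi\phi$ (Lie derivative), and $\delta h=-(\nabla_{E_i}h)(E_i)$ (which is a section of $\mathcal D$). The structure is $H$-contact if $\xi$ is a harmonic unit vector field, i.e. $\tau(\xi)=0$; it is $K$-contact if $h=0$ (equivalently $\xi$ is Killing). The curvature of $(\mathcal D,\bar\nabla)$ is $\bar R(X,Y)=\bar\nabla^2_{X,Y}-\bar\nabla^2_{Y,X}$, and the $*$-Ricci curvature of $\mathcal D$ is $\bar\rho^*(X,Y)=g(\bar R(X,F_i)JF_i,JY)$ for $X,Y\in\mathcal D$, where $(F_i)$ is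 a local orthonormal frame of $\mathcal D$. It is symmetric if $\bar\rho^*(X,Y)=\bar\rho^*(Y,X)$ for all $X,Y\in\mathcal D$. *)

theory Defs
  imports "HOL-Analysis.Analysis" "HOL-Library.Function_Algebras"
begin

section \<open>Smooth manifolds\<close>

text \<open>
  C^k maps on an open subset of a Euclidean space: differentiable, with all directional
  derivatives C^(k-1). The definitions are only used for open S.
\<close>

primrec Ck_on :: "nat \<Rightarrow> ('e::euclidean_space \<Rightarrow> 'b::real_normed_vector) \<Rightarrow> 'e set \<Rightarrow> bool" where
  "Ck_on 0 f S \<longleftrightarrow> continuous_on S f"
| "Ck_on (Suc k) f S \<longleftrightarrow> (\<forall>x\<in>S. f differentiable (at x)) \<and>
     (\<forall>w. Ck_on k (\<lambda>x. frechet_derivative f (at x) w) S)"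

definition smooth_on :: "('e::euclidean_space \<Rightarrow> 'b::real_normed_vector) \<Rightarrow> 'e set \<Rightarrow> bool" where
  "smooth_on f S \<longleftrightarrow> (\<forall>k. Ck_on k f S)"

text \<open>
  The manifold is the type 'm; a chart is a pair (V, c) of an open domain and a coordinate map,
  whose values outside V are irrelevant.
\<close>

type_synonym ('m, 'e) atlas = "('m set \<times> ('m \<Rightarrow> 'e)) set"

definition smooth_manifold ::
  "('m::{t2_space,second_countable_topology}, 'e::euclidean_space) atlas \<Rightarrow> bool" where
  "smooth_manifold A \<longleftrightarrow>
     (\<forall>(V, c)\<in>A. open V \<and> open (c ` V) \<and> homeomorphism V (c ` V) c (inv_into V c)) \<and>
     (\<Union>(V, c)\<in>A. V) = UNIV \<and>
     (\<forall>(V, c)\<in>A. \<forall>(W, d)\<in>A. smooth_on (c \<circ> inv_into W d) (d ` (V \<inter> W)))"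

definition smooth_fun ::
  "('m::topological_space, 'e::euclidean_space) atlas \<Rightarrow> 'm set \<Rightarrow> ('m \<Rightarrow> real) \<Rightarrow> bool" where
  "smooth_fun A U f \<longleftrightarrow> (\<forall>(V, c)\<in>A. smooth_on (f \<circ> inv_into V c) (c ` (U \<inter> V)))"

definition smooth_near ::
  "('m::topological_space, 'e::euclidean_space) atlas \<Rightarrow> 'm \<Rightarrow> ('m \<Rightarrow> real) \<Rightarrow> bool" where
  "smooth_near A p f \<longleftrightarrow> (\<exists>U. open U \<and> p \<in> U \<and> smooth_fun A U f)"


section \<open>Tangent vectors and vector fields\<close>

text \<open>
  A tangent vector at p is a directional derivative operator, acting on real functions that are
  smooth near p. It is extended by 0 to all other functions, so that equality of tangent
  vectors is equality of functionals. Sums and differences are the pointwise ones of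
  Function_Algebras.
\<close>

type_synonym 'm tvec = "('m \<Rightarrow> real) \<Rightarrow> real"
type_synonym 'm vfield = "'m \<Rightarrow> 'm tvec"

definition tscale :: "real \<Rightarrow> 'm tvec \<Rightarrow> 'm tvec"  (infixr "\<odot>" 75) where
  "a \<odot> v = (\<lambda>f. a * v f)"

definition tangent ::
  "('m::topological_space, 'e::euclidean_space) atlas \<Rightarrow> 'm \<Rightarrow> 'm tvec set" where
  "tangent A p = {v. \<exists>(V, c)\<in>A. p \<in> V \<and> (\<exists>w. v = (\<lambda>f.
     if smooth_near A p f then frechet_derivative (f \<circ> inv_into V c) (at (c p)) w else 0))}"

text \<open>
  Fields are total functions on 'm, but only their values on the open set U matter when they are
  regarded as local fields on U.
\<close>

definition smooth_vfield ::
  "('m::topological_space, 'e::euclidean_space) atlas \<Rightarrow> 'm set \<Rightarrow> 'm vfield \<Rightarrow> bool" where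
  "smooth_vfield A U X \<longleftrightarrow> (\<forall>p\<in>U. X p \<in> tangent A p) \<and>
     (\<forall>W f. open W \<longrightarrow> W \<subseteq> U \<longrightarrow> smooth_fun A W f \<longrightarrow> smooth_fun A W (\<lambda>p. X p f))"

definition smooth_section ::
  "('m::topological_space, 'e::euclidean_space) atlas \<Rightarrow> ('m \<Rightarrow> 'm tvec set) \<Rightarrow>
     'm set \<Rightarrow> 'm vfield \<Rightarrow> bool" where
  "smooth_section A B U X \<longleftrightarrow> smooth_vfield A U X \<and> (\<forall>p\<in>U. X p \<in> B p)"

definition lie_bracket ::
  "('m::topological_space, 'e::euclidean_space) atlas \<Rightarrow> 'm vfield \<Rightarrow> 'm vfield \<Rightarrow> 'm vfield" where
  "lie_bracket A X Y = (\<lambda>p f.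
     if smooth_near A p f then X p (\<lambda>q. Y q f) - Y p (\<lambda>q. X q f) else 0)"

definition tensor11 ::
  "('m::topological_space, 'e::euclidean_space) atlas \<Rightarrow> ('m \<Rightarrow> 'm tvec \<Rightarrow> 'm tvec) \<Rightarrow> bool" where
  "tensor11 A K \<longleftrightarrow>
     (\<forall>p. \<forall>v\<in>tangent A p. K p v \<in> tangent A p) \<and>
     (\<forall>p. \<forall>v\<in>tangent A p. \<forall>w\<in>tangent A p. K p (v + w) = K p v + K p w) \<and>
     (\<forall>p. \<forall>v\<in>tangent A p. \<forall>a. K p (a \<odot> v) = a \<odot> K p v) \<and>
     (\<forall>U X. open U \<longrightarrow> smooth_vfield A U X \<longrightarrow> smooth_vfield A U (\<lambda>p. K p (X p)))"


section \<open>Riemannian metrics, Levi-Civita connection, orthonormal frames\<close>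

type_synonym 'm metric = "'m \<Rightarrow> 'm tvec \<Rightarrow> 'm tvec \<Rightarrow> real"

definition riemannian_metric ::
  "('m::topological_space, 'e::euclidean_space) atlas \<Rightarrow> 'm metric \<Rightarrow> bool" where
  "riemannian_metric A g \<longleftrightarrow>
     (\<forall>p. \<forall>u\<in>tangent A p. \<forall>v\<in>tangent A p. \<forall>w\<in>tangent A p. g p (u + v) w = g p u w + g p v w) \<and>
     (\<forall>p. \<forall>v\<in>tangent A p. \<forall>w\<in>tangent A p. \<forall>a. g p (a \<odot> v) w = a * g p v w) \<and>
     (\<forall>p. \<forall>v\<in>tangent A p. \<forall>w\<in>tangent A p. g p v w = g p w v) \<and>
     (\<forall>p. \<forall>v\<in>tangent A p. v \<noteq> 0 \<longrightarrow> g p v v > 0) \<and>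
     (\<forall>U X Y. open U \<longrightarrow> smooth_vfield A U X \<longrightarrow> smooth_vfield A U Y \<longrightarrow>
        smooth_fun A U (\<lambda>p. g p (X p) (Y p)))"

type_synonym 'm connection = "'m vfield \<Rightarrow> 'm vfield \<Rightarrow> 'm vfield"

text \<open>
  An affine connection, as an operator on local vector fields. The first clause
  says that the operators on the various open sets are compatible with restriction.
\<close>

definition affine_connection ::
  "('m::topological_space, 'e::euclidean_space) atlas \<Rightarrow> 'm connection \<Rightarrow> bool" where
  "affine_connection A nab \<longleftrightarrow>
     (\<forall>U X X' Y Y'. open U \<longrightarrow>
        smooth_vfield A U X \<longrightarrow> smooth_vfield A U X' \<longrightarrow>
        smooth_vfield A U Y \<longrightarrow> smooth_vfield A U Y' \<longrightarrow>
        (\<forall>p\<in>U. X p = X' p \<and> Y p = Y' p) \<longrightarrow> (\<forall>p\<in>U. nab X Y p = nab X' Y' p)) \<and>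
     (\<forall>U X Y. open U \<longrightarrow> smooth_vfield A U X \<longrightarrow> smooth_vfield A U Y \<longrightarrow>
        smooth_vfield A U (nab X Y)) \<and>
     (\<forall>U X Y Z. open U \<longrightarrow>
        smooth_vfield A U X \<longrightarrow> smooth_vfield A U Y \<longrightarrow> smooth_vfield A U Z \<longrightarrow>
        (\<forall>p\<in>U. nab (X + Y) Z p = nab X Z p + nab Y Z p \<and> nab X (Y + Z) p = nab X Y p + nab X Z p)) \<and>
     (\<forall>U f X Y. open U \<longrightarrow>
        smooth_fun A U f \<longrightarrow> smooth_vfield A U X \<longrightarrow> smooth_vfield A U Y \<longrightarrow>
        (\<forall>p\<in>U. nab (\<lambda>q. f q \<odot> X q) Y p = f p \<odot> nab X Y p \<and>
          nab X (\<lambda>q. f q \<odot> Y q) p = X p f \<odot> Y p + f p \<odot> nab X Y p))"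

definition levi_civita ::
  "('m::topological_space, 'e::euclidean_space) atlas \<Rightarrow> 'm metric \<Rightarrow> 'm connection \<Rightarrow> bool" where
  "levi_civita A g nab \<longleftrightarrow> affine_connection A nab \<and>
     (\<forall>U X Y. open U \<longrightarrow> smooth_vfield A U X \<longrightarrow> smooth_vfield A U Y \<longrightarrow>
        (\<forall>p\<in>U. nab X Y p - nab Y X p = lie_bracket A X Y p)) \<and>
     (\<forall>U X Y Z. open U \<longrightarrow>
        smooth_vfield A U X \<longrightarrow> smooth_vfield A U Y \<longrightarrow> smooth_vfield A U Z \<longrightarrow>
        (\<forall>p\<in>U. X p (\<lambda>q. g q (Y q) (Z q)) = g p (nab X Y p) (Z p) + g p (Y p) (nab X Z p)))"

text \<open>A local orthonormal frame over U of the subbundle of TM with fibres B p, of rank N.\<close>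

definition orthonormal_frame ::
  "('m::topological_space, 'e::euclidean_space) atlas \<Rightarrow> 'm metric \<Rightarrow> ('m \<Rightarrow> 'm tvec set) \<Rightarrow>
     nat \<Rightarrow> 'm set \<Rightarrow> (nat \<Rightarrow> 'm vfield) \<Rightarrow> bool" where
  "orthonormal_frame A g B N U E \<longleftrightarrow> open U \<and>
     (\<forall>i<N. smooth_section A B U (E i)) \<and>
     (\<forall>p\<in>U. \<forall>i<N. \<forall>j<N. g p (E i p) (E j p) = (if i = j then 1 else 0)) \<and>
     (\<forall>p\<in>U. \<forall>v\<in>B p. v = (\<Sum>i<N. g p v (E i p) \<odot> E i p))"


section \<open>Almost contact metric structures\<close>

definition almost_contact_metric ::
  "('m::topological_space, 'e::euclidean_space) atlas \<Rightarrow> 'm metric \<Rightarrow>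
     ('m \<Rightarrow> 'm tvec \<Rightarrow> 'm tvec) \<Rightarrow> 'm vfield \<Rightarrow> ('m \<Rightarrow> 'm tvec \<Rightarrow> real) \<Rightarrow> bool" where
  "almost_contact_metric A g \<phi> \<xi> \<eta> \<longleftrightarrow>
     tensor11 A \<phi> \<and> smooth_vfield A UNIV \<xi> \<and> (\<forall>p. g p (\<xi> p) (\<xi> p) = 1) \<and>
     (\<forall>p. \<forall>v\<in>tangent A p. \<eta> p v = g p (\<xi> p) v) \<and>
     (\<forall>p. \<forall>v\<in>tangent A p. \<phi> p (\<phi> p v) = - v + \<eta> p v \<odot> \<xi> p) \<and>
     (\<forall>p. \<forall>v\<in>tangent A p. \<forall>w\<in>tangent A p. g p (\<phi> p v) (\<phi> p w) = g p v w - \<eta> p v * \<eta> p w)"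

definition ext_deriv ::
  "('m::topological_space, 'e::euclidean_space) atlas \<Rightarrow> ('m \<Rightarrow> 'm tvec \<Rightarrow> real) \<Rightarrow>
     'm vfield \<Rightarrow> 'm vfield \<Rightarrow> 'm \<Rightarrow> real" where
  "ext_deriv A \<eta> X Y p =
     (X p (\<lambda>q. \<eta> q (Y q)) - Y p (\<lambda>q. \<eta> q (X q)) - \<eta> p (lie_bracket A X Y p)) / 2"

definition contact_metric ::
  "('m::topological_space, 'e::euclidean_space) atlas \<Rightarrow> 'm metric \<Rightarrow>
     ('m \<Rightarrow> 'm tvec \<Rightarrow> 'm tvec) \<Rightarrow> 'm vfield \<Rightarrow> ('m \<Rightarrow> 'm tvec \<Rightarrow> real) \<Rightarrow> bool" where
  "contact_metric A g \<phi> \<xi> \<eta> \<longleftrightarrow> almost_contact_metric A g \<phi> \<xi> \<eta> \<and>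
     (\<forall>U X Y. open U \<longrightarrow> smooth_vfield A U X \<longrightarrow> smooth_vfield A U Y \<longrightarrow>
        (\<forall>p\<in>U. ext_deriv A \<eta> X Y p = g p (X p) (\<phi> p (Y p))))"

definition contact_bundle ::
  "('m::topological_space, 'e::euclidean_space) atlas \<Rightarrow> ('m \<Rightarrow> 'm tvec \<Rightarrow> 'm tvec) \<Rightarrow>
     'm \<Rightarrow> 'm tvec set" where
  "contact_bundle A \<phi> p = \<phi> p ` tangent A p"

definition app :: "('m \<Rightarrow> 'm tvec \<Rightarrow> 'm tvec) \<Rightarrow> 'm vfield \<Rightarrow> 'm vfield" where
  "app K X = (\<lambda>p. K p (X p))"

text \<open>The contact bundle is the orthogonal complement of the unit field xi.\<close>

definition projD :: "'m vfield \<Rightarrow> ('m \<Rightarrow> 'm tvec \<Rightarrow> real) \<Rightarrow> 'm vfield \<Rightarrow> 'm vfield" where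
  "projD \<xi> \<eta> X = (\<lambda>p. X p - \<eta> p (X p) \<odot> \<xi> p)"

definition nablaD ::
  "'m connection \<Rightarrow> 'm vfield \<Rightarrow> ('m \<Rightarrow> 'm tvec \<Rightarrow> real) \<Rightarrow> 'm connection" where
  "nablaD nab \<xi> \<eta> X Y = projD \<xi> \<eta> (nab X Y)"

text \<open>
  Endomorphism fields are treated as operators on vector fields (respectively on sections of the
  contact bundle). A connection C in a bundle induces one on its endomorphisms, by the
  Leibniz rule. The second covariant derivatives use in addition the Levi-Civita connection nab.
\<close>

definition deriv_end ::
  "'m connection \<Rightarrow> 'm vfield \<Rightarrow> ('m vfield \<Rightarrow> 'm vfield) \<Rightarrow> 'm vfield \<Rightarrow> 'm vfield" where
  "deriv_end C X K Y = C X (K Y) - K (C X Y)"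

definition second_deriv ::
  "'m connection \<Rightarrow> 'm connection \<Rightarrow> 'm vfield \<Rightarrow> 'm vfield \<Rightarrow> 'm vfield \<Rightarrow> 'm vfield" where
  "second_deriv nab C X Y Z = C X (C Y Z) - C (nab X Y) Z"

definition second_deriv_end ::
  "'m connection \<Rightarrow> 'm connection \<Rightarrow> 'm vfield \<Rightarrow> 'm vfield \<Rightarrow>
     ('m vfield \<Rightarrow> 'm vfield) \<Rightarrow> 'm vfield \<Rightarrow> 'm vfield" where
  "second_deriv_end nab C X Y K Z =
     deriv_end C X (deriv_end C Y K) Z - deriv_end C (nab X Y) K Z"


section \<open>Harmonicity\<close>

text \<open>
  E is a local orthonormal frame of the tangent bundle with N elements, F one of the contact
  bundle. J is the operator app phi on sections of the contact bundle.
\<close>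

definition tau_xi ::
  "'m metric \<Rightarrow> 'm connection \<Rightarrow> 'm vfield \<Rightarrow> nat \<Rightarrow> (nat \<Rightarrow> 'm vfield) \<Rightarrow> 'm vfield" where
  "tau_xi g nab \<xi> N E = (\<lambda>p.
     - (\<Sum>i<N. second_deriv nab nab (E i) (E i) \<xi> p)
     - (\<Sum>i<N. g p (nab (E i) \<xi> p) (nab (E i) \<xi> p)) \<odot> \<xi> p)"

definition rough_laplacian_J ::
  "'m connection \<Rightarrow> ('m \<Rightarrow> 'm tvec \<Rightarrow> 'm tvec) \<Rightarrow> 'm vfield \<Rightarrow> ('m \<Rightarrow> 'm tvec \<Rightarrow> real) \<Rightarrow>
     nat \<Rightarrow> (nat \<Rightarrow> 'm vfield) \<Rightarrow> 'm vfield \<Rightarrow> 'm vfield" where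
  "rough_laplacian_J nab \<phi> \<xi> \<eta> N E Y =
     - (\<Sum>i<N. second_deriv_end nab (nablaD nab \<xi> \<eta>) (E i) (E i) (app \<phi>) Y)"

definition tau_J ::
  "'m connection \<Rightarrow> ('m \<Rightarrow> 'm tvec \<Rightarrow> 'm tvec) \<Rightarrow> 'm vfield \<Rightarrow> ('m \<Rightarrow> 'm tvec \<Rightarrow> real) \<Rightarrow>
     nat \<Rightarrow> (nat \<Rightarrow> 'm vfield) \<Rightarrow> 'm vfield \<Rightarrow> 'm vfield" where
  "tau_J nab \<phi> \<xi> \<eta> N E Y =
     rough_laplacian_J nab \<phi> \<xi> \<eta> N E (app \<phi> Y) - app \<phi> (rough_laplacian_J nab \<phi> \<xi> \<eta> N E Y)"

definition T_phi ::
  "'m connection \<Rightarrow> ('m \<Rightarrow> 'm tvec \<Rightarrow> 'm tvec) \<Rightarrow> 'm vfield \<Rightarrow> ('m \<Rightarrow> 'm tvec \<Rightarrow> real) \<Rightarrow>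
     nat \<Rightarrow> (nat \<Rightarrow> 'm vfield) \<Rightarrow> 'm vfield" where
  "T_phi nab \<phi> \<xi> \<eta> N E = (\<Sum>i<N. deriv_end (nablaD nab \<xi> \<eta>) (E i) (app \<phi>) (nab (E i) \<xi>))"

definition harmonic_acms ::
  "('m::topological_space, 'e::euclidean_space) atlas \<Rightarrow> 'm metric \<Rightarrow> 'm connection \<Rightarrow>
     ('m \<Rightarrow> 'm tvec \<Rightarrow> 'm tvec) \<Rightarrow> 'm vfield \<Rightarrow> ('m \<Rightarrow> 'm tvec \<Rightarrow> real) \<Rightarrow> bool" where
  "harmonic_acms A g nab \<phi> \<xi> \<eta> \<longleftrightarrow>
     (\<forall>U E. orthonormal_frame A g (tangent A) DIM('e) U E \<longrightarrow> (\<forall>p\<in>U.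
        tau_xi g nab \<xi> DIM('e) E p + (1 / 2) \<odot> \<phi> p (T_phi nab \<phi> \<xi> \<eta> DIM('e) E p) = 0)) \<and>
     (\<forall>U E Y. orthonormal_frame A g (tangent A) DIM('e) U E \<longrightarrow>
        smooth_section A (contact_bundle A \<phi>) U Y \<longrightarrow>
        (\<forall>p\<in>U. tau_J nab \<phi> \<xi> \<eta> DIM('e) E Y p = 0))"


section \<open>The tensor h, H-contact and K-contact structures\<close>

text \<open>Half the Lie derivative of phi along xi.\<close>

definition h_op ::
  "('m::topological_space, 'e::euclidean_space) atlas \<Rightarrow> ('m \<Rightarrow> 'm tvec \<Rightarrow> 'm tvec) \<Rightarrow>
     'm vfield \<Rightarrow> 'm vfield \<Rightarrow> 'm vfield" where
  "h_op A \<phi> \<xi> X = (\<lambda>p.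
     (1 / 2) \<odot> (lie_bracket A \<xi> (app \<phi> X) p - \<phi> p (lie_bracket A \<xi> X p)))"

definition codiff_h ::
  "('m::topological_space, 'e::euclidean_space) atlas \<Rightarrow> 'm connection \<Rightarrow>
     ('m \<Rightarrow> 'm tvec \<Rightarrow> 'm tvec) \<Rightarrow> 'm vfield \<Rightarrow> nat \<Rightarrow> (nat \<Rightarrow> 'm vfield) \<Rightarrow> 'm vfield" where
  "codiff_h A nab \<phi> \<xi> N E = - (\<Sum>i<N. deriv_end nab (E i) (h_op A \<phi> \<xi>) (E i))"

definition h_coclosed ::
  "('m::topological_space, 'e::euclidean_space) atlas \<Rightarrow> 'm metric \<Rightarrow> 'm connection \<Rightarrow>
     ('m \<Rightarrow> 'm tvec \<Rightarrow> 'm tvec) \<Rightarrow> 'm vfield \<Rightarrow> bool" where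
  "h_coclosed A g nab \<phi> \<xi> \<longleftrightarrow>
     (\<forall>U E. orthonormal_frame A g (tangent A) DIM('e) U E \<longrightarrow>
        (\<forall>p\<in>U. codiff_h A nab \<phi> \<xi> DIM('e) E p = 0))"

definition H_contact ::
  "('m::topological_space, 'e::euclidean_space) atlas \<Rightarrow> 'm metric \<Rightarrow> 'm connection \<Rightarrow>
     'm vfield \<Rightarrow> bool" where
  "H_contact A g nab \<xi> \<longleftrightarrow>
     (\<forall>U E. orthonormal_frame A g (tangent A) DIM('e) U E \<longrightarrow>
        (\<forall>p\<in>U. tau_xi g nab \<xi> DIM('e) E p = 0))"

definition K_contact ::
  "('m::topological_space, 'e::euclidean_space) atlas \<Rightarrow>
     ('m \<Rightarrow> 'm tvec \<Rightarrow> 'm tvec) \<Rightarrow> 'm vfield \<Rightarrow> bool" where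
  "K_contact A \<phi> \<xi> \<longleftrightarrow>
     (\<forall>U X. open U \<longrightarrow> smooth_vfield A U X \<longrightarrow> (\<forall>p\<in>U. h_op A \<phi> \<xi> X p = 0))"


section \<open>The *-Ricci curvature of the contact bundle\<close>

definition curvD ::
  "'m connection \<Rightarrow> 'm vfield \<Rightarrow> ('m \<Rightarrow> 'm tvec \<Rightarrow> real) \<Rightarrow>
     'm vfield \<Rightarrow> 'm vfield \<Rightarrow> 'm vfield \<Rightarrow> 'm vfield" where
  "curvD nab \<xi> \<eta> X Y Z =
     second_deriv nab (nablaD nab \<xi> \<eta>) X Y Z - second_deriv nab (nablaD nab \<xi> \<eta>) Y X Z"

definition star_ricciD ::
  "'m metric \<Rightarrow> 'm connection \<Rightarrow> ('m \<Rightarrow> 'm tvec \<Rightarrow> 'm tvec) \<Rightarrow> 'm vfield \<Rightarrow>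
     ('m \<Rightarrow> 'm tvec \<Rightarrow> real) \<Rightarrow> nat \<Rightarrow> (nat \<Rightarrow> 'm vfield) \<Rightarrow>
     'm vfield \<Rightarrow> 'm vfield \<Rightarrow> 'm \<Rightarrow> real" where
  "star_ricciD g nab \<phi> \<xi> \<eta> N F X Y p =
     (\<Sum>i<N. g p (curvD nab \<xi> \<eta> X (F i) (app \<phi> (F i)) p) (\<phi> p (Y p)))"

text \<open>The contact bundle has corank 1, hence rank DIM('e) - 1.\<close>

definition star_ricciD_symmetric ::
  "('m::topological_space, 'e::euclidean_space) atlas \<Rightarrow> 'm metric \<Rightarrow> 'm connection \<Rightarrow>
     ('m \<Rightarrow> 'm tvec \<Rightarrow> 'm tvec) \<Rightarrow> 'm vfield \<Rightarrow> ('m \<Rightarrow> 'm tvec \<Rightarrow> real) \<Rightarrow> bool" where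
  "star_ricciD_symmetric A g nab \<phi> \<xi> \<eta> \<longleftrightarrow>
     (\<forall>U F X Y. orthonormal_frame A g (contact_bundle A \<phi>) (DIM('e) - 1) U F \<longrightarrow>
        smooth_section A (contact_bundle A \<phi>) U X \<longrightarrow>
        smooth_section A (contact_bundle A \<phi>) U Y \<longrightarrow>
        (\<forall>p\<in>U. star_ricciD g nab \<phi> \<xi> \<eta> (DIM('e) - 1) F X Y p =
                star_ricciD g nab \<phi> \<xi> \<eta> (DIM('e) - 1) F Y X p))"

end

theory Submission
  imports Defs
begin

text \<open>
  The form \<open>\<Phi> = d\<eta>\<close> is closed; with \<open>\<phi>\<^sup>2 = - I + \<eta> \<otimes> \<xi>\<close> this forces \<open>\<nabla>\<^sub>\<xi>\<phi> = 0\<close> and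
  \<open>h = \<phi>\<nabla>\<xi> + \<phi>\<^sup>2\<close>. The divergence of the last identity is \<open>\<phi>\<delta>h = - \<phi>T(\<phi>) - \<tau>(\<xi>)\<close>, which
  turns the first harmonic section equation into \<open>\<tau>(\<xi>) = \<phi>\<delta>h\<close>. Closedness also means that
  \<open>\<langle>(\<nabla>\<^sub>XJ)Y, Z\<rangle>\<close> has vanishing cyclic sum on the contact bundle and that \<open>J\<close> is divergence free.
  Differentiating the cyclic identity and commuting the covariant derivatives expresses the rough
  Laplacian of \<open>J\<close> by the Ricci and \<open>*\<close>-Ricci contractions of the curvature of the contact bundle.
  By the Gauss equation the former is symmetric and the antisymmetric part of the latter is
  \<open>J\<close>-anti-invariant, so that \<open>\<langle>\<tau>(J)Y, W\<rangle> = 2 (\<rho>\<^sup>*(Y, W) - \<rho>\<^sup>*(W, Y))\<close>.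
\<close>

section \<open>Modules with a metric connection\<close>

text \<open>Two obstacles shape the proof. Local fields are total functions whose nested covariant
  derivatives are meaningful only on an open set, so direct rewriting would carry a point of that
  set through every step. As elements of a module they admit a purely equational tensor calculus, in
  which identities are checked through pairings with test elements.

  Moreover, the harmonic section equations range over frames of the tangent bundle, the
  \<open>*\<close>-Ricci condition over frames of the contact bundle. A contact frame is completed
  by \<open>\<xi>\<close>. Conversely, a tangent frame is turned into a contact frame only near each
  point, by a reflection, and frame independence of traces links the two. Symmetry of the
  \<open>*\<close>-Ricci curvature then forces tau(J)Y to vanish because tau(J)Y is itself a local
  contact section and can serve as the other argument; single vectors never have to be extended to
  sections.\<close>

text \<open>In the application \<open>V\<close> consists of the smooth vector fields on an open set, extended by 0,
  and \<open>S\<close> of the functions that are smooth there, so that equality on the open set is equality.\<close>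

locale levi_civita_module =
  fixes V :: "'v::ab_group_add set"
    and S :: "('p \<Rightarrow> real) set"
    and sc :: "('p \<Rightarrow> real) \<Rightarrow> 'v \<Rightarrow> 'v"
    and ip :: "'v \<Rightarrow> 'v \<Rightarrow> 'p \<Rightarrow> real"
    and der :: "'v \<Rightarrow> ('p \<Rightarrow> real) \<Rightarrow> 'p \<Rightarrow> real"
    and nb :: "'v \<Rightarrow> 'v \<Rightarrow> 'v"
  assumes zero_mem [simp]: "0 \<in> V"
    and add_mem [simp]: "X \<in> V \<Longrightarrow> Y \<in> V \<Longrightarrow> X + Y \<in> V"
    and uminus_mem [simp]: "X \<in> V \<Longrightarrow> - X \<in> V"
    and sc_mem [simp]: "f \<in> S \<Longrightarrow> X \<in> V \<Longrightarrow> sc f X \<in> V"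
    and nb_mem [simp]: "X \<in> V \<Longrightarrow> Y \<in> V \<Longrightarrow> nb X Y \<in> V"
    and ip_S [simp]: "X \<in> V \<Longrightarrow> Y \<in> V \<Longrightarrow> ip X Y \<in> S"
    and der_S [simp]: "X \<in> V \<Longrightarrow> f \<in> S \<Longrightarrow> der X f \<in> S"
    and add_S [simp]: "f \<in> S \<Longrightarrow> k \<in> S \<Longrightarrow> (\<lambda>p. f p + k p) \<in> S"
    and uminus_S [simp]: "f \<in> S \<Longrightarrow> (\<lambda>p. - f p) \<in> S"
    and der_add: "X \<in> V \<Longrightarrow> f \<in> S \<Longrightarrow> k \<in> S \<Longrightarrow>
      der X (\<lambda>p. f p + k p) p = der X f p + der X k p"
    and der_minus: "X \<in> V \<Longrightarrow> f \<in> S \<Longrightarrow> der X (\<lambda>p. - f p) p = - der X f p"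
    and ip_add_left [simp]: "X \<in> V \<Longrightarrow> Y \<in> V \<Longrightarrow> Z \<in> V \<Longrightarrow> ip (X + Y) Z p = ip X Z p + ip Y Z p"
    and ip_sc_left [simp]: "f \<in> S \<Longrightarrow> X \<in> V \<Longrightarrow> Z \<in> V \<Longrightarrow> ip (sc f X) Z p = f p * ip X Z p"
    and ip_sym: "X \<in> V \<Longrightarrow> Y \<in> V \<Longrightarrow> ip X Y = ip Y X"
    and ip_definite: "X \<in> V \<Longrightarrow> (\<And>p. ip X X p = 0) \<Longrightarrow> X = 0"
    and nb_add_left [simp]: "X \<in> V \<Longrightarrow> Y \<in> V \<Longrightarrow> Z \<in> V \<Longrightarrow> nb (X + Y) Z = nb X Z + nb Y Z"
    and nb_add_right [simp]: "X \<in> V \<Longrightarrow> Y \<in> V \<Longrightarrow> Z \<in> V \<Longrightarrow> nb X (Y + Z) = nb X Y + nb X Z"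
    and nb_sc_left [simp]: "f \<in> S \<Longrightarrow> X \<in> V \<Longrightarrow> Y \<in> V \<Longrightarrow> nb (sc f X) Y = sc f (nb X Y)"
    and nb_sc_right [simp]: "f \<in> S \<Longrightarrow> X \<in> V \<Longrightarrow> Y \<in> V \<Longrightarrow>
      nb X (sc f Y) = sc (der X f) Y + sc f (nb X Y)"
    and der_ip: "X \<in> V \<Longrightarrow> Y \<in> V \<Longrightarrow> Z \<in> V \<Longrightarrow>
      der X (ip Y Z) p = ip (nb X Y) Z p + ip Y (nb X Z) p"
    \<comment> \<open>The Lie bracket is not a primitive: as torsion vanishes it is
      \<open>nb X Y - nb Y X\<close>, which acts on functions as a commutator and obeys the Jacobi
      identity.\<close>
    and der_bracket: "X \<in> V \<Longrightarrow> Y \<in> V \<Longrightarrow> f \<in> S \<Longrightarrow>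
      der (nb X Y) f p - der (nb Y X) f p = der X (der Y f) p - der Y (der X f) p"
    and jacobi: "X \<in> V \<Longrightarrow> Y \<in> V \<Longrightarrow> Z \<in> V \<Longrightarrow>
      (nb X (nb Y Z - nb Z Y) - nb (nb Y Z - nb Z Y) X) +
      (nb Y (nb Z X - nb X Z) - nb (nb Z X - nb X Z) Y) +
      (nb Z (nb X Y - nb Y X) - nb (nb X Y - nb Y X) Z) = 0"
begin

lemma diff_mem [simp]: "X \<in> V \<Longrightarrow> Y \<in> V \<Longrightarrow> X - Y \<in> V"
  using add_mem[of X "- Y"] by simp

lemma sum_mem: "(\<And>i. i \<in> I \<Longrightarrow> X i \<in> V) \<Longrightarrow> (\<Sum>i\<in>I. X i) \<in> V"
  by (induction I rule: infinite_finite_induct) auto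

lemma ip_add_right [simp]: "X \<in> V \<Longrightarrow> Y \<in> V \<Longrightarrow> Z \<in> V \<Longrightarrow> ip Z (X + Y) p = ip Z X p + ip Z Y p"
  by (simp add: ip_sym[of Z])

lemma ip_sc_right [simp]: "f \<in> S \<Longrightarrow> X \<in> V \<Longrightarrow> Z \<in> V \<Longrightarrow> ip Z (sc f X) p = f p * ip Z X p"
  by (simp add: ip_sym[of Z])

lemma ip_zero_left [simp]: "X \<in> V \<Longrightarrow> ip 0 X p = 0"
  using ip_add_left[of 0 0 X p] by simp

lemma ip_zero_right [simp]: "X \<in> V \<Longrightarrow> ip X 0 p = 0"
  by (simp add: ip_sym[of X])

lemma ip_minus_left [simp]: "X \<in> V \<Longrightarrow> Y \<in> V \<Longrightarrow> ip (- X) Y p = - ip X Y p"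
  using ip_add_left[of X "- X" Y p] by simp

lemma ip_minus_right [simp]: "X \<in> V \<Longrightarrow> Y \<in> V \<Longrightarrow> ip Y (- X) p = - ip Y X p"
  by (simp add: ip_sym[of Y])

lemma ip_diff_left [simp]: "X \<in> V \<Longrightarrow> Y \<in> V \<Longrightarrow> Z \<in> V \<Longrightarrow> ip (X - Y) Z p = ip X Z p - ip Y Z p"
  using ip_add_left[of X "- Y" Z p] by simp

lemma ip_diff_right [simp]: "X \<in> V \<Longrightarrow> Y \<in> V \<Longrightarrow> Z \<in> V \<Longrightarrow> ip Z (X - Y) p = ip Z X p - ip Z Y p"
  using ip_add_right[of X "- Y" Z p] by simp

lemma ip_sum_left: "(\<And>i. i \<in> I \<Longrightarrow> X i \<in> V) \<Longrightarrow> Z \<in> V \<Longrightarrow> ip (\<Sum>i\<in>I. X i) Z p = (\<Sum>i\<in>I. ip (X i) Z p)"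
  by (induction I rule: infinite_finite_induct) (auto simp: sum_mem)

text \<open>Distributivity and associativity of \<open>sc\<close> are not assumed. Where such a law
  is needed it comes from positive definiteness, by comparing pairings, which are real
  numbers.\<close>

lemma eqI:
  assumes "X \<in> V" "Y \<in> V" "\<And>Z p. Z \<in> V \<Longrightarrow> ip X Z p = ip Y Z p"
  shows "X = Y"
  using ip_definite[of "X - Y"] assms by simp

lemma nb_zero_left [simp]: "X \<in> V \<Longrightarrow> nb 0 X = 0"
  using nb_add_left[of 0 0 X] by simp

lemma nb_zero_right [simp]: "X \<in> V \<Longrightarrow> nb X 0 = 0"
  using nb_add_right[of X 0 0] by simp

lemma nb_minus_left [simp]: "X \<in> V \<Longrightarrow> Y \<in> V \<Longrightarrow> nb (- X) Y = - nb X Y"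
  using nb_add_left[of X "- X" Y] by (simp add: eq_neg_iff_add_eq_0 add.commute)

lemma nb_minus_right [simp]: "X \<in> V \<Longrightarrow> Y \<in> V \<Longrightarrow> nb Y (- X) = - nb Y X"
  using nb_add_right[of Y X "- X"] by (simp add: eq_neg_iff_add_eq_0 add.commute)

lemma nb_diff_left [simp]: "X \<in> V \<Longrightarrow> Y \<in> V \<Longrightarrow> Z \<in> V \<Longrightarrow> nb (X - Y) Z = nb X Z - nb Y Z"
  using nb_add_left[of X "- Y" Z] by simp

lemma nb_diff_right [simp]: "X \<in> V \<Longrightarrow> Y \<in> V \<Longrightarrow> Z \<in> V \<Longrightarrow> nb Z (X - Y) = nb Z X - nb Z Y"
  using nb_add_right[of Z X "- Y"] by simp

lemma nb_sum_right: "(\<And>i. i \<in> I \<Longrightarrow> X i \<in> V) \<Longrightarrow> Z \<in> V \<Longrightarrow> nb Z (\<Sum>i\<in>I. X i) = (\<Sum>i\<in>I. nb Z (X i))"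
  by (induction I rule: infinite_finite_induct) (auto simp: sum_mem)

lemma ip_0_0: "ip 0 0 = (\<lambda>p. 0)"
  by (simp add: fun_eq_iff)

lemma der_zero: "X \<in> V \<Longrightarrow> der X (\<lambda>p. 0) p = 0"
  using der_ip[of X 0 0 p] by (simp add: ip_0_0)

lemma zero_S [simp]: "(\<lambda>p. 0) \<in> S"
  using ip_S[of 0 0] by (simp add: ip_0_0)

lemma sum_S: "(\<And>i. i \<in> I \<Longrightarrow> f i \<in> S) \<Longrightarrow> (\<lambda>p. \<Sum>i\<in>I. f i p) \<in> S"
  by (induction I rule: infinite_finite_induct) auto

lemma der_add_ip:
  "\<lbrakk>X \<in> V; Y \<in> V; Z \<in> V; Y' \<in> V; Z' \<in> V\<rbrakk> \<Longrightarrow> der X (\<lambda>p. ip Y Z p + ip Y' Z' p) p =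
    ip (nb X Y) Z p + ip Y (nb X Z) p + (ip (nb X Y') Z' p + ip Y' (nb X Z') p)"
  by (simp add: der_add der_ip)

section \<open>Curvature and its symmetries\<close>

definition R :: "'v \<Rightarrow> 'v \<Rightarrow> 'v \<Rightarrow> 'v" where
  "R X Y Z = (nb X (nb Y Z) - nb (nb X Y) Z) - (nb Y (nb X Z) - nb (nb Y X) Z)"

lemma R_mem [simp]: "X \<in> V \<Longrightarrow> Y \<in> V \<Longrightarrow> Z \<in> V \<Longrightarrow> R X Y Z \<in> V"
  by (simp add: R_def)

lemma R_swap: "R Y X Z = - R X Y Z"
  by (simp add: R_def)

lemma R_sc: "f \<in> S \<Longrightarrow> X \<in> V \<Longrightarrow> Y \<in> V \<Longrightarrow> Z \<in> V \<Longrightarrow> R (sc f X) Y Z = sc f (R X Y Z)"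
  by (rule eqI) (auto simp: R_def algebra_simps)

text \<open>By \<open>der_bracket\<close> the antisymmetrised second derivative of the function
  \<open>ip Z W\<close> vanishes. The product rule splits it into the two curvature terms, the mixed
  first-order terms cancelling by symmetry.\<close>

lemma R_skew:
  assumes [simp]: "X \<in> V" "Y \<in> V" "Z \<in> V" "W \<in> V"
  shows "ip (R X Y Z) W p = - ip (R X Y W) Z p"
proof -
  have e: "der Y (ip Z W) = (\<lambda>p. ip (nb Y Z) W p + ip Z (nb Y W) p)" if "Y \<in> V" for Y
    using that by (simp add: der_ip fun_eq_iff)
  have "der (nb X Y) (ip Z W) p - der (nb Y X) (ip Z W) p =
      der X (der Y (ip Z W)) p - der Y (der X (ip Z W)) p"
    by (simp add: der_bracket)
  then show ?thesis
    unfolding e[of X, simplified] e[of Y, simplified]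
    by (simp add: der_ip der_add_ip R_def ip_sym)
qed

lemma bianchi:
  assumes [simp]: "X \<in> V" "Y \<in> V" "Z \<in> V"
  shows "R X Y Z + R Y Z X + R Z X Y = 0"
  using jacobi[of X Y Z] by (simp add: R_def algebra_simps)

lemma bianchi_ip:
  assumes [simp]: "X \<in> V" "Y \<in> V" "Z \<in> V" "W \<in> V"
  shows "ip (R X Y Z) W p + ip (R Y Z X) W p + ip (R Z X Y) W p = 0"
  using arg_cong[OF bianchi[of X Y Z], of "\<lambda>v. ip v W p"] by simp

text \<open>The octahedron argument: four cyclic sums of the Bianchi identity, combined by skewness
  in each pair of arguments.\<close>

lemma R_pair:
  assumes [simp]: "X \<in> V" "Y \<in> V" "Z \<in> V" "W \<in> V"
  shows "ip (R X Y Z) W p = ip (R Z W X) Y p"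
proof -
  have sw: "ip (R B A C) D p = - ip (R A B C) D p"
    if "A \<in> V" "B \<in> V" "C \<in> V" "D \<in> V" for A B C D
    using that by (simp add: R_swap[of A B])
  show ?thesis
    using bianchi_ip[of X Y Z W p] bianchi_ip[of Y Z W X p] bianchi_ip[of Z W X Y p]
      bianchi_ip[of W X Y Z p]
      R_skew[of X Y Z W p] R_skew[of Y Z X W p] R_skew[of Z X Y W p]
      R_skew[of Z W X Y p] R_skew[of W X Y Z p] R_skew[of Y W X Z p]
      sw[of X Y Z W] sw[of X Y W Z] sw[of Z X Y W] sw[of Z X W Y] sw[of Y Z X W] sw[of Y Z W X]
      sw[of Z W X Y] sw[of Z W Y X] sw[of W X Y Z] sw[of W X Z Y] sw[of Y W X Z] sw[of Y W Z X]
    by simp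
qed

section \<open>Traces of function-bilinear forms over frames\<close>

definition tensorial :: "'v set \<Rightarrow> ('v \<Rightarrow> 'v \<Rightarrow> 'p \<Rightarrow> real) \<Rightarrow> bool" where
  "tensorial B b \<longleftrightarrow>
    (\<forall>X\<in>B. \<forall>Y\<in>B. \<forall>Z\<in>B. \<forall>p. b (X + Y) Z p = b X Z p + b Y Z p \<and> b Z (X + Y) p = b Z X p + b Z Y p) \<and>
    (\<forall>f\<in>S. \<forall>X\<in>B. \<forall>Y\<in>B. \<forall>p. b (sc f X) Y p = f p * b X Y p \<and> b X (sc f Y) p = f p * b X Y p)"

lemma tensorialI:
  assumes "\<And>X Y Z p. X \<in> B \<Longrightarrow> Y \<in> B \<Longrightarrow> Z \<in> B \<Longrightarrow> b (X + Y) Z p = b X Z p + b Y Z p"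
    and "\<And>X Y Z p. X \<in> B \<Longrightarrow> Y \<in> B \<Longrightarrow> Z \<in> B \<Longrightarrow> b Z (X + Y) p = b Z X p + b Z Y p"
    and "\<And>f X Y p. f \<in> S \<Longrightarrow> X \<in> B \<Longrightarrow> Y \<in> B \<Longrightarrow> b (sc f X) Y p = f p * b X Y p"
    and "\<And>f X Y p. f \<in> S \<Longrightarrow> X \<in> B \<Longrightarrow> Y \<in> B \<Longrightarrow> b X (sc f Y) p = f p * b X Y p"
  shows "tensorial B b"
  using assms by (simp add: tensorial_def)

lemma tensorial_swap: "tensorial B b \<Longrightarrow> tensorial B (\<lambda>X Y. b Y X)"
  by (simp add: tensorial_def)

definition submodule :: "'v set \<Rightarrow> bool" where
  "submodule B \<longleftrightarrow> B \<subseteq> V \<and> 0 \<in> B \<and> (\<forall>X\<in>B. \<forall>Y\<in>B. X + Y \<in> B) \<and> (\<forall>f\<in>S. \<forall>X\<in>B. sc f X \<in> B)"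

text \<open>Only the expansion is recorded, as for a Parseval frame: it determines traces, and it
  remains true where all fields have been extended by zero.\<close>

definition frame :: "'v set \<Rightarrow> nat \<Rightarrow> (nat \<Rightarrow> 'v) \<Rightarrow> bool" where
  "frame B N E \<longleftrightarrow> submodule B \<and> (\<forall>i<N. E i \<in> B) \<and> (\<forall>X\<in>B. X = (\<Sum>i<N. sc (ip X (E i)) (E i)))"

lemma submodule_V [simp]: "submodule V"
  by (simp add: submodule_def)

lemma frame_mem: "frame B N E \<Longrightarrow> i < N \<Longrightarrow> E i \<in> B"
  and frame_memV: "frame B N E \<Longrightarrow> i < N \<Longrightarrow> E i \<in> V"
  by (auto simp: frame_def submodule_def)

lemma tensorial_expand_left:
  assumes fr: "frame B N E" and b: "tensorial B b" and X: "X \<in> B" and Y: "Y \<in> B"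
  shows "b X Y p = (\<Sum>i<N. ip X (E i) p * b (E i) Y p)"
proof -
  have B: "0 \<in> B" "\<And>X Y. X \<in> B \<Longrightarrow> Y \<in> B \<Longrightarrow> X + Y \<in> B" "\<And>f X. f \<in> S \<Longrightarrow> X \<in> B \<Longrightarrow> sc f X \<in> B" "B \<subseteq> V"
    using fr by (auto simp: frame_def submodule_def)
  have b0: "b 0 Y p = 0"
  proof -
    have "b (0 + 0) Y p = b 0 Y p + b 0 Y p"
      using b B(1) Y unfolding tensorial_def by blast
    then show ?thesis by simp
  qed
  have "k \<le> N \<Longrightarrow> (\<Sum>i<k. sc (ip X (E i)) (E i)) \<in> B \<and>
      b (\<Sum>i<k. sc (ip X (E i)) (E i)) Y p = (\<Sum>i<k. ip X (E i) p * b (E i) Y p)" for k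
  proof (induction k)
    case 0
    then show ?case using B b0 by simp
  next
    case (Suc k)
    have E: "E k \<in> B" and s: "ip X (E k) \<in> S"
      using Suc.prems frame_mem[OF fr, of k] B(4) X by (auto intro!: ip_S)
    have "b ((\<Sum>i<k. sc (ip X (E i)) (E i)) + sc (ip X (E k)) (E k)) Y p =
        b (\<Sum>i<k. sc (ip X (E i)) (E i)) Y p + b (sc (ip X (E k)) (E k)) Y p"
      using b B E s Y Suc unfolding tensorial_def by simp
    moreover have "b (sc (ip X (E k)) (E k)) Y p = ip X (E k) p * b (E k) Y p"
      using b B E s Y unfolding tensorial_def by simp
    ultimately show ?case using Suc B E s by simp
  qed
  from this[of N] show ?thesis
    using fr X unfolding frame_def by (metis order_refl)
qed

lemma tensorial_expand_right:
  assumes "frame B N E" "tensorial B b" "X \<in> B" "Y \<in> B"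
  shows "b X Y p = (\<Sum>i<N. ip Y (E i) p * b X (E i) p)"
  using tensorial_expand_left[OF assms(1) tensorial_swap[OF assms(2)] assms(4,3)] .

lemma tensorial_ip: "submodule B \<Longrightarrow> tensorial B ip"
  by (rule tensorialI) (auto simp: submodule_def subset_iff)

lemma parseval:
  assumes "frame B N E" "X \<in> B" "Y \<in> B"
  shows "ip X Y p = (\<Sum>i<N. ip X (E i) p * ip (E i) Y p)"
  using tensorial_expand_left[OF assms(1) tensorial_ip assms(2,3)] assms(1) by (simp add: frame_def)

text \<open>Expand each \<open>E i\<close> twice in \<open>F\<close>. Summing over \<open>i\<close>
  first turns the products of coefficients into \<open>ip (F j) (F k)\<close> by Parseval in
  \<open>E\<close>; the sum over \<open>k\<close> then collapses by expansion in
  \<open>F\<close>.\<close>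

lemma trace_frame_independent:
  assumes E: "frame B N E" and F: "frame B K F" and b: "tensorial B b"
  shows "(\<Sum>i<N. b (E i) (E i) p) = (\<Sum>j<K. b (F j) (F j) p)"
proof -
  have V: "X \<in> B \<Longrightarrow> X \<in> V" for X using E by (auto simp: frame_def submodule_def)
  have "(\<Sum>i<N. b (E i) (E i) p) =
      (\<Sum>i<N. \<Sum>j<K. \<Sum>k<K. ip (E i) (F j) p * (ip (E i) (F k) p * b (F j) (F k) p))"
  proof (intro sum.cong refl)
    fix i assume "i \<in> {..<N}"
    then have i: "E i \<in> B" using frame_mem[OF E] by auto
    have "b (E i) (E i) p = (\<Sum>j<K. ip (E i) (F j) p * b (F j) (E i) p)"
      by (rule tensorial_expand_left[OF F b i i])
    also have "\<dots> = (\<Sum>j<K. ip (E i) (F j) p * (\<Sum>k<K. ip (E i) (F k) p * b (F j) (F k) p))"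
    proof (intro sum.cong refl)
      fix j assume "j \<in> {..<K}"
      then have "F j \<in> B" using frame_mem[OF F] by auto
      then show "ip (E i) (F j) p * b (F j) (E i) p =
          ip (E i) (F j) p * (\<Sum>k<K. ip (E i) (F k) p * b (F j) (F k) p)"
        using tensorial_expand_right[OF F b _ i] by simp
    qed
    finally show "b (E i) (E i) p =
        (\<Sum>j<K. \<Sum>k<K. ip (E i) (F j) p * (ip (E i) (F k) p * b (F j) (F k) p))"
      by (simp add: sum_distrib_left)
  qed
  also have "\<dots> = (\<Sum>j<K. \<Sum>k<K. \<Sum>i<N. ip (E i) (F j) p * (ip (E i) (F k) p * b (F j) (F k) p))"
    by (subst sum.swap, rule sum.cong[OF refl], rule sum.swap)
  also have "\<dots> = (\<Sum>j<K. \<Sum>k<K. ip (F j) (F k) p * b (F j) (F k) p)"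
  proof (intro sum.cong refl)
    fix j k assume "j \<in> {..<K}" "k \<in> {..<K}"
    then have *: "F j \<in> B" "F k \<in> B" using frame_mem[OF F] by auto
    show "(\<Sum>i<N. ip (E i) (F j) p * (ip (E i) (F k) p * b (F j) (F k) p)) =
        ip (F j) (F k) p * b (F j) (F k) p"
      unfolding parseval[OF E *] sum_distrib_right
      by (intro sum.cong refl)
        (use * V frame_memV[OF E] in \<open>simp add: ip_sym[of "F j"]\<close>)
  qed
  also have "\<dots> = (\<Sum>j<K. b (F j) (F j) p)"
    by (intro sum.cong refl tensorial_expand_right[OF F b, symmetric]) (auto simp: frame_mem[OF F])
  finally show ?thesis .
qed

end

section \<open>Contact metric structures on a module\<close>

text \<open>The field \<open>\<xi>\<close> extended by zero has squared length 1 only on the open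
  set. Unit length is therefore stated through its effect: \<open>ip xi xi\<close> acts as the
  identity on \<open>V\<close> and has zero derivative. The factor 2 in \<open>contact\<close>
  undoes the one half in the exterior derivative.\<close>

locale contact_module = levi_civita_module V S sc ip der nb
  for V :: "'v::ab_group_add set"
    and S :: "('p \<Rightarrow> real) set"
    and sc ip der nb +
  fixes ph :: "'v \<Rightarrow> 'v" and xi :: 'v
  assumes ph_mem [simp]: "X \<in> V \<Longrightarrow> ph X \<in> V"
    and xi_mem [simp]: "xi \<in> V"
    and ph_add [simp]: "X \<in> V \<Longrightarrow> Y \<in> V \<Longrightarrow> ph (X + Y) = ph X + ph Y"
    and ph_sc [simp]: "f \<in> S \<Longrightarrow> X \<in> V \<Longrightarrow> ph (sc f X) = sc f (ph X)"
    and unit: "X \<in> V \<Longrightarrow> sc (ip xi xi) X = X"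
    and der_unit: "X \<in> V \<Longrightarrow> der X (ip xi xi) p = 0"
    and ph_ph: "X \<in> V \<Longrightarrow> ph (ph X) = - X + sc (ip X xi) xi"
    and ip_ph_ph: "X \<in> V \<Longrightarrow> Y \<in> V \<Longrightarrow> ip (ph X) (ph Y) p = ip X Y p - ip X xi p * ip Y xi p"
    and contact: "X \<in> V \<Longrightarrow> Y \<in> V \<Longrightarrow>
      der X (ip xi Y) p - der Y (ip xi X) p - ip xi (nb X Y - nb Y X) p = 2 * ip X (ph Y) p"
begin

abbreviation al :: "'v \<Rightarrow> 'v" where "al X \<equiv> nb X xi"
abbreviation a :: "'v \<Rightarrow> 'v \<Rightarrow> 'p \<Rightarrow> real" where "a X Y \<equiv> ip (al X) Y"

lemma unit_ip: "X \<in> V \<Longrightarrow> Y \<in> V \<Longrightarrow> ip xi xi p * ip X Y p = ip X Y p"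
  using ip_sc_left[of "ip xi xi" X Y p] by (simp add: unit)

lemma ph_zero [simp]: "ph 0 = 0"
  using ph_add[of 0 0] by simp

lemma ph_minus [simp]: "X \<in> V \<Longrightarrow> ph (- X) = - ph X"
  using ph_add[of X "- X"] by (simp add: eq_neg_iff_add_eq_0 add.commute)

lemma ph_diff [simp]: "X \<in> V \<Longrightarrow> Y \<in> V \<Longrightarrow> ph (X - Y) = ph X - ph Y"
  using ph_add[of X "- Y"] by simp

lemma ph_sum: "(\<And>i. i \<in> I \<Longrightarrow> X i \<in> V) \<Longrightarrow> ph (\<Sum>i\<in>I. X i) = (\<Sum>i\<in>I. ph (X i))"
  by (induction I rule: infinite_finite_induct) (auto simp: sum_mem)

lemma ph_xi [simp]: "ph xi = 0"
  using unit_ip[of xi xi] by (intro ip_definite) (simp_all add: ip_ph_ph)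

lemma sc_ip_xi_eq_0:
  assumes "f \<in> S" "sc f xi = 0" "X \<in> V"
  shows "f p * ip xi X p = 0"
  using ip_sc_left[of f xi X p] assms by simp

text \<open>\<open>ph\<close> applied three times, evaluated from the outside and from the inside;
  the two results differ by the \<open>xi\<close>-component of \<open>ph X\<close>.\<close>

lemma ip_ph_xi [simp]: "X \<in> V \<Longrightarrow> ip (ph X) xi p = 0"
proof -
  assume X: "X \<in> V"
  have "ph (ph (ph X)) = - ph X + sc (ip (ph X) xi) xi"
    using X by (simp add: ph_ph[of "ph X"])
  moreover have "ph (ph (ph X)) = - ph X + sc (ip X xi) (ph xi)"
    using X by (simp add: ph_ph[of X] del: ph_xi)
  moreover have "sc (ip X xi) 0 = 0"
    using X by (intro ip_definite) simp_all
  ultimately have "sc (ip (ph X) xi) xi = 0" by simp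
  from sc_ip_xi_eq_0[OF _ this, of xi p] X show ?thesis
    using unit_ip[of "ph X" xi p] by (simp add: mult.commute)
qed

lemma ip_xi_ph [simp]: "X \<in> V \<Longrightarrow> ip xi (ph X) p = 0"
  by (simp add: ip_sym[of xi])

lemma ip_ph_left: "X \<in> V \<Longrightarrow> Y \<in> V \<Longrightarrow> ip (ph X) Y p = - ip X (ph Y) p"
  using ip_ph_ph[of X "ph Y" p] by (simp add: ph_ph)

lemma ip_ph_self [simp]: "X \<in> V \<Longrightarrow> ip X (ph X) p = 0"
  using ip_ph_left[of X X p] by (simp add: ip_sym[of "ph X"])

lemma a_xi [simp]: "X \<in> V \<Longrightarrow> a X xi p = 0"
  using der_ip[of X xi xi p] der_unit[of X p] by (simp add: ip_sym)

lemma xi_a [simp]: "X \<in> V \<Longrightarrow> ip xi (al X) p = 0"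
  by (simp add: ip_sym[of xi])

text \<open>For a torsion-free connection the exterior derivative of the form dual to
  \<open>xi\<close> is the skew part of the covariant derivative of \<open>xi\<close>.\<close>

lemma a_skew_part: "X \<in> V \<Longrightarrow> Y \<in> V \<Longrightarrow> a X Y p - a Y X p = 2 * ip X (ph Y) p"
  using contact[of X Y p] der_ip[of X xi Y p] der_ip[of Y xi X p] by simp

text \<open>The Reeb field is geodesic: in \<open>a_skew_part\<close> both \<open>a Z xi\<close> and
  \<open>ip xi (ph Z)\<close> vanish.\<close>

lemma al_xi [simp]: "al xi = 0"
proof (rule eqI)
  fix Z p assume "Z \<in> V"
  then show "ip (al xi) Z p = ip 0 Z p"
    using a_skew_part[of xi Z p] by simp
qed auto

lemma ip_nb_xi: "X \<in> V \<Longrightarrow> Y \<in> V \<Longrightarrow> (\<And>p. ip Y xi p = 0) \<Longrightarrow> ip (nb X Y) xi p = - a X Y p"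
proof -
  assume *: "X \<in> V" "Y \<in> V" "\<And>p. ip Y xi p = 0"
  then have "ip Y xi = (\<lambda>p. 0)" by (simp add: fun_eq_iff)
  then show ?thesis
    using * der_ip[of X Y xi p] der_zero[of X p] by (simp add: ip_sym[of Y])
qed

section \<open>The covariant derivative \<open>D\<close> of \<open>ph\<close> on the whole tangent
  bundle\<close>

definition D :: "'v \<Rightarrow> 'v \<Rightarrow> 'v" where
  "D X Y = nb X (ph Y) - ph (nb X Y)"

lemma D_mem [simp]: "X \<in> V \<Longrightarrow> Y \<in> V \<Longrightarrow> D X Y \<in> V"
  by (simp add: D_def)

lemma D_add:
  assumes [simp]: "X \<in> V" "Y \<in> V" "Z \<in> V"
  shows "D (X + Y) Z = D X Z + D Y Z" "D Z (X + Y) = D Z X + D Z Y"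
  by (rule eqI; simp add: D_def algebra_simps)+

lemma D_sc:
  assumes [simp]: "X \<in> V" "Y \<in> V" "f \<in> S"
  shows "D (sc f X) Y = sc f (D X Y)" "D X (sc f Y) = sc f (D X Y)"
  by (rule eqI; simp add: D_def algebra_simps)+

lemma D_skew:
  assumes [simp]: "X \<in> V" "Y \<in> V" "Z \<in> V"
  shows "ip (D X Y) Z p = - ip (D X Z) Y p"
proof -
  have "ip (ph Y) Z = (\<lambda>p. - ip Y (ph Z) p)"
    by (simp add: ip_ph_left fun_eq_iff)
  then have "der X (ip (ph Y) Z) p = - der X (ip Y (ph Z)) p"
    by (simp add: der_minus)
  then show ?thesis
    by (simp add: der_ip D_def ip_ph_left ip_sym[of _ Y])
qed

text \<open>The covariant derivative of \<open>ph_ph\<close>: up to the derivative of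
  \<open>\<eta> \<otimes> \<xi>\<close> on the right, \<open>D X\<close> anticommutes with
  \<open>ph\<close>.\<close>

lemma D_ph:
  assumes [simp]: "X \<in> V" "Y \<in> V"
  shows "D X (ph Y) + ph (D X Y) = sc (a X Y) xi + sc (ip Y xi) (al X)"
proof (rule eqI)
  fix Z p assume [simp]: "Z \<in> V"
  show "ip (D X (ph Y) + ph (D X Y)) Z p = ip (sc (a X Y) xi + sc (ip Y xi) (al X)) Z p"
    by (simp add: D_def ph_ph der_ip ip_sym[of Y] ip_sym[of xi "nb X Y"] algebra_simps)
qed auto

lemma D_ph_ip:
  assumes [simp]: "X \<in> V" "Y \<in> V" "Z \<in> V"
  shows "ip (D X (ph Y)) Z p = ip (D X Y) (ph Z) p + a X Y p * ip xi Z p + ip Y xi p * a X Z p"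
  using arg_cong[OF D_ph[of X Y], of "\<lambda>v. ip v Z p"] by (simp add: ip_ph_left)

text \<open>The fundamental form is exact, hence closed.\<close>

lemma D_cyclic:
  assumes [simp]: "X \<in> V" "Y \<in> V" "Z \<in> V"
  shows "ip (D X Y) Z p + ip (D Y Z) X p + ip (D Z X) Y p = 0"
proof -
  \<comment> \<open>Differentiating \<open>a_skew_part\<close> writes twice the derivative of the
    fundamental form as a difference of second covariant derivatives of \<open>xi\<close>.\<close>
  have d: "2 * ip (D C B) A p = (ip (nb C (al A)) B p - a (nb C A) B p) - (ip (nb C (al B)) A p - a (nb C B) A p)"
    if [simp]: "A \<in> V" "B \<in> V" "C \<in> V" for A B C
  proof -
    have "a A B = (\<lambda>p. a B A p + (ip A (ph B) p + ip A (ph B) p))"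
      using a_skew_part[of A B] by (simp add: fun_eq_iff algebra_simps)
    moreover have "der C (\<lambda>p. a B A p + (ip A (ph B) p + ip A (ph B) p)) p =
        der C (a B A) p + der C (\<lambda>p. ip A (ph B) p + ip A (ph B) p) p"
      by (rule der_add; (intro add_S)?; rule that ip_S; simp)
    moreover have "der C (\<lambda>p. ip A (ph B) p + ip A (ph B) p) p =
        der C (ip A (ph B)) p + der C (ip A (ph B)) p"
      by (rule der_add; simp)
    ultimately have "der C (a A B) p = der C (a B A) p + (der C (ip A (ph B)) p + der C (ip A (ph B)) p)"
      by (simp only:)
    then have "ip (nb C (al A)) B p + ip (al A) (nb C B) p = ip (nb C (al B)) A p + ip (al B) (nb C A) p
       + 2 * (ip (nb C A) (ph B) p + ip A (nb C (ph B)) p)"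
      by (simp add: der_ip)
    then show ?thesis
      using a_skew_part[of "nb C A" B p] a_skew_part[of A "nb C B" p]
      by (simp add: D_def ip_sym[of A] ip_ph_left)
  qed
  \<comment> \<open>In the cyclic sum these second derivatives pair up into curvature terms, which
    the Bianchi identity removes.\<close>
  have r: "(ip (nb A (al B)) C p - a (nb A B) C p) - (ip (nb B (al A)) C p - a (nb B A) C p) = - ip (R A B C) xi p"
    if [simp]: "A \<in> V" "B \<in> V" "C \<in> V" for A B C
    using R_skew[of A B xi C p] by (simp add: R_def)
  show ?thesis
    using d[of Z Y X] d[of X Z Y] d[of Y X Z] r[of X Z Y] r[of Y X Z] r[of Z Y X]
      bianchi_ip[of X Z Y xi p] by simp
qed

text \<open>The cyclic identity expresses \<open>\<nabla>\<^sub>\<xi>\<phi>\<close> by \<open>\<nabla>\<xi>\<close>; since \<open>\<nabla>\<^sub>\<xi>\<phi>\<close> anticommutes with \<open>\<phi>\<close>,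
  so does the symmetric part of \<open>\<nabla>\<xi>\<close>.\<close>

lemma a_ph_ph:
  assumes [simp]: "Y \<in> V" "Z \<in> V"
  shows "a (ph Y) (ph Z) p = - a Z Y p"
proof -
  have s: "ip (D xi A) B p = a A (ph B) p - a B (ph A) p" if [simp]: "A \<in> V" "B \<in> V" for A B
  proof -
    have [simp]: "D B xi = - ph (al B)"
      by (simp add: D_def)
    show ?thesis
      using D_cyclic[of xi A B p] D_skew[of A B xi p]
      by (simp add: ip_ph_left D_def)
  qed
  have "ip (D xi (ph Y)) Z p = ip (D xi Y) (ph Z) p"
    using D_ph_ip[of xi Y Z p] by simp
  then have "a (ph Y) (ph Z) p - a Z (ph (ph Y)) p = a Y (ph (ph Z)) p - a (ph Z) (ph Y) p"
    by (simp add: s)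
  then have "a (ph Y) (ph Z) p + a (ph Z) (ph Y) p + a Z Y p + a Y Z p = 0"
    by (simp add: ph_ph)
  moreover have "a (ph Y) (ph Z) p - a (ph Z) (ph Y) p = a Y Z p - a Z Y p"
    using a_skew_part[of "ph Y" "ph Z" p] a_skew_part[of Y Z p] by (simp add: ip_ph_ph)
  ultimately show ?thesis by simp
qed

lemma a_ph_left_sym:
  assumes [simp]: "Y \<in> V" "Z \<in> V"
  shows "a (ph Y) Z p = a (ph Z) Y p"
  using a_ph_ph[of Y "ph Z" p] by (simp add: ph_ph)

lemma a_ph_right_sym:
  assumes [simp]: "Y \<in> V" "Z \<in> V"
  shows "a Y (ph Z) p = a Z (ph Y) p"
  using a_ph_left_sym[of Y Z p] a_skew_part[of "ph Z" Y p] a_skew_part[of "ph Y" Z p]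
  by (simp add: ip_ph_ph ip_sym[of Z Y] mult.commute)

text \<open>With first entry \<open>xi\<close> the cyclic identity equates the pairing with
  \<open>a Y (ph Z) - a Z (ph Y)\<close>, which is zero by \<open>a_ph_right_sym\<close>.\<close>

lemma D_xi [simp]: "Y \<in> V \<Longrightarrow> D xi Y = 0"
proof (rule eqI)
  fix Z p assume [simp]: "Y \<in> V" "Z \<in> V"
  have "D Z xi = - ph (al Z)"
    by (simp add: D_def)
  then show "ip (D xi Y) Z p = ip 0 Z p"
    using D_cyclic[of xi Y Z p] D_skew[of Y Z xi p] a_ph_right_sym[of Y Z p]
    by (simp add: ip_ph_left D_def)
qed auto

text \<open>Since \<open>ph\<close> is skew, the tensor \<open>\<Sum>\<^sub>i ph E\<^sub>i \<otimes> E\<^sub>i\<close> is antisymmetric.\<close>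

lemma trace_ph_skew:
  assumes fr: "frame B N E" and b: "tensorial B b" and ph: "\<And>X. X \<in> B \<Longrightarrow> ph X \<in> B"
  shows "(\<Sum>i<N. b (ph (E i)) (E i) p) = - (\<Sum>i<N. b (E i) (ph (E i)) p)"
proof -
  have "(\<Sum>i<N. b (ph (E i)) (E i) p) = (\<Sum>i<N. \<Sum>j<N. ip (ph (E i)) (E j) p * b (E j) (E i) p)"
    by (intro sum.cong refl tensorial_expand_left[OF fr b] ph) (auto simp: frame_mem[OF fr])
  also have "\<dots> = (\<Sum>i<N. \<Sum>j<N. - (ip (ph (E j)) (E i) p * b (E j) (E i) p))"
  proof (intro sum.cong refl)
    fix i j assume "i \<in> {..<N}" "j \<in> {..<N}"
    then have "E i \<in> V" "E j \<in> V" using frame_memV[OF fr] by auto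
    then show "ip (ph (E i)) (E j) p * b (E j) (E i) p = - (ip (ph (E j)) (E i) p * b (E j) (E i) p)"
      by (simp add: ip_ph_left[of "E i"] ip_sym[of "E i" "ph (E j)"])
  qed
  also have "\<dots> = - (\<Sum>j<N. \<Sum>i<N. ip (ph (E j)) (E i) p * b (E j) (E i) p)"
    by (subst sum.swap) (simp add: sum_negf)
  also have "(\<Sum>j<N. \<Sum>i<N. ip (ph (E j)) (E i) p * b (E j) (E i) p) = (\<Sum>j<N. b (E j) (ph (E j)) p)"
    by (intro sum.cong refl tensorial_expand_right[OF fr b, symmetric] ph) (auto simp: frame_mem[OF fr])
  finally show ?thesis .
qed

lemma trace_ph_ph:
  assumes fr: "frame B N E" and b: "tensorial B b" and ph: "\<And>X. X \<in> B \<Longrightarrow> ph X \<in> B"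
    and ph_sc: "\<And>f X. f \<in> S \<Longrightarrow> X \<in> B \<Longrightarrow> ph (sc f X) = sc f (ph X)"
    and ph_add: "\<And>X Y. X \<in> B \<Longrightarrow> Y \<in> B \<Longrightarrow> ph (X + Y) = ph X + ph Y"
  shows "(\<Sum>i<N. b (ph (E i)) (ph (E i)) p) = - (\<Sum>i<N. b (E i) (ph (ph (E i))) p)"
proof -
  have "tensorial B (\<lambda>X Y. b X (ph Y))"
    using b unfolding tensorial_def by (simp add: ph_sc ph_add ph)
  from trace_ph_skew[OF fr this ph] show ?thesis by simp
qed

lemma tensorial_a: "submodule B \<Longrightarrow> tensorial B a"
  by (rule tensorialI) (auto simp: submodule_def subset_iff)

text \<open>The divergence of \<open>xi\<close>. The trace of \<open>a\<close> over the
  \<open>ph (E i)\<close> equals the trace over the \<open>E i\<close> by skewness of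
  \<open>ph\<close>, and its negative by \<open>a_ph_ph\<close>.\<close>

lemma trace_a:
  assumes fr: "frame V N E"
  shows "(\<Sum>i<N. a (E i) (E i) p) = 0"
proof -
  note m [simp] = frame_memV[OF fr]
  have "(\<Sum>i<N. a (ph (E i)) (ph (E i)) p) = - (\<Sum>i<N. a (E i) (ph (ph (E i))) p)"
    by (rule trace_ph_ph[OF fr tensorial_a]) simp_all
  moreover have "(\<Sum>i<N. a (ph (E i)) (ph (E i)) p) = - (\<Sum>i<N. a (E i) (E i) p)"
    by (simp add: a_ph_ph sum_negf)
  moreover have "(\<Sum>i<N. a (E i) (ph (ph (E i))) p) = - (\<Sum>i<N. a (E i) (E i) p)"
    by (simp add: ph_ph sum_negf)
  ultimately show ?thesis by simp
qed

text \<open>Moving \<open>ph\<close> to the other factor reverses the sign of the sum by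
  \<open>trace_ph_skew\<close>, but preserves it by \<open>D_ph_ip\<close>, whose extra terms add up
  to \<open>2 * ip xi (al Y) p = 0\<close>.\<close>

lemma trace_D_ph:
  assumes fr: "frame V N E" and [simp]: "Y \<in> V"
  shows "(\<Sum>i<N. ip (D Y (ph (E i))) (E i) p) = 0"
proof -
  note m [simp] = frame_memV[OF fr]
  have "tensorial V (\<lambda>X Z. ip (D Y Z) X)"
    by (rule tensorialI) (simp_all add: D_add D_sc)
  from trace_ph_skew[OF fr this] have "(\<Sum>i<N. ip (D Y (E i)) (ph (E i)) p) = - (\<Sum>i<N. ip (D Y (ph (E i))) (E i) p)"
    by simp
  moreover have "(\<Sum>i<N. ip (D Y (ph (E i))) (E i) p) = (\<Sum>i<N. ip (D Y (E i)) (ph (E i)) p +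
      2 * (ip xi (E i) p * ip (E i) (al Y) p))"
    by (intro sum.cong refl) (simp add: D_ph_ip ip_sym[of _ xi] ip_sym[of _ "al Y"])
  moreover have "(\<Sum>i<N. ip xi (E i) p * ip (E i) (al Y) p) = ip xi (al Y) p"
    using parseval[OF fr, of xi "al Y" p] by simp
  ultimately show ?thesis
    by (simp add: sum.distrib flip: sum_distrib_left)
qed

text \<open>Trace the cyclic identity over \<open>E i\<close>, \<open>Y\<close>,
  \<open>ph (E i)\<close>. The middle term vanishes by \<open>trace_D_ph\<close>. Through the last
  term the first one equals the sum in question; by skewness of \<open>D\<close> it also equals the
  negative of that sum.\<close>

lemma divergence_ph:
  assumes fr: "frame V N E" and Y [simp]: "Y \<in> V" and [simp]: "\<And>p. ip Y xi p = 0"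
  shows "(\<Sum>i<N. ip (D (E i) (E i)) (ph Y) p) = 0"
proof -
  note m [simp] = frame_memV[OF fr]
  have [simp]: "ip xi Y p = 0" for p by (simp add: ip_sym)
  have "tensorial V (\<lambda>X Z. ip (D X Z) Y)"
    by (rule tensorialI) (simp_all add: D_add D_sc)
  from trace_ph_skew[OF fr this]
  have 1: "(\<Sum>i<N. ip (D (ph (E i)) (E i)) Y p) = - (\<Sum>i<N. ip (D (E i) (ph (E i))) Y p)" by simp
  have s: "(\<Sum>i<N. ip (E i) xi p * a (E i) Y p) = 0"
    using tensorial_expand_left[OF fr tensorial_a, of xi Y p] by (simp add: ip_sym[of xi])
  have 2: "(\<Sum>i<N. ip (D (E i) (ph (E i))) Y p) = (\<Sum>i<N. ip (D (E i) (E i)) (ph Y) p)"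
    using s by (simp add: D_ph_ip sum.distrib)
  have "(\<Sum>i<N. ip (D (E i) Y) (ph (E i)) p + ip (D Y (ph (E i))) (E i) p + ip (D (ph (E i)) (E i)) Y p) = 0"
    by (simp add: D_cyclic)
  then have "(\<Sum>i<N. ip (D (E i) Y) (ph (E i)) p) = (\<Sum>i<N. ip (D (E i) (E i)) (ph Y) p)"
    using 1 2 trace_D_ph[OF fr Y, of p] by (simp add: sum.distrib)
  moreover have "(\<Sum>i<N. ip (D (E i) Y) (ph (E i)) p) = - (\<Sum>i<N. ip (D (E i) (E i)) (ph Y) p)"
    using 2 by (simp add: D_skew[of _ Y] sum_negf)
  ultimately show ?thesis by simp
qed

text \<open>In the notation of the paper, \<open>hh\<close> is \<open>h\<close>, \<open>Lap\<close> is \<open>- \<nabla>\<^sup>*\<nabla>\<xi>\<close> and \<open>divh\<close> is \<open>- \<delta>h\<close>;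
  below, \<open>tauv\<close> is \<open>\<tau>(\<xi>)\<close>, \<open>Tv\<close> is \<open>T(\<phi>)\<close> and \<open>tauJ\<close> is \<open>\<tau>(J)\<close>.\<close>

definition hh :: "'v \<Rightarrow> 'v" where
  "hh X = ph (al X) + ph (ph X)"

definition Lap :: "nat \<Rightarrow> (nat \<Rightarrow> 'v) \<Rightarrow> 'v" where
  "Lap N E = (\<Sum>i<N. nb (E i) (al (E i)) - al (nb (E i) (E i)))"

definition divh :: "nat \<Rightarrow> (nat \<Rightarrow> 'v) \<Rightarrow> 'v" where
  "divh N E = (\<Sum>i<N. nb (E i) (hh (E i)) - hh (nb (E i) (E i)))"

lemma hh_mem [simp]: "X \<in> V \<Longrightarrow> hh X \<in> V"
  by (simp add: hh_def)

lemma Lap_mem: "frame V N E \<Longrightarrow> Lap N E \<in> V"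
  unfolding Lap_def by (rule sum_mem) (simp add: frame_mem)

lemma divh_mem: "frame V N E \<Longrightarrow> divh N E \<in> V"
  unfolding divh_def by (rule sum_mem) (simp add: frame_mem)

text \<open>Obtained by differentiating \<open>ip (al X) xi = 0\<close>; it is the reason why
  tau(xi) has no \<open>xi\<close>-component.\<close>

lemma ip_Lap_xi:
  assumes fr: "frame V N E"
  shows "ip (Lap N E) xi p = - (\<Sum>i<N. ip (al (E i)) (al (E i)) p)"
proof -
  note m [simp] = frame_memV[OF fr]
  show ?thesis
    unfolding Lap_def
    by (subst ip_sum_left) (auto simp: sum_negf ip_nb_xi)
qed

text \<open>Makes the codifferential of \<open>h\<close> a contact section. Pairing
  \<open>al X\<close> with \<open>hh X\<close> leaves \<open>- a X X\<close>, because
  \<open>ph (al X)\<close> is orthogonal to \<open>al X\<close>, and the trace of \<open>a\<close>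
  is zero.\<close>

lemma divh_xi:
  assumes fr: "frame V N E"
  shows "ip (divh N E) xi p = 0"
proof -
  note m [simp] = frame_memV[OF fr]
  have "ip (hh X) xi p = 0" if "X \<in> V" for X p
    using that by (simp add: hh_def)
  moreover have "a X (hh X) p = - a X X p" if "X \<in> V" for X
    using that by (simp add: hh_def ph_ph)
  ultimately show ?thesis
    unfolding divh_def
    by (subst ip_sum_left) (auto simp: sum_negf ip_nb_xi trace_a[OF fr])
qed

text \<open>Differentiate both summands of \<open>hh\<close>. The first gives the derivative of
  \<open>ph\<close> and, after the outer \<open>ph\<close>, the term
  \<open>ph (ph (Lap N E))\<close>, that is, minus \<open>Lap N E\<close> plus its
  \<open>xi\<close>-component. From the second only the derivative of
  \<open>\<eta> \<otimes> \<xi>\<close> survives, and its trace is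
  \<open>ph (al xi) = 0\<close>.\<close>

lemma ph_divh:
  assumes fr: "frame V N E" and Z [simp]: "Z \<in> V"
  shows "ip (ph (divh N E)) Z p = (\<Sum>i<N. ip (ph (D (E i) (al (E i)))) Z p)
    - ip (Lap N E) Z p - (\<Sum>i<N. ip (al (E i)) (al (E i)) p) * ip xi Z p"
proof -
  note m [simp] = frame_memV[OF fr]
  have 1: "ip (ph (nb X (hh X) - hh (nb X X))) Z p = ip (ph (D X (al X))) Z p
     + ip (ph (ph (nb X (al X) - al (nb X X)))) Z p + ip X xi p * a X (- ph Z) p" if [simp]: "X \<in> V" for X
  proof -
    have "ip (ph (nb X (- X + sc (ip X xi) xi))) Z p = - ip (ph (nb X X)) Z p + ip X xi p * a X (- ph Z) p"
      by (simp add: ip_ph_left)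
    moreover have "ip (ph (ph (ph (nb X X)))) Z p = - ip (ph (nb X X)) Z p"
      by (simp add: ph_ph)
    ultimately show ?thesis
      by (simp add: hh_def D_def ph_ph[of X])
  qed
  have "(\<Sum>i<N. ip (E i) xi p * a (E i) (- ph Z) p) = 0"
    using tensorial_expand_left[OF fr tensorial_a, of xi "- ph Z" p] by (simp add: ip_sym[of xi])
  moreover have "ip (ph (divh N E)) Z p = (\<Sum>i<N. ip (ph (nb (E i) (hh (E i)) - hh (nb (E i) (E i)))) Z p)"
    unfolding divh_def by (subst ph_sum, simp, rule ip_sum_left) simp_all
  moreover have "\<dots> = (\<Sum>i<N. ip (ph (D (E i) (al (E i)))) Z p
      + ip (ph (ph (nb (E i) (al (E i)) - al (nb (E i) (E i))))) Z p + ip (E i) xi p * a (E i) (- ph Z) p)"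
    by (intro sum.cong refl 1 m) simp
  ultimately have "ip (ph (divh N E)) Z p = (\<Sum>i<N. ip (ph (D (E i) (al (E i)))) Z p)
      + (\<Sum>i<N. ip (ph (ph (nb (E i) (al (E i)) - al (nb (E i) (E i))))) Z p)"
    by (simp only: sum.distrib add_0_right)
  also have "(\<Sum>i<N. ip (ph (ph (nb (E i) (al (E i)) - al (nb (E i) (E i))))) Z p) = ip (ph (ph (Lap N E))) Z p"
    unfolding Lap_def by (subst ph_sum, simp, subst ph_sum, simp, rule ip_sum_left[symmetric]) simp_all
  finally show ?thesis
    by (simp add: ph_ph Lap_mem[OF fr] ip_Lap_xi[OF fr])
qed

text \<open>If \<open>h\<close> is zero then the derivative of \<open>xi\<close> is
  \<open>- ph\<close>, so \<open>Lap N E\<close> is minus the divergence of \<open>ph\<close>, which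
  points along \<open>xi\<close> by \<open>divergence_ph\<close>.\<close>

lemma Lap_K_contact:
  assumes fr: "frame V N E" and K: "\<And>X. X \<in> V \<Longrightarrow> hh X = 0" and [simp]: "Z \<in> V"
  shows "ip (Lap N E) Z p + (\<Sum>i<N. ip (al (E i)) (al (E i)) p) * ip xi Z p = 0"
proof -
  note m [simp] = frame_memV[OF fr]
  have al: "al X = - ph X" if [simp]: "X \<in> V" for X
  proof -
    show ?thesis
    proof (rule eqI)
      fix Z p assume "Z \<in> V"
      then show "ip (al X) Z p = ip (- ph X) Z p"
        using arg_cong[OF K[of X], of "\<lambda>v. ip (ph v) Z p"]
        by (simp add: hh_def ph_ph[of "al X"] ph_ph[of "ph X"])
    qed simp_all
  qed
  have L: "Lap N E = (\<Sum>i<N. - D (E i) (E i))"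
    unfolding Lap_def by (intro sum.cong refl) (simp add: al D_def)
  have LV [simp]: "Lap N E \<in> V" by (rule Lap_mem[OF fr])
  \<comment> \<open>Testing with \<open>ph (ph Z)\<close> discards the
    \<open>xi\<close>-component.\<close>
  have "ip (Lap N E) (ph (ph Z)) p = 0"
    unfolding L using divergence_ph[OF fr, of "ph Z" p]
    by (subst ip_sum_left) (auto simp: sum_negf)
  then have "ip (Lap N E) Z p = ip (Lap N E) xi p * ip Z xi p"
    by (simp add: ph_ph mult.commute)
  then show ?thesis
    by (simp add: ip_Lap_xi[OF fr] ip_sym[of xi])
qed

text \<open>\<open>Dd\<close> consists of the sections of the contact bundle; \<open>C\<close> is the induced connection in it,
  \<open>Q\<close> and \<open>M\<close> are the first and second covariant derivatives of \<open>J\<close>, and \<open>Rb\<close> is the curvature of \<open>C\<close>.\<close>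

definition Dd :: "'v set" where
  "Dd = {X \<in> V. \<forall>p. ip X xi p = 0}"

definition C :: "'v \<Rightarrow> 'v \<Rightarrow> 'v" where
  "C X Y = nb X Y - sc (ip (nb X Y) xi) xi"

definition Q :: "'v \<Rightarrow> 'v \<Rightarrow> 'v" where
  "Q X Y = C X (ph Y) - ph (C X Y)"

definition M :: "'v \<Rightarrow> 'v \<Rightarrow> 'v \<Rightarrow> 'v" where
  "M W X Z = (C W (Q X Z) - Q X (C W Z)) - Q (nb W X) Z"

definition Rb :: "'v \<Rightarrow> 'v \<Rightarrow> 'v \<Rightarrow> 'v" where
  "Rb X Y Z = (C X (C Y Z) - C (nb X Y) Z) - (C Y (C X Z) - C (nb Y X) Z)"

lemma DdV [simp]: "X \<in> Dd \<Longrightarrow> X \<in> V"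
  unfolding Dd_def by blast

lemma Dd_xi [simp]: "X \<in> Dd \<Longrightarrow> ip X xi p = 0"
  unfolding Dd_def by blast

lemma xi_Dd [simp]: "X \<in> Dd \<Longrightarrow> ip xi X p = 0"
  by (simp add: ip_sym[of xi X])

lemma DdI: "X \<in> V \<Longrightarrow> (\<And>p. ip X xi p = 0) \<Longrightarrow> X \<in> Dd"
  unfolding Dd_def by blast

lemma Dd_closed [simp]:
  "0 \<in> Dd"
  "X \<in> Dd \<Longrightarrow> Y \<in> Dd \<Longrightarrow> X + Y \<in> Dd"
  "X \<in> Dd \<Longrightarrow> Y \<in> Dd \<Longrightarrow> X - Y \<in> Dd"
  "X \<in> Dd \<Longrightarrow> - X \<in> Dd"
  "f \<in> S \<Longrightarrow> X \<in> Dd \<Longrightarrow> sc f X \<in> Dd"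
  "X \<in> V \<Longrightarrow> ph X \<in> Dd"
  "X \<in> V \<Longrightarrow> al X \<in> Dd"
  by (rule DdI; simp)+

lemma submodule_Dd [simp]: "submodule Dd"
  by (auto simp: submodule_def)

lemma C_Dd [simp]: "X \<in> V \<Longrightarrow> Y \<in> V \<Longrightarrow> C X Y \<in> Dd"
  by (rule DdI) (simp_all add: C_def mult.commute[of _ "ip xi xi _"] unit_ip)

lemma ip_C: "X \<in> V \<Longrightarrow> Y \<in> V \<Longrightarrow> Z \<in> Dd \<Longrightarrow> ip (C X Y) Z p = ip (nb X Y) Z p"
  by (simp add: C_def)

lemma ph_ph_Dd: "X \<in> Dd \<Longrightarrow> ph (ph X) = - X"
  by (rule eqI) (simp_all add: ph_ph)

lemma eqI_Dd:
  assumes "X \<in> Dd" "Y \<in> Dd" "\<And>Z p. Z \<in> Dd \<Longrightarrow> ip X Z p = ip Y Z p"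
  shows "X = Y"
  using ip_definite[of "X - Y"] assms by simp

lemma der_ip_C: "X \<in> V \<Longrightarrow> Y \<in> Dd \<Longrightarrow> Z \<in> Dd \<Longrightarrow>
    der X (ip Y Z) p = ip (C X Y) Z p + ip Y (C X Z) p"
  by (simp add: der_ip ip_C ip_sym[of Y "nb X Z"] ip_sym[of Y "C X Z"])

lemma C_add [simp]:
  assumes [simp]: "X \<in> V" "Y \<in> V" "Z \<in> V"
  shows "C (X + Y) Z = C X Z + C Y Z" "C Z (X + Y) = C Z X + C Z Y"
  by (rule eqI_Dd; simp add: ip_C)+

lemma C_diff [simp]:
  assumes [simp]: "X \<in> V" "Y \<in> V" "Z \<in> V"
  shows "C (X - Y) Z = C X Z - C Y Z" "C Z (X - Y) = C Z X - C Z Y"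
  by (rule eqI_Dd; simp add: ip_C)+

lemma C_sc [simp]:
  assumes [simp]: "X \<in> V" "f \<in> S"
  shows "Y \<in> V \<Longrightarrow> C (sc f X) Y = sc f (C X Y)"
    "Y \<in> Dd \<Longrightarrow> C X (sc f Y) = sc (der X f) Y + sc f (C X Y)"
  by (rule eqI_Dd; simp add: ip_C)+

lemma Q_Dd [simp]: "X \<in> V \<Longrightarrow> Y \<in> V \<Longrightarrow> Q X Y \<in> Dd"
  by (simp add: Q_def)

lemma ip_Q:
  assumes [simp]: "X \<in> V" "Y \<in> V" "Z \<in> Dd"
  shows "ip (Q X Y) Z p = ip (D X Y) Z p"
  by (simp add: Q_def D_def ip_C ip_ph_left)

lemma Q_add [simp]:
  assumes [simp]: "X \<in> V" "Y \<in> V" "Z \<in> V"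
  shows "Q (X + Y) Z = Q X Z + Q Y Z" "Q Z (X + Y) = Q Z X + Q Z Y"
  by (rule eqI_Dd; simp add: ip_Q D_add)+

lemma Q_sc [simp]:
  assumes [simp]: "X \<in> V" "Y \<in> V" "f \<in> S"
  shows "Q (sc f X) Y = sc f (Q X Y)" "Q X (sc f Y) = sc f (Q X Y)"
  by (rule eqI_Dd; simp add: ip_Q D_sc)+

lemma Q_skew: "X \<in> V \<Longrightarrow> Y \<in> Dd \<Longrightarrow> Z \<in> Dd \<Longrightarrow> ip (Q X Y) Z p = - ip (Q X Z) Y p"
  using D_skew[of X Y Z p] by (simp add: ip_Q)

lemma Q_cyclic:
  "X \<in> Dd \<Longrightarrow> Y \<in> Dd \<Longrightarrow> Z \<in> Dd \<Longrightarrow> ip (Q X Y) Z p + ip (Q Y Z) X p + ip (Q Z X) Y p = 0"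
  using D_cyclic[of X Y Z p] by (simp add: ip_Q)

text \<open>\<open>Q\<close> vanishes along \<open>xi\<close> by \<open>D_xi\<close>, so only the
  contact component of the first entry counts. This makes \<open>Q_cyclic\<close>, which is
  restricted to \<open>Dd\<close>, applicable to \<open>nb W X\<close>.\<close>

lemma Q_nb:
  assumes [simp]: "W \<in> V" "X \<in> V" "Y \<in> V"
  shows "Q (nb W X) Y = Q (C W X) Y"
proof -
  have "Q (sc (ip (nb W X) xi) xi) Y = 0"
    by (rule eqI_Dd) (simp_all add: ip_Q)
  moreover have "Q (nb W X) Y = Q (C W X + sc (ip (nb W X) xi) xi) Y"
    by (simp add: C_def)
  ultimately show ?thesis by (simp del: Q_sc)
qed

lemma M_Dd [simp]: "W \<in> V \<Longrightarrow> X \<in> V \<Longrightarrow> Y \<in> V \<Longrightarrow> M W X Y \<in> Dd"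
  by (simp add: M_def)

text \<open>Hence completing a contact frame by \<open>xi\<close> does not change the trace of
  \<open>M\<close>.\<close>

lemma M_xi:
  assumes [simp]: "Y \<in> V"
  shows "M xi xi Y = 0"
proof -
  have q: "Q xi Y = 0" if "Y \<in> V" for Y
    using that by (intro eqI_Dd) (simp_all add: ip_Q)
  have "Q 0 Y = 0"
    by (rule eqI_Dd) (simp_all add: ip_Q D_def)
  moreover have "C xi 0 = 0"
    by (rule eqI_Dd) (simp_all add: ip_C)
  ultimately show ?thesis by (simp add: M_def q)
qed

lemma tensorial_M:
  assumes [simp]: "Y \<in> Dd" "Z \<in> Dd"
  shows "tensorial V (\<lambda>W X. ip (M W X Y) Z)"
  by (rule tensorialI) (simp_all add: M_def algebra_simps)

lemma M_skew:
  assumes [simp]: "W \<in> V" "X \<in> V" "Y \<in> Dd" "Z \<in> Dd"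
  shows "ip (M W X Y) Z p = - ip (M W X Z) Y p"
proof -
  have "ip (Q X Y) Z = (\<lambda>p. - ip (Q X Z) Y p)"
    using Q_skew[of X Y Z] by (simp add: fun_eq_iff)
  then have "der W (ip (Q X Y) Z) p = - der W (ip (Q X Z) Y) p"
    by (simp add: der_minus)
  then show ?thesis
    using Q_skew[of X "C W Y" Z p] Q_skew[of X "C W Z" Y p] Q_skew[of "nb W X" Y Z p]
    by (simp add: M_def der_ip_C)
qed

text \<open>The derivative of \<open>Q_cyclic\<close>; the terms in which an argument is
  differentiated are again instances of \<open>Q_cyclic\<close>.\<close>

lemma M_cyclic:
  assumes [simp]: "W \<in> V" "X \<in> Dd" "Y \<in> Dd" "Z \<in> Dd"
  shows "ip (M W X Y) Z p + ip (M W Y Z) X p + ip (M W Z X) Y p = 0"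
proof -
  have "(\<lambda>p. (ip (Q X Y) Z p + ip (Q Y Z) X p) + ip (Q Z X) Y p) = (\<lambda>p. 0)"
    using Q_cyclic[of X Y Z] by (simp add: fun_eq_iff)
  then have "der W (\<lambda>p. (ip (Q X Y) Z p + ip (Q Y Z) X p) + ip (Q Z X) Y p) p = 0"
    by (simp add: der_zero)
  then have "der W (ip (Q X Y) Z) p + der W (ip (Q Y Z) X) p + der W (ip (Q Z X) Y) p = 0"
    by (simp add: der_add)
  then show ?thesis
    using Q_cyclic[of "C W X" Y Z p] Q_cyclic[of X "C W Y" Z p] Q_cyclic[of X Y "C W Z" p]
    by (simp add: M_def der_ip_C Q_nb)
qed

text \<open>The Ricci identity for \<open>J\<close>.\<close>

lemma M_ricci:
  assumes [simp]: "X \<in> V" "Y \<in> V" "Z \<in> V"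
  shows "M X Y Z - M Y X Z = Rb X Y (ph Z) - ph (Rb X Y Z)"
  by (simp add: M_def Q_def Rb_def)

lemma Rb_Dd [simp]: "X \<in> V \<Longrightarrow> Y \<in> V \<Longrightarrow> Z \<in> V \<Longrightarrow> Rb X Y Z \<in> Dd"
  by (simp add: Rb_def)

text \<open>The Gauss equation of the distribution: \<open>C\<close> drops from
  \<open>nb Y Z\<close> the component \<open>- a Y Z\<close> along \<open>xi\<close>, and
  differentiating the dropped term contributes \<open>al\<close>. The form \<open>a\<close> is not
  symmetric, since the contact bundle is not integrable.\<close>

lemma gauss:
  assumes [simp]: "X \<in> V" "Y \<in> V" "Z \<in> Dd" "W \<in> Dd"
  shows "ip (Rb X Y Z) W p = ip (R X Y Z) W p + a Y Z p * a X W p - a X Z p * a Y W p"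
proof -
  have "ip (C A (C B Z)) W p = ip (nb A (nb B Z)) W p + a B Z p * a A W p" if [simp]: "A \<in> V" "B \<in> V" for A B
  proof -
    have "ip (C A (C B Z)) W p = ip (nb A (nb B Z - sc (ip (nb B Z) xi) xi)) W p"
      by (simp add: ip_C del: nb_diff_right nb_sc_right) (simp add: C_def)
    then show ?thesis by (simp add: ip_nb_xi)
  qed
  then show ?thesis
    by (simp add: Rb_def R_def ip_C)
qed

lemma R_add:
  assumes [simp]: "X \<in> V" "Y \<in> V" "Z \<in> V" "W \<in> V"
  shows "R (X + W) Y Z = R X Y Z + R W Y Z" "R X (Y + W) Z = R X Y Z + R X W Z"
    "R X Y (Z + W) = R X Y Z + R X Y W"
  by (simp_all add: R_def algebra_simps)

lemma R_sc_ip: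
  assumes [simp]: "X \<in> V" "Y \<in> V" "Z \<in> V" "W \<in> V" "f \<in> S"
  shows "ip (R X (sc f Y) Z) W p = f p * ip (R X Y Z) W p"
    "ip (R X Y (sc f Z)) W p = f p * ip (R X Y Z) W p"
proof -
  show "ip (R X (sc f Y) Z) W p = f p * ip (R X Y Z) W p"
    by (simp add: R_swap[of X "sc f Y"] R_swap[of X Y] R_sc)
  show "ip (R X Y (sc f Z)) W p = f p * ip (R X Y Z) W p"
    by (simp add: R_pair[of X Y] R_sc)
qed

lemma tensorial_Rb:
  assumes [simp]: "X \<in> V" "W \<in> Dd"
  shows "tensorial Dd (\<lambda>Y Z. ip (Rb X Y Z) W)"
  by (rule tensorialI) (simp_all add: gauss R_add R_sc_ip algebra_simps)

lemma Rb_swap: "Rb Y X Z = - Rb X Y Z"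
  by (simp add: Rb_def)

lemma Rb_skew:
  assumes [simp]: "X \<in> V" "Y \<in> V" "Z \<in> Dd" "W \<in> Dd"
  shows "ip (Rb X Y Z) W p = - ip (Rb X Y W) Z p"
  using R_skew[of X Y Z W p] by (simp add: gauss)

text \<open>Equivalent to \<open>h\<close> anticommuting with \<open>\<phi>\<close>.\<close>

lemma al_ph:
  assumes [simp]: "X \<in> V"
  shows "al (ph X) = - ph (al X) - (ph (ph X) + ph (ph X))"
proof (rule eqI)
  fix Z p assume [simp]: "Z \<in> V"
  show "ip (al (ph X)) Z p = ip (- ph (al X) - (ph (ph X) + ph (ph X))) Z p"
    using a_skew_part[of "ph X" Z p] a_ph_right_sym[of X Z p]
    by (simp add: ip_ph_left[of "al X"] ip_ph_left[of "ph X"])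
qed simp_all

text \<open>The right-hand side is the Lie derivative of \<open>\<phi>\<close> along
  \<open>\<xi>\<close> once its term \<open>D xi X\<close> is known to vanish; this identifies
  \<open>hh\<close> with \<open>h\<close>.\<close>

lemma hh_eq: "X \<in> V \<Longrightarrow> hh X + hh X = ph (al X) - al (ph X)"
  by (simp add: hh_def al_ph algebra_simps)

section \<open>The fields tau(xi), T(phi) and tau(J) in the module\<close>

definition Tv :: "nat \<Rightarrow> (nat \<Rightarrow> 'v) \<Rightarrow> 'v" where
  "Tv N E = (\<Sum>i<N. Q (E i) (al (E i)))"

definition tauv :: "nat \<Rightarrow> (nat \<Rightarrow> 'v) \<Rightarrow> 'v" where
  "tauv N E = - Lap N E - sc (\<lambda>p. \<Sum>i<N. ip (al (E i)) (al (E i)) p) xi"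

lemma norm_al_S: "frame V N E \<Longrightarrow> (\<lambda>p. \<Sum>i<N. ip (al (E i)) (al (E i)) p) \<in> S"
  by (rule sum_S) (simp add: frame_memV)

lemma tauv_mem: "frame V N E \<Longrightarrow> tauv N E \<in> V"
  by (simp add: tauv_def norm_al_S Lap_mem)

lemma Tv_mem: "frame V N E \<Longrightarrow> Tv N E \<in> V"
  unfolding Tv_def by (rule sum_mem) (simp add: frame_memV)

lemma ph_divh_eq:
  assumes fr: "frame V N E"
  shows "ph (divh N E) = ph (Tv N E) + tauv N E"
proof (rule eqI)
  note m [simp] = frame_memV[OF fr]
  note [simp] = Tv_mem[OF fr] tauv_mem[OF fr] divh_mem[OF fr] Lap_mem[OF fr] norm_al_S[OF fr]
  show "ph (divh N E) \<in> V" "ph (Tv N E) + tauv N E \<in> V" by simp_all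
  fix Z p assume [simp]: "Z \<in> V"
  have "ip (Tv N E) (ph Z) p = (\<Sum>i<N. ip (Q (E i) (al (E i))) (ph Z) p)"
    unfolding Tv_def by (rule ip_sum_left) simp_all
  then have "ip (ph (Tv N E)) Z p = - (\<Sum>i<N. ip (Q (E i) (al (E i))) (ph Z) p)"
    by (simp add: ip_ph_left)
  also have "\<dots> = (\<Sum>i<N. ip (ph (D (E i) (al (E i)))) Z p)"
    unfolding sum_negf[symmetric] by (intro sum.cong refl) (simp add: ip_Q ip_ph_left)
  finally show "ip (ph (divh N E)) Z p = ip (ph (Tv N E) + tauv N E) Z p"
    by (simp add: ph_divh[OF fr] tauv_def)
qed

lemma tauv_K_contact:
  assumes fr: "frame V N E" and K: "\<And>X. X \<in> V \<Longrightarrow> hh X = 0"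
  shows "tauv N E = 0"
proof (rule eqI)
  fix Z p assume "Z \<in> V"
  then show "ip (tauv N E) Z p = ip 0 Z p"
    using Lap_K_contact[OF fr K, of Z p] by (simp add: tauv_def norm_al_S[OF fr] Lap_mem[OF fr])
qed (simp_all add: tauv_mem[OF fr])

definition tauJ :: "nat \<Rightarrow> (nat \<Rightarrow> 'v) \<Rightarrow> 'v \<Rightarrow> 'v" where
  "tauJ N E Y = - (\<Sum>i<N. M (E i) (E i) (ph Y)) - ph (- (\<Sum>i<N. M (E i) (E i) Y))"

lemma sum_Dd: "(\<And>i. i \<in> I \<Longrightarrow> X i \<in> Dd) \<Longrightarrow> (\<Sum>i\<in>I. X i) \<in> Dd"
  by (induction I rule: infinite_finite_induct) auto

lemma sum_M_Dd: "frame V N E \<Longrightarrow> Y \<in> V \<Longrightarrow> (\<Sum>i<N. M (E i) (E i) Y) \<in> Dd"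
  by (rule sum_Dd) (simp add: frame_memV)

lemma tauJ_Dd: "frame V N E \<Longrightarrow> Y \<in> V \<Longrightarrow> tauJ N E Y \<in> Dd"
  by (simp add: tauJ_def sum_M_Dd)

lemma ip_tauJ:
  assumes fr: "frame V N E" and [simp]: "Y \<in> Dd" "W \<in> Dd"
  shows "ip (tauJ N E Y) W p =
    - (\<Sum>i<N. ip (M (E i) (E i) (ph Y)) W p) - (\<Sum>i<N. ip (M (E i) (E i) Y) (ph W) p)"
proof -
  note [simp] = sum_M_Dd[OF fr] frame_memV[OF fr]
  have "ip (\<Sum>i<N. M (E i) (E i) Z) X p = (\<Sum>i<N. ip (M (E i) (E i) Z) X p)" if "Z \<in> V" "X \<in> V" for X Z
    by (rule ip_sum_left) (simp_all add: that)
  then show ?thesis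
    by (simp add: tauJ_def ip_ph_left)
qed

text \<open>Allows the frame in the second harmonic section equation to be replaced by a contact
  frame completed by \<open>xi\<close>.\<close>

lemma tauJ_frame_independent:
  assumes E: "frame V N E" and E': "frame V N' E'" and [simp]: "Y \<in> Dd"
  shows "tauJ N E Y = tauJ N' E' Y"
proof (rule eqI_Dd)
  fix W p assume [simp]: "W \<in> Dd"
  show "ip (tauJ N E Y) W p = ip (tauJ N' E' Y) W p"
    unfolding ip_tauJ[OF E \<open>Y \<in> Dd\<close> \<open>W \<in> Dd\<close>] ip_tauJ[OF E' \<open>Y \<in> Dd\<close> \<open>W \<in> Dd\<close>]
    using trace_frame_independent[OF E E' tensorial_M, of "ph Y" W p]
      trace_frame_independent[OF E E' tensorial_M, of Y "ph W" p] by simp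
qed (simp_all add: tauJ_Dd[OF E] tauJ_Dd[OF E'])

end

section \<open>The second harmonic section equation in a frame\<close>

text \<open>Besides the expansion, orthonormality enters as constancy of the inner products: those
  of fields extended by zero have the values 0 and 1 only on the open set.\<close>

locale contact_frame = contact_module V S sc ip der nb ph xi
  for V :: "'v::ab_group_add set"
    and S :: "('p \<Rightarrow> real) set"
    and sc ip der nb ph xi +
  fixes K :: nat and F :: "nat \<Rightarrow> 'v"
  assumes F: "frame Dd K F"
    and F_const: "X \<in> V \<Longrightarrow> i < K \<Longrightarrow> j < K \<Longrightarrow> der X (ip (F i) (F j)) p = 0"
begin

definition FX :: "nat \<Rightarrow> 'v" where "FX i = (if i < K then F i else xi)"

lemma F_Dd [simp]: "i < K \<Longrightarrow> F i \<in> Dd"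
  using frame_mem[OF F] .

lemma sum_FX: "(\<Sum>i<Suc K. f (FX i)) = (\<Sum>i<K. f (F i)) + f xi"
  by (simp add: FX_def)

lemma frame_FX: "frame V (Suc K) FX"
proof -
  have "X = (\<Sum>i<Suc K. sc (ip X (FX i)) (FX i))" if X [simp]: "X \<in> V" for X
  proof -
    define Y where "Y = X - sc (ip X xi) xi"
    have Y [simp]: "Y \<in> Dd"
      unfolding Y_def
      by (rule DdI) (simp_all add: mult.commute[of _ "ip xi xi _"] unit_ip)
    have e: "ip Y (F i) = ip X (F i)" if "i < K" for i
      using that by (simp add: Y_def fun_eq_iff)
    have "Y = (\<Sum>i<K. sc (ip Y (F i)) (F i))"
      using F Y by (simp add: frame_def del: Y)
    also have "\<dots> = (\<Sum>i<K. sc (ip X (F i)) (F i))"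
      using e by simp
    finally show ?thesis
      using sum_FX[of "\<lambda>Z. sc (ip X Z) Z"] by (simp add: Y_def algebra_simps)
  qed
  then show ?thesis
    by (simp add: frame_def FX_def)
qed

text \<open>The sum of the \<open>F i \<otimes> F i\<close> is parallel: constant inner products
  make the connection coefficients \<open>w\<close> skew, and they are paired with the
  symmetrisation of \<open>b\<close>.\<close>

lemma trace_parallel:
  assumes b: "tensorial Dd b" and X [simp]: "X \<in> V"
  shows "(\<Sum>i<K. b (F i) (C X (F i)) p + b (C X (F i)) (F i) p) = 0"
proof -
  define w where "w i j = ip (C X (F i)) (F j) p" for i j
  have w: "w i j = - w j i" if [simp]: "i < K" "j < K" for i j
    using F_const[of X i j p] der_ip_C[of X "F i" "F j" p] by (simp add: w_def ip_sym[of "F i"])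
  define s where "s = (\<Sum>i<K. \<Sum>j<K. w i j * (b (F i) (F j) p + b (F j) (F i) p))"
  have "s = (\<Sum>i<K. \<Sum>j<K. w j i * (b (F j) (F i) p + b (F i) (F j) p))"
    unfolding s_def by (rule sum.swap)
  also have "\<dots> = (\<Sum>i<K. \<Sum>j<K. - (w i j * (b (F i) (F j) p + b (F j) (F i) p)))"
  proof (intro sum.cong refl)
    fix i j assume "i \<in> {..<K}" "j \<in> {..<K}"
    then show "w j i * (b (F j) (F i) p + b (F i) (F j) p) = - (w i j * (b (F i) (F j) p + b (F j) (F i) p))"
      using w[of i j] by (simp add: add.commute)
  qed
  also have "\<dots> = - s"
    by (simp only: sum_negf s_def)
  finally have "s = 0" by simp
  moreover have "(\<Sum>i<K. b (F i) (C X (F i)) p + b (C X (F i)) (F i) p) = s"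
    unfolding s_def
  proof (intro sum.cong refl)
    fix i assume "i \<in> {..<K}"
    then have [simp]: "F i \<in> Dd" by simp
    show "b (F i) (C X (F i)) p + b (C X (F i)) (F i) p = (\<Sum>j<K. w i j * (b (F i) (F j) p + b (F j) (F i) p))"
      using tensorial_expand_left[OF F b, of "C X (F i)" "F i" p]
        tensorial_expand_right[OF F b, of "F i" "C X (F i)" p]
      by (simp add: w_def distrib_left sum.distrib)
  qed
  ultimately show ?thesis by simp
qed

lemma Q_divergence: "(\<Sum>i<K. Q (F i) (F i)) = 0"
proof (rule eqI_Dd)
  have "k \<le> K \<Longrightarrow> (\<Sum>i<k. Q (F i) (F i)) \<in> Dd" for k
    by (induction k) simp_all
  then show "(\<Sum>i<K. Q (F i) (F i)) \<in> Dd" by simp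
next
  fix Z p assume [simp]: "Z \<in> Dd"
  \<comment> \<open>\<open>divergence_ph\<close> tests only with vectors in the image of
    \<open>ph\<close>, but on \<open>Dd\<close> each \<open>Z\<close> is \<open>- ph (ph Z)\<close>.
    The summand of \<open>xi\<close> is zero.\<close>
  have "(\<Sum>i<Suc K. ip (D (FX i) (FX i)) (ph (ph Z)) p) = 0"
    by (rule divergence_ph[OF frame_FX]) simp_all
  then have "(\<Sum>i<K. ip (D (F i) (F i)) Z p) = 0"
    using sum_FX[of "\<lambda>X. ip (D X X) (ph (ph Z)) p"] by (simp add: ph_ph_Dd sum_negf)
  then show "ip (\<Sum>i<K. Q (F i) (F i)) Z p = ip 0 Z p"
    by (subst ip_sum_left) (auto simp: ip_Q)
qed simp

text \<open>The derivative of \<open>Q_divergence\<close> along \<open>Y\<close>; by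
  \<open>trace_parallel\<close> it may be taken under the trace.\<close>

lemma M_trace:
  assumes [simp]: "Y \<in> V" "Z \<in> Dd"
  shows "(\<Sum>i<K. ip (M Y (F i) (F i)) Z p) = 0"
proof -
  have "(\<Sum>i<K. ip (nb Y (Q (F i) (F i))) Z p) = ip (nb Y (\<Sum>i<K. Q (F i) (F i))) Z p"
    by (subst nb_sum_right, simp, simp, subst ip_sum_left) simp_all
  then have 1: "(\<Sum>i<K. ip (nb Y (Q (F i) (F i))) Z p) = 0"
    by (simp add: Q_divergence)
  have "tensorial Dd (\<lambda>X W. ip (Q X W) Z)"
    by (rule tensorialI) simp_all
  from trace_parallel[OF this, of Y p]
  have 2: "(\<Sum>i<K. ip (Q (F i) (C Y (F i))) Z p + ip (Q (C Y (F i)) (F i)) Z p) = 0" by simp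
  have "(\<Sum>i<K. ip (M Y (F i) (F i)) Z p) = (\<Sum>i<K. ip (nb Y (Q (F i) (F i))) Z p
      - (ip (Q (F i) (C Y (F i))) Z p + ip (Q (C Y (F i)) (F i)) Z p))"
    by (intro sum.cong refl) (simp add: M_def ip_C Q_nb)
  then show ?thesis
    using 1 2 by (simp only: sum_subtractf)
qed

section \<open>Ricci and \<open>*\<close>-Ricci contractions of the contact bundle\<close>

definition rho :: "'v \<Rightarrow> 'v \<Rightarrow> 'p \<Rightarrow> real" where
  "rho Y Z p = (\<Sum>i<K. ip (Rb (F i) Y Z) (F i) p)"

definition rho_star :: "'v \<Rightarrow> 'v \<Rightarrow> 'p \<Rightarrow> real" where
  "rho_star Y Z p = (\<Sum>i<K. ip (Rb Y (F i) (ph (F i))) (ph Z) p)"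

lemma trace_a_F: "(\<Sum>i<K. a (F i) (F i) p) = 0"
  using trace_a[OF frame_FX, of p] sum_FX[of "\<lambda>X. a X X p"] by simp

lemma sum_a:
  assumes [simp]: "Y \<in> Dd" "Z \<in> Dd"
  shows "(\<Sum>i<K. ip Y (F i) p * a (F i) Z p) = a Y Z p"
  using tensorial_expand_left[OF F tensorial_a, of Y Z p] by simp

text \<open>The \<open>R\<close> part is symmetric by pair symmetry. Of the Gauss terms, the one
  with the trace of \<open>a\<close> vanishes, and the two quadratic ones agree by
  \<open>a_skew_part\<close> and \<open>a_ph_right_sym\<close>.\<close>

lemma rho_sym:
  assumes [simp]: "Y \<in> Dd" "Z \<in> Dd"
  shows "rho Y Z p = rho Z Y p"
proof -
  have "(\<Sum>i<K. ip (Rb (F i) Y Z) (F i) p) = (\<Sum>i<K. ip (Rb (F i) Z Y) (F i) p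
      + (a Y Z p - a Z Y p) * a (F i) (F i) p - ip (al Y) (F i) p * a (F i) Z p + ip (al Z) (F i) p * a (F i) Y p)"
  proof (intro sum.cong refl)
    fix i assume "i \<in> {..<K}"
    then have [simp]: "F i \<in> Dd" by simp
    have "ip (R (F i) Y Z) (F i) p = ip (R (F i) Z Y) (F i) p"
      using R_pair[of "F i" Y Z "F i" p] R_skew[of Z "F i" "F i" Y p] by (simp add: R_swap[of Z "F i"])
    then show "ip (Rb (F i) Y Z) (F i) p = ip (Rb (F i) Z Y) (F i) p
      + (a Y Z p - a Z Y p) * a (F i) (F i) p - ip (al Y) (F i) p * a (F i) Z p + ip (al Z) (F i) p * a (F i) Y p"
      by (simp add: gauss algebra_simps)
  qed
  also have "\<dots> = rho Z Y p - a (al Y) Z p + a (al Z) Y p"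
    by (simp add: rho_def sum.distrib sum_subtractf sum_a trace_a_F flip: sum_distrib_left)
  also have "a (al Y) Z p = a (al Z) Y p"
    using a_skew_part[of "al Y" Z p] a_skew_part[of "al Z" Y p] a_ph_right_sym[of Y Z p]
    by (simp add: ip_sym[of Z] ip_sym[of Y] ip_sym[of "al Z" "al Y"])
  finally show ?thesis by (simp add: rho_def)
qed

text \<open>With \<open>R\<close> in place of \<open>Rb\<close>, pair symmetry and skewness of
  \<open>ph\<close> under the trace would exchange the arguments exactly. The Gauss terms disturb
  this by expressions symmetric in \<open>Y\<close> and \<open>Z\<close>, which drop out of the
  difference.\<close>

lemma rho_star_ph:
  assumes [simp]: "Y \<in> Dd" "Z \<in> Dd"
  shows "rho_star (ph Y) (ph Z) p - rho_star (ph Z) (ph Y) p = rho_star Z Y p - rho_star Y Z p"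
proof -
  define c where "c = (\<Sum>i<K. a (ph (F i)) (F i) p)"
  define c' where "c' = (\<Sum>i<K. a (F i) (ph (F i)) p)"
  have e: "rho_star (ph Y) (ph Z) p = rho_star Z Y p + a (ph Y) Z p * c - a Z (ph Y) p * c'
      - ip (al (ph Z)) (al (ph Y)) p + ip (al Y) (al Z) p"
    if [simp]: "Y \<in> Dd" "Z \<in> Dd" for Y Z
  proof -
    have "rho_star (ph Y) (ph Z) p = - (\<Sum>i<K. ip (Rb (ph Y) (F i) (ph (F i))) Z p)"
      by (simp add: rho_star_def ph_ph_Dd sum_negf)
    \<comment> \<open>Moves \<open>ph\<close> from the third entry to the second, so that pair
      symmetry of \<open>R\<close> returns a \<open>*\<close>-Ricci summand.\<close>
    also have "\<dots> = (\<Sum>i<K. ip (Rb (ph Y) (ph (F i)) (F i)) Z p)"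
      using trace_ph_skew[OF F tensorial_Rb[of "ph Y" Z], of p] by simp
    also have "\<dots> = (\<Sum>i<K. ip (Rb Z (F i) (ph (F i))) (ph Y) p + a (ph Y) Z p * a (ph (F i)) (F i) p
        - a Z (ph Y) p * a (F i) (ph (F i)) p
        - ip (ph (al (ph Y))) (ph (F i)) p * a (ph (F i)) Z p
        - ip (ph (al Z)) (F i) p * a (F i) (ph Y) p)"
    proof (intro sum.cong refl)
      fix i assume "i \<in> {..<K}"
      then have [simp]: "F i \<in> Dd" by simp
      have "ip (R (ph Y) (ph (F i)) (F i)) Z p = ip (R Z (F i) (ph (F i))) (ph Y) p"
        using R_pair[of "ph Y" "ph (F i)" "F i" Z p] R_skew[of Z "F i" "ph (F i)" "ph Y" p]
        by (simp add: R_swap[of Z "F i"])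
      then show "ip (Rb (ph Y) (ph (F i)) (F i)) Z p =
        ip (Rb Z (F i) (ph (F i))) (ph Y) p + a (ph Y) Z p * a (ph (F i)) (F i) p
        - a Z (ph Y) p * a (F i) (ph (F i)) p
        - ip (ph (al (ph Y))) (ph (F i)) p * a (ph (F i)) Z p
        - ip (ph (al Z)) (F i) p * a (F i) (ph Y) p"
        by (simp add: gauss ip_ph_ph ip_ph_left[of "al Z"] algebra_simps)
    qed
    also have "\<dots> = rho_star Z Y p + a (ph Y) Z p * c - a Z (ph Y) p * c'
        - (\<Sum>i<K. ip (ph (al (ph Y))) (ph (F i)) p * a (ph (F i)) Z p)
        - (\<Sum>i<K. ip (ph (al Z)) (F i) p * a (F i) (ph Y) p)"
      by (simp add: rho_star_def c_def c'_def sum.distrib sum_subtractf sum_distrib_left sum_negf)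
    also have "(\<Sum>i<K. ip (ph (al (ph Y))) (ph (F i)) p * a (ph (F i)) Z p) =
        (\<Sum>i<K. ip (al (ph Y)) (F i) p * a (ph (F i)) Z p)"
      by (intro sum.cong refl) (simp add: ip_ph_ph)
    also have "\<dots> = ip (al (ph Z)) (al (ph Y)) p"
    proof -
      have "(\<Sum>i<K. ip (al (ph Y)) (F i) p * a (ph (F i)) Z p) = (\<Sum>i<K. ip (al (ph Y)) (F i) p * ip (F i) (al (ph Z)) p)"
        by (intro sum.cong refl) (simp add: a_ph_left_sym[of _ Z] ip_sym[of _ "al (ph Z)"])
      then show ?thesis
        using parseval[OF F, of "al (ph Y)" "al (ph Z)" p] by (simp add: ip_sym[of "al (ph Z)"])
    qed
    also have "(\<Sum>i<K. ip (ph (al Z)) (F i) p * a (F i) (ph Y) p) = - ip (al Y) (al Z) p"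
      by (simp add: sum_a a_ph_ph)
    finally show ?thesis by simp
  qed
  show ?thesis
    using e[of Y Z] e[of Z Y] a_ph_left_sym[of Y Z p] a_ph_right_sym[of Y Z p]
    by (simp add: ip_sym[of "al Z" "al Y"] ip_sym[of "al (ph Z)" "al (ph Y)"])
qed

lemma M_laplacian:
  assumes [simp]: "Y \<in> Dd" "Z \<in> Dd"
  shows "(\<Sum>i<K. ip (M (F i) (F i) Y) Z p) =
    rho Z (ph Y) p - rho Y (ph Z) p + rho_star Y (ph Z) p - rho_star Z (ph Y) p"
proof -
  \<comment> \<open>Exchanging the first two entries of \<open>M\<close> costs a curvature
    commutator by \<open>M_ricci\<close>. The exchanged trace vanishes by \<open>M_trace\<close>;
    the two halves of the commutator contract to \<open>rho\<close> and
    \<open>rho_star\<close>.\<close>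
  have s: "(\<Sum>i<K. ip (M (F i) Y Z) (F i) p) = rho Y (ph Z) p - rho_star Y (ph Z) p"
    if [simp]: "Y \<in> Dd" "Z \<in> Dd" for Y Z
  proof -
    have "(\<Sum>i<K. ip (M (F i) Y Z) (F i) p) = (\<Sum>i<K. ip (Rb (F i) Y (ph Z)) (F i) p
        - ip (Rb Y (F i) (ph (F i))) (ph (ph Z)) p - ip (M Y (F i) (F i)) Z p)"
    proof (intro sum.cong refl)
      fix i assume "i \<in> {..<K}"
      then have [simp]: "F i \<in> Dd" by simp
      show "ip (M (F i) Y Z) (F i) p = ip (Rb (F i) Y (ph Z)) (F i) p
        - ip (Rb Y (F i) (ph (F i))) (ph (ph Z)) p - ip (M Y (F i) (F i)) Z p"
        using arg_cong[OF M_ricci[of "F i" Y Z], of "\<lambda>v. ip v (F i) p"] M_skew[of Y "F i" Z "F i" p]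
          Rb_skew[of Y "F i" "ph (F i)" Z p]
        by (simp add: ip_ph_left[of "Rb (F i) Y Z"] ph_ph_Dd Rb_swap[of Y "F i"])
    qed
    then show ?thesis
      by (simp add: rho_def rho_star_def sum_subtractf M_trace)
  qed
  have "(\<Sum>i<K. ip (M (F i) (F i) Y) Z p) = (\<Sum>i<K. ip (M (F i) Z Y) (F i) p - ip (M (F i) Y Z) (F i) p)"
  proof (intro sum.cong refl)
    fix i assume "i \<in> {..<K}"
    then have [simp]: "F i \<in> Dd" by simp
    \<comment> \<open>The cyclic identity separates the two copies of \<open>F i\<close>: only one
      remains a direction of differentiation, so \<open>s\<close> applies.\<close>
    show "ip (M (F i) (F i) Y) Z p = ip (M (F i) Z Y) (F i) p - ip (M (F i) Y Z) (F i) p"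
      using M_cyclic[of "F i" "F i" Y Z p] M_skew[of "F i" Z "F i" Y p] by simp
  qed
  then show ?thesis
    by (simp add: s sum_subtractf)
qed

text \<open>The \<open>rho\<close> terms cancel by symmetry, and \<open>rho_star_ph\<close> makes
  the two differences of \<open>rho_star\<close> equal, whence the factor 2.\<close>

theorem M_laplacian_commutator:
  assumes [simp]: "Y \<in> Dd" "Z \<in> Dd"
  shows "(\<Sum>i<K. ip (M (F i) (F i) Y) Z p) - (\<Sum>i<K. ip (M (F i) (F i) (ph Y)) (ph Z) p) =
    2 * (rho_star Y (ph Z) p - rho_star (ph Z) Y p)"
proof -
  have m: "rho_star (- A) B p = - rho_star A B p" "rho_star A (- B) p = - rho_star A B p"
    "rho A (- B) p = - rho A B p" if [simp]: "A \<in> Dd" "B \<in> Dd" for A B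
  proof -
    show "rho_star (- A) B p = - rho_star A B p"
      unfolding rho_star_def sum_negf[symmetric]
      by (intro sum.cong refl) (simp add: gauss R_def algebra_simps)
    show "rho_star A (- B) p = - rho_star A B p"
      by (simp add: rho_star_def sum_negf)
    show "rho A (- B) p = - rho A B p"
      unfolding rho_def sum_negf[symmetric]
      by (intro sum.cong refl) (simp add: gauss R_def algebra_simps)
  qed
  show ?thesis
    using rho_sym[of Y "ph Z" p] rho_sym[of Z "ph Y" p] rho_star_ph[of "ph Y" Z p]
    by (simp add: M_laplacian ph_ph_Dd m)
qed

theorem tauJ_rho_star:
  assumes [simp]: "Y \<in> Dd" "W \<in> Dd"
  shows "ip (tauJ (Suc K) FX Y) W p = 2 * (rho_star Y W p - rho_star W Y p)"
proof -
  have "ip (tauJ (Suc K) FX Y) W p = - (\<Sum>i<K. ip (M (F i) (F i) (ph Y)) W p) - (\<Sum>i<K. ip (M (F i) (F i) Y) (ph W) p)"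
    using ip_tauJ[OF frame_FX, of Y W p] sum_FX[of "\<lambda>X. ip (M X X (ph Y)) W p"]
      sum_FX[of "\<lambda>X. ip (M X X Y) (ph W) p"] by (simp add: M_xi)
  then show ?thesis
    \<comment> \<open>For \<open>Z = - ph W\<close> one has \<open>ph Z = W\<close>, which produces
      both sums at once.\<close>
    using M_laplacian_commutator[of Y "- ph W" p] by (simp add: ph_ph_Dd sum_negf)
qed

end

section \<open>Calculus on the manifold\<close>

lemma Ck_on_cong:
  assumes "open S" "\<And>x. x \<in> S \<Longrightarrow> f x = g x" "Ck_on k f S"
  shows "Ck_on k g S"
  using assms(2,3)
proof (induction k arbitrary: f g)
  case 0
  then show ?case by (simp cong: continuous_on_cong)
next
  case (Suc k)
  have d: "f differentiable (at x)" if "x \<in> S" for x using Suc.prems(2) that by simp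
  have "g differentiable (at x)" if x: "x \<in> S" for x
  proof -
    obtain D where "(f has_derivative D) (at x)" using d[OF x] unfolding differentiable_def by blast
    then have "(g has_derivative D) (at x)"
      by (rule has_derivative_transform_within_open) (use assms(1) x Suc.prems(1) in auto)
    then show ?thesis unfolding differentiable_def by blast
  qed
  moreover have "Ck_on k (\<lambda>x. frechet_derivative g (at x) w) S" for w
  proof (rule Suc.IH)
    show "Ck_on k (\<lambda>x. frechet_derivative f (at x) w) S" using Suc.prems(2) by simp
    show "frechet_derivative f (at x) w = frechet_derivative g (at x) w" if "x \<in> S" for x
      using frechet_derivative_transform_within_open[OF d[OF that] assms(1) that Suc.prems(1)] by simp
  qed
  ultimately show ?case by simp
qed

lemma Ck_on_subset: "Ck_on k f S \<Longrightarrow> T \<subseteq> S \<Longrightarrow> Ck_on k f T"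
proof (induction k arbitrary: f)
  case 0
  then show ?case by (auto intro: continuous_on_subset)
qed auto

lemma Ck_on_SucD: "Ck_on (Suc k) f S \<Longrightarrow> Ck_on k f S"
proof (induction k arbitrary: f)
  case 0
  then show ?case
    by (auto intro!: continuous_at_imp_continuous_on differentiable_imp_continuous_within)
qed auto

lemma Ck_on_const: "Ck_on k (\<lambda>x. c) S"
proof (induction k arbitrary: c)
  case (Suc k)
  then show ?case by simp
qed simp

lemma Ck_on_add:
  assumes "open S" "Ck_on k f S" "Ck_on k g S"
  shows "Ck_on k (\<lambda>x. f x + g x) S"
  using assms(2,3)
proof (induction k arbitrary: f g)
  case 0
  then show ?case by (simp add: continuous_on_add)
next
  case (Suc k)
  have d: "f differentiable (at x)" "g differentiable (at x)" if "x \<in> S" for x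
    using Suc.prems that by auto
  have "Ck_on k (\<lambda>x. frechet_derivative (\<lambda>x. f x + g x) (at x) w) S" for w
  proof (rule Ck_on_cong[OF assms(1)])
    show "Ck_on k (\<lambda>x. frechet_derivative f (at x) w + frechet_derivative g (at x) w) S"
      using Suc by simp
    show "frechet_derivative f (at x) w + frechet_derivative g (at x) w =
        frechet_derivative (\<lambda>x. f x + g x) (at x) w" if "x \<in> S" for x
      using fun_cong[OF frechet_derivative_at[OF has_derivative_add[OF d[OF that, unfolded frechet_derivative_works]]], of w]
      by simp
  qed
  then show ?case using d by simp
qed

lemma Ck_on_mult:
  fixes f g :: "'e::euclidean_space \<Rightarrow> real"
  assumes "open S" "Ck_on k f S" "Ck_on k g S"
  shows "Ck_on k (\<lambda>x. f x * g x) S"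
  using assms(2,3)
proof (induction k arbitrary: f g)
  case 0
  then show ?case by (simp add: continuous_on_mult)
next
  case (Suc k)
  have d: "f differentiable (at x)" "g differentiable (at x)" if "x \<in> S" for x
    using Suc.prems that by auto
  have "Ck_on k (\<lambda>x. frechet_derivative (\<lambda>x. f x * g x) (at x) w) S" for w
  proof (rule Ck_on_cong[OF assms(1)])
    show "Ck_on k (\<lambda>x. f x * frechet_derivative g (at x) w + frechet_derivative f (at x) w * g x) S"
      using Suc.prems by (intro Ck_on_add Suc.IH assms(1)) (auto dest: Ck_on_SucD simp del: Ck_on.simps, auto)
    show "f x * frechet_derivative g (at x) w + frechet_derivative f (at x) w * g x =
        frechet_derivative (\<lambda>x. f x * g x) (at x) w" if "x \<in> S" for x
      using fun_cong[OF frechet_derivative_at[OF has_derivative_mult[OF d[OF that, unfolded frechet_derivative_works]]], of w]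
      by simp
  qed
  then show ?case using d by simp
qed

text \<open>All orders of \<open>f\<close> are assumed so that \<open>f\<close> stays fixed in the
  induction: the derivative of \<open>1/f\<close> is minus the derivative of \<open>f\<close> times
  two factors \<open>1/f\<close>, which the induction hypothesis covers.\<close>

lemma Ck_on_inverse:
  fixes f :: "'e::euclidean_space \<Rightarrow> real"
  assumes "open S" "\<And>k. Ck_on k f S" "\<And>x. x \<in> S \<Longrightarrow> f x \<noteq> 0"
  shows "Ck_on k (\<lambda>x. inverse (f x)) S"
proof (induction k)
  case 0
  then show ?case using assms(2)[of 0] assms(3) by (simp add: continuous_on_inverse)
next
  case (Suc k)
  have d: "f differentiable (at x)" if "x \<in> S" for x
    using assms(2)[of "Suc 0"] that by auto
  have "Ck_on k (\<lambda>x. frechet_derivative (\<lambda>x. inverse (f x)) (at x) w) S" for w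
  proof (rule Ck_on_cong[OF assms(1)])
    show "Ck_on k (\<lambda>x. (- 1) * (inverse (f x) * frechet_derivative f (at x) w * inverse (f x))) S"
      using assms(2)[of "Suc k"] by (intro Ck_on_mult Ck_on_const Suc assms(1)) auto
    show "(- 1) * (inverse (f x) * frechet_derivative f (at x) w * inverse (f x)) =
        frechet_derivative (\<lambda>x. inverse (f x)) (at x) w" if "x \<in> S" for x
      using fun_cong[OF frechet_derivative_at[OF Deriv.has_derivative_inverse[OF assms(3)[OF that] d[OF that, unfolded frechet_derivative_works]]], of w]
      by simp
  qed
  then show ?case using d assms(3) by (simp add: differentiable_inverse)
qed

section \<open>Smooth functions on the manifold\<close>

locale manifold =
  fixes A :: "('m::{t2_space,second_countable_topology}, 'e::euclidean_space) atlas"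
  assumes A: "smooth_manifold A"
begin

lemma chart:
  assumes "(V, c) \<in> A"
  shows "open V" "open (c ` V)" "homeomorphism V (c ` V) c (inv_into V c)" "inj_on c V"
    "continuous_on V c"
proof -
  show *: "open V" "open (c ` V)" "homeomorphism V (c ` V) c (inv_into V c)"
    using A assms unfolding smooth_manifold_def by blast+
  show "inj_on c V" "continuous_on V c"
    using *(3) unfolding homeomorphism_def inj_on_def by metis+
qed

lemma chart_at:
  obtains V c where "(V, c) \<in> A" "p \<in> V"
  using A unfolding smooth_manifold_def by blast

lemma open_chart_image:
  assumes "(V, c) \<in> A" "open U"
  shows "open (c ` (U \<inter> V))"
proof -
  have "openin (top_of_set (c ` V)) (c ` (U \<inter> V))"
    using homeomorphism_imp_open_map[OF chart(3)[OF assms(1)], of "U \<inter> V"] openin_open_Int[OF assms(2), of V]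
    by (simp add: Int_commute)
  then show ?thesis
    using chart(2)[OF assms(1)] openin_open_eq by blast
qed

lemma smooth_funD:
  "smooth_fun A U f \<Longrightarrow> (V, c) \<in> A \<Longrightarrow> Ck_on k (f \<circ> inv_into V c) (c ` (U \<inter> V))"
  unfolding smooth_fun_def smooth_on_def by blast

lemma smooth_funI:
  "(\<And>V c k. (V, c) \<in> A \<Longrightarrow> Ck_on k (f \<circ> inv_into V c) (c ` (U \<inter> V))) \<Longrightarrow> smooth_fun A U f"
  unfolding smooth_fun_def smooth_on_def by blast

lemma smooth_fun_subset: "smooth_fun A U f \<Longrightarrow> W \<subseteq> U \<Longrightarrow> smooth_fun A W f"
  by (rule smooth_funI, rule Ck_on_subset, erule (1) smooth_funD) auto

lemma smooth_fun_cong: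
  assumes "open U" "\<And>p. p \<in> U \<Longrightarrow> f p = k p" "smooth_fun A U f"
  shows "smooth_fun A U k"
proof (rule smooth_funI)
  fix V c j assume c: "(V, c) \<in> A"
  show "Ck_on j (k \<circ> inv_into V c) (c ` (U \<inter> V))"
    using assms(2) chart(4)[OF c]
    by (intro Ck_on_cong[OF open_chart_image[OF c assms(1)] _ smooth_funD[OF assms(3) c]]) auto
qed

lemma smooth_fun_const: "smooth_fun A U (\<lambda>p. a)"
  by (rule smooth_funI) (simp add: comp_def Ck_on_const)

lemma smooth_fun_add:
  assumes "open U" "smooth_fun A U f" "smooth_fun A U k"
  shows "smooth_fun A U (\<lambda>p. f p + k p)"
proof (rule smooth_funI)
  fix V c j assume c: "(V, c) \<in> A"
  show "Ck_on j ((\<lambda>p. f p + k p) \<circ> inv_into V c) (c ` (U \<inter> V))"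
    using Ck_on_add[OF open_chart_image[OF c assms(1)] smooth_funD[OF assms(2) c] smooth_funD[OF assms(3) c]]
    by (simp add: comp_def)
qed

lemma smooth_fun_mult:
  assumes "open U" "smooth_fun A U f" "smooth_fun A U k"
  shows "smooth_fun A U (\<lambda>p. f p * k p)"
proof (rule smooth_funI)
  fix V c j assume c: "(V, c) \<in> A"
  show "Ck_on j ((\<lambda>p. f p * k p) \<circ> inv_into V c) (c ` (U \<inter> V))"
    using Ck_on_mult[OF open_chart_image[OF c assms(1)] smooth_funD[OF assms(2) c] smooth_funD[OF assms(3) c]]
    by (simp add: comp_def)
qed

lemma smooth_fun_uminus: "open U \<Longrightarrow> smooth_fun A U f \<Longrightarrow> smooth_fun A U (\<lambda>p. - f p)"
  using smooth_fun_mult[OF _ smooth_fun_const[of U "- 1"], of f] by simp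

lemma smooth_fun_inverse:
  assumes "open U" "smooth_fun A U f" "\<And>p. p \<in> U \<Longrightarrow> f p \<noteq> 0"
  shows "smooth_fun A U (\<lambda>p. inverse (f p))"
proof (rule smooth_funI)
  fix V c j assume c: "(V, c) \<in> A"
  have "(f \<circ> inv_into V c) x \<noteq> 0" if "x \<in> c ` (U \<inter> V)" for x
    using that assms(3) chart(4)[OF c] by auto
  from Ck_on_inverse[OF open_chart_image[OF c assms(1)] smooth_funD[OF assms(2) c] this]
  show "Ck_on j ((\<lambda>p. inverse (f p)) \<circ> inv_into V c) (c ` (U \<inter> V))"
    by (simp add: comp_def)
qed

lemma smooth_fun_continuous:
  assumes "open U" "smooth_fun A U f"
  shows "continuous_on U f"
proof -
  have "\<exists>T. open T \<and> p \<in> T \<and> continuous_on (U \<inter> T) f" if "p \<in> U" for p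
  proof -
    obtain V c where c: "(V, c) \<in> A" "p \<in> V" by (rule chart_at)
    have "continuous_on (c ` (U \<inter> V)) (f \<circ> inv_into V c)"
      using smooth_funD[OF assms(2) c(1), of 0] by simp
    moreover have "continuous_on (U \<inter> V) c"
      using chart(5)[OF c(1)] by (rule continuous_on_subset) auto
    ultimately have "continuous_on (U \<inter> V) ((f \<circ> inv_into V c) \<circ> c)"
      by (rule continuous_on_compose[rotated])
    then have "continuous_on (U \<inter> V) f"
      by (rule continuous_on_eq) (use chart(4)[OF c(1)] in auto)
    then show ?thesis using chart(1)[OF c(1)] c(2) by blast
  qed
  then have "continuous (at p) f" if "p \<in> U" for p
    using that assms(1) by (metis IntI continuous_on_eq_continuous_at open_Int)
  then show ?thesis by (simp add: continuous_at_imp_continuous_on)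
qed

lemma smooth_fun_near: "open U \<Longrightarrow> p \<in> U \<Longrightarrow> smooth_fun A U f \<Longrightarrow> smooth_near A p f"
  unfolding smooth_near_def by blast

lemma smooth_near_cong:
  assumes "open W" "p \<in> W" "\<And>q. q \<in> W \<Longrightarrow> f q = k q" "smooth_near A p f"
  shows "smooth_near A p k"
proof -
  obtain U where U: "open U" "p \<in> U" "smooth_fun A U f"
    using assms(4) unfolding smooth_near_def by blast
  have "smooth_fun A (U \<inter> W) f" by (rule smooth_fun_subset[OF U(3)]) simp
  then have "smooth_fun A (U \<inter> W) k"
    by (rule smooth_fun_cong[rotated 2]) (use U(1) assms(1,3) in auto)
  then show ?thesis
    using open_Int[OF U(1) assms(1)] U(2) assms(2) unfolding smooth_near_def by blast
qed

lemma smooth_near_differentiable: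
  assumes "smooth_near A p f" "(V, c) \<in> A" "p \<in> V"
  shows "(f \<circ> inv_into V c) differentiable (at (c p))"
proof -
  obtain U where "open U" "p \<in> U" "smooth_fun A U f"
    using assms(1) unfolding smooth_near_def by blast
  then show ?thesis
    using smooth_funD[of U f V c "Suc 0"] assms(2,3) by simp
qed

section \<open>Tangent vectors through charts\<close>

definition tvec_of :: "'m \<Rightarrow> 'm set \<Rightarrow> ('m \<Rightarrow> 'e) \<Rightarrow> 'e \<Rightarrow> 'm tvec" where
  "tvec_of p V c w = (\<lambda>f. if smooth_near A p f then frechet_derivative (f \<circ> inv_into V c) (at (c p)) w else 0)"

lemma tangentE:
  assumes "v \<in> tangent A p"
  obtains V c w where "(V, c) \<in> A" "p \<in> V" "v = tvec_of p V c w"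
  using assms unfolding tangent_def tvec_of_def by blast

lemma tvec_of_tangent: "(V, c) \<in> A \<Longrightarrow> p \<in> V \<Longrightarrow> tvec_of p V c w \<in> tangent A p"
  unfolding tangent_def tvec_of_def by blast

lemma tvec_of_linear:
  assumes "(V, c) \<in> A" "p \<in> V"
  shows "tvec_of p V c (w + w') = tvec_of p V c w + tvec_of p V c w'"
    "tvec_of p V c (a *\<^sub>R w) = a \<odot> tvec_of p V c w"
proof -
  have l: "linear (frechet_derivative (f \<circ> inv_into V c) (at (c p)))" if "smooth_near A p f" for f
    using smooth_near_differentiable[OF that assms] by (rule linear_frechet_derivative)
  show "tvec_of p V c (w + w') = tvec_of p V c w + tvec_of p V c w'"
    using linear_add[OF l] by (auto simp: tvec_of_def fun_eq_iff)
  show "tvec_of p V c (a *\<^sub>R w) = a \<odot> tvec_of p V c w"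
    using linear_cmul[OF l] by (auto simp: tvec_of_def fun_eq_iff tscale_def)
qed

text \<open>The chain rule for the transition map \<open>t\<close>. Membership in
  \<open>tangent\<close> supplies some chart, so two vectors at \<open>p\<close> must be brought to
  a common one before they can be added.\<close>

lemma tvec_of_change:
  assumes V: "(V, c) \<in> A" "p \<in> V" and W: "(W, d) \<in> A" "p \<in> W"
  shows "\<exists>w'. tvec_of p V c w = tvec_of p W d w'"
proof -
  define t where "t = d \<circ> inv_into V c"
  have o: "open (c ` (W \<inter> V))" by (rule open_chart_image[OF V(1) chart(1)[OF W(1)]])
  have "smooth_on t (c ` (W \<inter> V))"
    using A V(1) W(1) unfolding smooth_manifold_def t_def by blast
  then have "Ck_on (Suc 0) t (c ` (W \<inter> V))" unfolding smooth_on_def by blast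
  then have t: "t differentiable (at (c p))" using V(2) W(2) by simp
  have tp: "t (c p) = d p" using chart(4)[OF V(1)] V(2) by (simp add: t_def)
  have "frechet_derivative (f \<circ> inv_into V c) (at (c p)) w =
      frechet_derivative (f \<circ> inv_into W d) (at (d p)) (frechet_derivative t (at (c p)) w)"
    if f: "smooth_near A p f" for f
  proof -
    have fd: "(f \<circ> inv_into W d) differentiable (at (t (c p)))"
      unfolding tp by (rule smooth_near_differentiable[OF f W])
    have e: "frechet_derivative ((f \<circ> inv_into W d) \<circ> t) (at (c p)) =
        frechet_derivative (f \<circ> inv_into W d) (at (d p)) \<circ> frechet_derivative t (at (c p))"
      by (simp only: frechet_derivative_compose[OF t fd] tp)
    have "frechet_derivative ((f \<circ> inv_into W d) \<circ> t) (at (c p)) = frechet_derivative (f \<circ> inv_into V c) (at (c p))"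
    proof (rule frechet_derivative_transform_within_open[OF _ o])
      show "((f \<circ> inv_into W d) \<circ> t) differentiable (at (c p))"
        by (rule differentiable_chain_at[OF t fd])
      show "c p \<in> c ` (W \<inter> V)" using V(2) W(2) by blast
      show "((f \<circ> inv_into W d) \<circ> t) x = (f \<circ> inv_into V c) x" if "x \<in> c ` (W \<inter> V)" for x
        using that chart(4)[OF V(1)] chart(4)[OF W(1)] by (auto simp: t_def)
    qed
    then show ?thesis using fun_cong[OF e, of w] by simp
  qed
  then have "tvec_of p V c w = tvec_of p W d (frechet_derivative t (at (c p)) w)"
    by (auto simp: tvec_of_def fun_eq_iff)
  then show ?thesis by blast
qed

lemma tangent_add: "v \<in> tangent A p \<Longrightarrow> w \<in> tangent A p \<Longrightarrow> v + w \<in> tangent A p"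
proof -
  assume "v \<in> tangent A p" "w \<in> tangent A p"
  then obtain V c x W d y where c: "(V, c) \<in> A" "p \<in> V" "v = tvec_of p V c x"
    and d: "(W, d) \<in> A" "p \<in> W" "w = tvec_of p W d y"
    by (elim tangentE)
  obtain z where "w = tvec_of p V c z" using tvec_of_change[OF d(1,2) c(1,2)] d(3) by blast
  then have "v + w = tvec_of p V c (x + z)" using tvec_of_linear(1)[OF c(1,2)] c(3) by simp
  then show ?thesis using tvec_of_tangent[OF c(1,2)] by simp
qed

lemma tangent_scale: "v \<in> tangent A p \<Longrightarrow> a \<odot> v \<in> tangent A p"
proof -
  assume "v \<in> tangent A p"
  then obtain V c x where c: "(V, c) \<in> A" "p \<in> V" "v = tvec_of p V c x" by (rule tangentE)
  show ?thesis unfolding c(3) tvec_of_linear(2)[OF c(1,2), symmetric] by (rule tvec_of_tangent[OF c(1,2)])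
qed

lemma tangent_0: "0 \<in> tangent A p"
proof -
  obtain V c where c: "(V, c) \<in> A" "p \<in> V" by (rule chart_at)
  have "0 \<odot> tvec_of p V c 0 = 0" by (simp add: tscale_def fun_eq_iff)
  then show ?thesis using tangent_scale[OF tvec_of_tangent[OF c], of 0 0] by simp
qed

lemma tangent_uminus: "v \<in> tangent A p \<Longrightarrow> - v \<in> tangent A p"
  using tangent_scale[of v p "- 1"] by (simp add: tscale_def fun_Compl_def)

lemma tangent_not_smooth: "v \<in> tangent A p \<Longrightarrow> \<not> smooth_near A p f \<Longrightarrow> v f = 0"
  by (elim tangentE) (simp add: tvec_of_def)

text \<open>Locality of derivations. In the second case neither function is smooth near
  \<open>p\<close>, and both values are the default 0.\<close>

lemma tangent_cong:
  assumes v: "v \<in> tangent A p" and W: "open W" "p \<in> W" "\<And>q. q \<in> W \<Longrightarrow> f q = k q"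
  shows "v f = v k"
proof (cases "smooth_near A p f")
  case True
  then have k: "smooth_near A p k" using smooth_near_cong W by blast
  obtain V c w where c: "(V, c) \<in> A" "p \<in> V" "v = tvec_of p V c w" using v by (rule tangentE)
  have "frechet_derivative (f \<circ> inv_into V c) (at (c p)) = frechet_derivative (k \<circ> inv_into V c) (at (c p))"
    by (rule frechet_derivative_transform_within_open[OF smooth_near_differentiable[OF True c(1,2)]
          open_chart_image[OF c(1) W(1)]])
      (use W c chart(4)[OF c(1)] in auto)
  then show ?thesis using True k c(3) by (simp add: tvec_of_def)
next
  case False
  then have "\<not> smooth_near A p k" using smooth_near_cong[of W p k f] W by auto
  then show ?thesis using False tangent_not_smooth[OF v] by simp
qed

lemma smooth_near_add: "smooth_near A p f \<Longrightarrow> smooth_near A p k \<Longrightarrow> smooth_near A p (\<lambda>q. f q + k q)"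
proof -
  assume "smooth_near A p f" "smooth_near A p k"
  then obtain U W where U: "open U" "p \<in> U" "smooth_fun A U f" and W: "open W" "p \<in> W" "smooth_fun A W k"
    unfolding smooth_near_def by blast
  have "smooth_fun A (U \<inter> W) (\<lambda>q. f q + k q)"
    by (intro smooth_fun_add open_Int U(1) W(1) smooth_fun_subset[OF U(3)] smooth_fun_subset[OF W(3)]) simp_all
  then show ?thesis
    using open_Int[OF U(1) W(1)] U(2) W(2) unfolding smooth_near_def by blast
qed

lemma smooth_near_uminus: "smooth_near A p f \<Longrightarrow> smooth_near A p (\<lambda>q. - f q)"
  unfolding smooth_near_def using smooth_fun_uminus by blast

lemma tangent_fun_add:
  assumes v: "v \<in> tangent A p" and f: "smooth_near A p f" and k: "smooth_near A p k"
  shows "v (\<lambda>q. f q + k q) = v f + v k"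
proof -
  obtain V c w where c: "(V, c) \<in> A" "p \<in> V" "v = tvec_of p V c w" using v by (rule tangentE)
  have "((\<lambda>q. f q + k q) \<circ> inv_into V c) = (\<lambda>x. (f \<circ> inv_into V c) x + (k \<circ> inv_into V c) x)"
    by (simp add: comp_def)
  then show ?thesis
    using fun_cong[OF frechet_derivative_at[OF has_derivative_add[OF
          smooth_near_differentiable[OF f c(1,2), unfolded frechet_derivative_works]
          smooth_near_differentiable[OF k c(1,2), unfolded frechet_derivative_works]]], of w]
      f k smooth_near_add[OF f k] c(3)
    by (simp add: tvec_of_def)
qed

lemma tangent_fun_const:
  assumes v: "v \<in> tangent A p"
  shows "v (\<lambda>q. a) = 0"
proof -
  obtain V c w where c: "(V, c) \<in> A" "p \<in> V" "v = tvec_of p V c w" using v by (rule tangentE)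
  then show ?thesis by (simp add: tvec_of_def comp_def)
qed

lemma tangent_fun_uminus:
  assumes v: "v \<in> tangent A p" and f: "smooth_near A p f"
  shows "v (\<lambda>q. - f q) = - v f"
  using tangent_fun_add[OF v f smooth_near_uminus[OF f]] tangent_fun_const[OF v, of 0] by simp

lemma tangent_fun_diff:
  assumes v: "v \<in> tangent A p" and f: "smooth_near A p f" and k: "smooth_near A p k"
  shows "v (\<lambda>q. f q - k q) = v f - v k"
  using tangent_fun_add[OF v f smooth_near_uminus[OF k]] tangent_fun_uminus[OF v k] by simp

section \<open>Smooth vector fields\<close>

lemma smooth_vfield_tangent: "smooth_vfield A U X \<Longrightarrow> p \<in> U \<Longrightarrow> X p \<in> tangent A p"
  unfolding smooth_vfield_def by blast

lemma smooth_vfield_apply: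
  "smooth_vfield A U X \<Longrightarrow> open W \<Longrightarrow> W \<subseteq> U \<Longrightarrow> smooth_fun A W f \<Longrightarrow> smooth_fun A W (\<lambda>p. X p f)"
  unfolding smooth_vfield_def by blast

lemma smooth_vfieldI:
  "(\<And>p. p \<in> U \<Longrightarrow> X p \<in> tangent A p) \<Longrightarrow>
   (\<And>W f. open W \<Longrightarrow> W \<subseteq> U \<Longrightarrow> smooth_fun A W f \<Longrightarrow> smooth_fun A W (\<lambda>p. X p f)) \<Longrightarrow> smooth_vfield A U X"
  unfolding smooth_vfield_def by blast

lemma smooth_vfield_subset: "smooth_vfield A U X \<Longrightarrow> W \<subseteq> U \<Longrightarrow> smooth_vfield A W X"
  unfolding smooth_vfield_def by (meson order_trans subsetD)

lemma smooth_vfield_cong: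
  assumes "smooth_vfield A U X" "\<And>p. p \<in> U \<Longrightarrow> X p = Y p"
  shows "smooth_vfield A U Y"
proof (rule smooth_vfieldI)
  show "Y p \<in> tangent A p" if "p \<in> U" for p
    using smooth_vfield_tangent[OF assms(1) that] assms(2)[OF that] by simp
  show "smooth_fun A W (\<lambda>p. Y p f)" if "open W" "W \<subseteq> U" "smooth_fun A W f" for W f
    by (rule smooth_fun_cong[OF that(1) _ smooth_vfield_apply[OF assms(1) that]]) (use that(2) assms(2) in auto)
qed

lemma smooth_vfield_add: "smooth_vfield A U X \<Longrightarrow> smooth_vfield A U Y \<Longrightarrow> smooth_vfield A U (X + Y)"
  by (rule smooth_vfieldI)
    (simp_all add: smooth_vfield_tangent tangent_add smooth_fun_add smooth_vfield_apply)

lemma smooth_vfield_scale: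
  assumes "smooth_fun A U f" "smooth_vfield A U X"
  shows "smooth_vfield A U (\<lambda>p. f p \<odot> X p)"
proof (rule smooth_vfieldI)
  show "f p \<odot> X p \<in> tangent A p" if "p \<in> U" for p
    using that by (intro tangent_scale smooth_vfield_tangent[OF assms(2)])
  show "smooth_fun A W (\<lambda>p. (f p \<odot> X p) k)" if "open W" "W \<subseteq> U" "smooth_fun A W k" for W k
    unfolding tscale_def
    by (rule smooth_fun_mult[OF that(1) smooth_fun_subset[OF assms(1) that(2)] smooth_vfield_apply[OF assms(2) that]])
qed

lemma smooth_vfield_uminus: "smooth_vfield A U X \<Longrightarrow> smooth_vfield A U (- X)"
  by (rule smooth_vfieldI)
    (simp_all add: smooth_vfield_tangent tangent_uminus smooth_fun_uminus smooth_vfield_apply)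

lemma smooth_vfield_diff: "smooth_vfield A U X \<Longrightarrow> smooth_vfield A U Y \<Longrightarrow> smooth_vfield A U (X - Y)"
  using smooth_vfield_add[OF _ smooth_vfield_uminus, of U X Y] by simp

lemma smooth_vfield_0: "smooth_vfield A U 0"
  by (rule smooth_vfieldI) (simp_all add: tangent_0 smooth_fun_const)

lemma smooth_near_apply:
  assumes "smooth_vfield A U X" "open U" "p \<in> U" "smooth_near A p f"
  shows "smooth_near A p (\<lambda>q. X q f)"
proof -
  obtain W where W: "open W" "p \<in> W" "smooth_fun A W f"
    using assms(4) unfolding smooth_near_def by blast
  have "smooth_fun A (W \<inter> U) (\<lambda>q. X q f)"
    by (rule smooth_vfield_apply[OF assms(1)]) (use W assms(2) smooth_fun_subset[OF W(3)] in auto)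
  then show ?thesis
    using open_Int[OF W(1) assms(2)] W(2) assms(3) unfolding smooth_near_def by blast
qed

end

section \<open>Vector fields on an open set\<close>

lemma sum_fun_apply: "(\<Sum>i\<in>I. F i) p = (\<Sum>i\<in>I. F i p)"
  by (induction I rule: infinite_finite_induct) auto

definition res :: "'m set \<Rightarrow> 'm vfield \<Rightarrow> 'm vfield" where
  "res U X = (\<lambda>p. if p \<in> U then X p else 0)"

lemma res_in [simp]: "p \<in> U \<Longrightarrow> res U X p = X p"
  and res_out [simp]: "p \<notin> U \<Longrightarrow> res U X p = 0"
  by (simp_all add: res_def)

lemma res_diff: "res U (X - Y) = res U X - res U Y"
  and res_uminus: "res U (- X) = - res U X"
  by (simp_all add: res_def fun_eq_iff)

lemma res_sum: "res U (\<Sum>i\<in>I. X i) = (\<Sum>i\<in>I. res U (X i))"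
  by (rule ext) (simp add: res_def sum_fun_apply)

lemma res_cong: "(\<And>p. p \<in> U \<Longrightarrow> X p = Y p) \<Longrightarrow> res U X = res U Y"
  by (simp add: res_def fun_eq_iff)

lemma res_res: "W \<subseteq> U \<Longrightarrow> res W (res U X) = res W X"
  by (rule res_cong) auto

lemma tscale_0 [simp]: "0 \<odot> v = 0" "a \<odot> 0 = 0"
  by (simp_all add: tscale_def fun_eq_iff)

lemma tscale_1 [simp]: "1 \<odot> v = v"
  by (simp add: tscale_def fun_eq_iff)

locale contact_metric_manifold = manifold A
  for A :: "('m::{t2_space,second_countable_topology}, 'e::euclidean_space) atlas" +
  fixes g :: "'m metric" and nab :: "'m connection"
    and \<phi> :: "'m \<Rightarrow> 'm tvec \<Rightarrow> 'm tvec" and \<xi> :: "'m vfield" and \<eta> :: "'m \<Rightarrow> 'm tvec \<Rightarrow> real"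
  assumes metric: "riemannian_metric A g"
    and connection: "levi_civita A g nab"
    and contact_structure: "contact_metric A g \<phi> \<xi> \<eta>"
begin

lemma g_add: "u \<in> tangent A p \<Longrightarrow> v \<in> tangent A p \<Longrightarrow> w \<in> tangent A p \<Longrightarrow> g p (u + v) w = g p u w + g p v w"
  using metric[unfolded riemannian_metric_def, THEN conjunct1] by blast

lemma g_scale: "v \<in> tangent A p \<Longrightarrow> w \<in> tangent A p \<Longrightarrow> g p (a \<odot> v) w = a * g p v w"
  using metric[unfolded riemannian_metric_def, THEN conjunct2, THEN conjunct1] by blast

lemma g_sym: "v \<in> tangent A p \<Longrightarrow> w \<in> tangent A p \<Longrightarrow> g p v w = g p w v"
  using metric[unfolded riemannian_metric_def, THEN conjunct2, THEN conjunct2, THEN conjunct1] by blast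

lemma g_pos: "v \<in> tangent A p \<Longrightarrow> v \<noteq> 0 \<Longrightarrow> g p v v > 0"
  using metric[unfolded riemannian_metric_def, THEN conjunct2, THEN conjunct2, THEN conjunct2, THEN conjunct1] by blast

lemma g_smooth: "open U \<Longrightarrow> smooth_vfield A U X \<Longrightarrow> smooth_vfield A U Y \<Longrightarrow> smooth_fun A U (\<lambda>p. g p (X p) (Y p))"
  using metric[unfolded riemannian_metric_def, THEN conjunct2, THEN conjunct2, THEN conjunct2, THEN conjunct2] by blast

lemma g_0: "w \<in> tangent A p \<Longrightarrow> g p 0 w = 0" "w \<in> tangent A p \<Longrightarrow> g p w 0 = 0"
  using g_scale[of 0 p w 0] g_sym[of 0 p w] tangent_0[of p] by auto

lemma g_add_right: "u \<in> tangent A p \<Longrightarrow> v \<in> tangent A p \<Longrightarrow> w \<in> tangent A p \<Longrightarrow> g p w (u + v) = g p w u + g p w v"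
  using g_add[of u p v w] g_sym tangent_add by metis

lemma g_scale_right: "v \<in> tangent A p \<Longrightarrow> w \<in> tangent A p \<Longrightarrow> g p w (a \<odot> v) = a * g p w v"
  using g_scale[of v p w a] g_sym tangent_scale by metis

lemma affine: "affine_connection A nab"
  using connection[unfolded levi_civita_def, THEN conjunct1] by blast

lemma nab_cong: "open U \<Longrightarrow> smooth_vfield A U X \<Longrightarrow> smooth_vfield A U X' \<Longrightarrow> smooth_vfield A U Y \<Longrightarrow> smooth_vfield A U Y' \<Longrightarrow>
    (\<And>p. p \<in> U \<Longrightarrow> X p = X' p) \<Longrightarrow> (\<And>p. p \<in> U \<Longrightarrow> Y p = Y' p) \<Longrightarrow> p \<in> U \<Longrightarrow> nab X Y p = nab X' Y' p"
  using affine[unfolded affine_connection_def, THEN conjunct1] by blast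

lemma nab_smooth: "open U \<Longrightarrow> smooth_vfield A U X \<Longrightarrow> smooth_vfield A U Y \<Longrightarrow> smooth_vfield A U (nab X Y)"
  using affine[unfolded affine_connection_def, THEN conjunct2, THEN conjunct1] by blast

lemma nab_add: "open U \<Longrightarrow> smooth_vfield A U X \<Longrightarrow> smooth_vfield A U Y \<Longrightarrow> smooth_vfield A U Z \<Longrightarrow> p \<in> U \<Longrightarrow>
    nab (X + Y) Z p = nab X Z p + nab Y Z p \<and> nab X (Y + Z) p = nab X Y p + nab X Z p"
  using affine[unfolded affine_connection_def, THEN conjunct2, THEN conjunct2, THEN conjunct1] by blast

lemma nab_scale: "open U \<Longrightarrow> smooth_fun A U f \<Longrightarrow> smooth_vfield A U X \<Longrightarrow> smooth_vfield A U Y \<Longrightarrow> p \<in> U \<Longrightarrow>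
    nab (\<lambda>q. f q \<odot> X q) Y p = f p \<odot> nab X Y p \<and>
    nab X (\<lambda>q. f q \<odot> Y q) p = X p f \<odot> Y p + f p \<odot> nab X Y p"
  using affine[unfolded affine_connection_def, THEN conjunct2, THEN conjunct2, THEN conjunct2] by blast

lemma torsion: "open U \<Longrightarrow> smooth_vfield A U X \<Longrightarrow> smooth_vfield A U Y \<Longrightarrow> p \<in> U \<Longrightarrow>
    nab X Y p - nab Y X p = lie_bracket A X Y p"
  using connection[unfolded levi_civita_def, THEN conjunct2, THEN conjunct1] by blast

lemma metric_connection: "open U \<Longrightarrow> smooth_vfield A U X \<Longrightarrow> smooth_vfield A U Y \<Longrightarrow> smooth_vfield A U Z \<Longrightarrow> p \<in> U \<Longrightarrow>
    X p (\<lambda>q. g q (Y q) (Z q)) = g p (nab X Y p) (Z p) + g p (Y p) (nab X Z p)"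
  using connection[unfolded levi_civita_def, THEN conjunct2, THEN conjunct2] by blast

lemma acm: "almost_contact_metric A g \<phi> \<xi> \<eta>"
  using contact_structure unfolding contact_metric_def by blast

lemma tensor: "tensor11 A \<phi>"
  using acm unfolding almost_contact_metric_def by blast

lemma phi_tangent: "v \<in> tangent A p \<Longrightarrow> \<phi> p v \<in> tangent A p"
  using tensor[unfolded tensor11_def, THEN conjunct1] unfolding app_def by blast

lemma phi_add: "v \<in> tangent A p \<Longrightarrow> w \<in> tangent A p \<Longrightarrow> \<phi> p (v + w) = \<phi> p v + \<phi> p w"
  using tensor[unfolded tensor11_def, THEN conjunct2, THEN conjunct1] unfolding app_def by blast

lemma phi_scale: "v \<in> tangent A p \<Longrightarrow> \<phi> p (a \<odot> v) = a \<odot> \<phi> p v"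
  using tensor[unfolded tensor11_def, THEN conjunct2, THEN conjunct2, THEN conjunct1] unfolding app_def by blast

lemma phi_smooth: "open U \<Longrightarrow> smooth_vfield A U X \<Longrightarrow> smooth_vfield A U (app \<phi> X)"
  using tensor[unfolded tensor11_def, THEN conjunct2, THEN conjunct2, THEN conjunct2] unfolding app_def by blast

lemma phi_0: "\<phi> p 0 = 0"
  using phi_scale[OF tangent_0[of p], of 0] by simp

lemma xi_smooth: "smooth_vfield A U \<xi>"
  using acm[unfolded almost_contact_metric_def, THEN conjunct2, THEN conjunct1] by (rule smooth_vfield_subset) simp

lemma xi_unit: "g p (\<xi> p) (\<xi> p) = 1"
  using acm[unfolded almost_contact_metric_def, THEN conjunct2, THEN conjunct2, THEN conjunct1] by blast

lemma eta_eq: "v \<in> tangent A p \<Longrightarrow> \<eta> p v = g p (\<xi> p) v"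
  using acm[unfolded almost_contact_metric_def, THEN conjunct2, THEN conjunct2, THEN conjunct2, THEN conjunct1] by blast

lemma phi_phi: "v \<in> tangent A p \<Longrightarrow> \<phi> p (\<phi> p v) = - v + \<eta> p v \<odot> \<xi> p"
  using acm[unfolded almost_contact_metric_def, THEN conjunct2, THEN conjunct2, THEN conjunct2, THEN conjunct2, THEN conjunct1] by blast

lemma g_phi_phi: "v \<in> tangent A p \<Longrightarrow> w \<in> tangent A p \<Longrightarrow> g p (\<phi> p v) (\<phi> p w) = g p v w - \<eta> p v * \<eta> p w"
  using acm[unfolded almost_contact_metric_def, THEN conjunct2, THEN conjunct2, THEN conjunct2, THEN conjunct2, THEN conjunct2] by blast

lemma xi_tangent: "\<xi> p \<in> tangent A p"
  using smooth_vfield_tangent[OF xi_smooth, of p UNIV] by simp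

lemma contact_form: "open U \<Longrightarrow> smooth_vfield A U X \<Longrightarrow> smooth_vfield A U Y \<Longrightarrow> p \<in> U \<Longrightarrow>
    ext_deriv A \<eta> X Y p = g p (X p) (\<phi> p (Y p))"
  using contact_structure unfolding contact_metric_def by blast

definition VU :: "'m set \<Rightarrow> 'm vfield set" where
  "VU U = {X. smooth_vfield A U X \<and> (\<forall>p. p \<notin> U \<longrightarrow> X p = 0)}"

text \<open>Functions, unlike fields, are not cut off outside \<open>U\<close>: their multiples of
  fields in \<open>VU U\<close>, and their derivatives along such fields, vanish there
  anyway.\<close>

definition SU :: "'m set \<Rightarrow> ('m \<Rightarrow> real) set" where
  "SU U = {f. smooth_fun A U f}"

definition scf :: "('m \<Rightarrow> real) \<Rightarrow> 'm vfield \<Rightarrow> 'm vfield" where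
  "scf f X = (\<lambda>p. f p \<odot> X p)"

definition ipf :: "'m vfield \<Rightarrow> 'm vfield \<Rightarrow> 'm \<Rightarrow> real" where
  "ipf X Y = (\<lambda>p. g p (X p) (Y p))"

definition derf :: "'m vfield \<Rightarrow> ('m \<Rightarrow> real) \<Rightarrow> 'm \<Rightarrow> real" where
  "derf X f = (\<lambda>p. X p f)"

definition nbf :: "'m set \<Rightarrow> 'm vfield \<Rightarrow> 'm vfield \<Rightarrow> 'm vfield" where
  "nbf U X Y = res U (nab X Y)"

lemma VU_smooth: "X \<in> VU U \<Longrightarrow> smooth_vfield A U X"
  and VU_out: "X \<in> VU U \<Longrightarrow> p \<notin> U \<Longrightarrow> X p = 0"
  by (simp_all add: VU_def)

lemma VU_tangent: "X \<in> VU U \<Longrightarrow> X p \<in> tangent A p"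
  using VU_out[of X U p] tangent_0[of p] smooth_vfield_tangent[OF VU_smooth, of X U p]
  by (cases "p \<in> U") simp_all

lemma res_VU: "smooth_vfield A U X \<Longrightarrow> res U X \<in> VU U"
  unfolding VU_def using smooth_vfield_cong[of U X "res U X"] by simp

lemma res_VU_id: "X \<in> VU U \<Longrightarrow> res U X = X"
  by (simp add: res_def fun_eq_iff VU_out)

lemma VU_eqI: "X \<in> VU U \<Longrightarrow> Y \<in> VU U \<Longrightarrow> (\<And>p. p \<in> U \<Longrightarrow> X p = Y p) \<Longrightarrow> X = Y"
  by (rule ext) (metis VU_out)

lemma nbf_VU: "open U \<Longrightarrow> X \<in> VU U \<Longrightarrow> Y \<in> VU U \<Longrightarrow> nbf U X Y \<in> VU U"
  unfolding nbf_def by (intro res_VU nab_smooth VU_smooth)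

lemma VU_add: "X \<in> VU U \<Longrightarrow> Y \<in> VU U \<Longrightarrow> X + Y \<in> VU U"
  by (simp add: VU_def smooth_vfield_add)

lemma VU_uminus: "X \<in> VU U \<Longrightarrow> - X \<in> VU U"
  by (simp add: VU_def smooth_vfield_uminus)

lemma VU_diff: "X \<in> VU U \<Longrightarrow> Y \<in> VU U \<Longrightarrow> X - Y \<in> VU U"
  by (simp add: VU_def smooth_vfield_diff)

lemma VU_scf: "f \<in> SU U \<Longrightarrow> X \<in> VU U \<Longrightarrow> scf f X \<in> VU U"
  by (simp add: VU_def SU_def scf_def smooth_vfield_scale)

lemma derf_bracket:
  assumes U: "open U" and X: "X \<in> VU U" and Y: "Y \<in> VU U" and p: "p \<in> U" and f: "smooth_near A p f"
  shows "(nbf U X Y - nbf U Y X) p f = X p (\<lambda>q. Y q f) - Y p (\<lambda>q. X q f)"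
proof -
  have "(nbf U X Y - nbf U Y X) p = lie_bracket A X Y p"
    using torsion[OF U VU_smooth[OF X] VU_smooth[OF Y] p] p by (simp add: nbf_def)
  then show ?thesis
    using f by (simp add: lie_bracket_def)
qed

text \<open>A double bracket in third-order derivatives; in the cyclic sum the twelve terms cancel
  in pairs, which gives \<open>jacobi\<close>. The formula for the inner bracket holds only near
  \<open>p\<close>, hence the appeal to \<open>tangent_cong\<close>.\<close>

lemma derf_bracket2:
  assumes U: "open U" and X: "X \<in> VU U" and Y: "Y \<in> VU U" and Z: "Z \<in> VU U" and p: "p \<in> U" and f: "smooth_near A p f"
  shows "(nbf U X (nbf U Y Z - nbf U Z Y) - nbf U (nbf U Y Z - nbf U Z Y) X) p f =
    X p (\<lambda>q. Y q (\<lambda>r. Z r f)) - X p (\<lambda>q. Z q (\<lambda>r. Y r f)) -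
    (Y p (\<lambda>q. Z q (\<lambda>r. X r f)) - Z p (\<lambda>q. Y q (\<lambda>r. X r f)))"
proof -
  obtain W where W: "open W" "p \<in> W" "smooth_fun A W f"
    using f unfolding smooth_near_def by blast
  have B: "nbf U Y Z - nbf U Z Y \<in> VU U"
    by (intro VU_diff nbf_VU U Y Z)
  have e: "(nbf U Y Z - nbf U Z Y) q f = Y q (\<lambda>r. Z r f) - Z q (\<lambda>r. Y r f)" if "q \<in> W \<inter> U" for q
    using that W by (intro derf_bracket[OF U Y Z]) (auto simp: smooth_near_def)
  have n: "smooth_near A p (\<lambda>q. D q k)" if "smooth_near A p k" "D \<in> VU U" for D and k :: "'m \<Rightarrow> real"
    using smooth_near_apply[OF VU_smooth U p] that by blast
  have "X p (\<lambda>q. (nbf U Y Z - nbf U Z Y) q f) = X p (\<lambda>q. Y q (\<lambda>r. Z r f) - Z q (\<lambda>r. Y r f))"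
    by (rule tangent_cong[OF VU_tangent[OF X] open_Int[OF W(1) U]]) (use W p e in auto)
  also have "\<dots> = X p (\<lambda>q. Y q (\<lambda>r. Z r f)) - X p (\<lambda>q. Z q (\<lambda>r. Y r f))"
    by (rule tangent_fun_diff[OF VU_tangent[OF X] n[OF n[OF f Z] Y] n[OF n[OF f Y] Z]])
  finally show ?thesis
    using derf_bracket[OF U X B p f] derf_bracket[OF U Y Z p n[OF f X]] by simp
qed

lemma contact_module_VU:
  assumes U: "open U"
  shows "contact_module (VU U) (SU U) scf ipf derf (nbf U) (app \<phi>) (res U \<xi>)"
proof -
  note T [simp] = VU_tangent[of _ U]
  have der_smooth: "smooth_fun A U f" if "f \<in> SU U" for f using that by (simp add: SU_def)
  have near: "smooth_near A p f" if "f \<in> SU U" "p \<in> U" for f p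
    using smooth_fun_near[OF U that(2)] that(1) by (simp add: SU_def)
  have xi: "res U \<xi> \<in> VU U" by (intro res_VU xi_smooth)
  have lc: "levi_civita_module (VU U) (SU U) scf ipf derf (nbf U)"
  proof
    show "0 \<in> VU U" by (simp add: VU_def smooth_vfield_0)
    show "X + Y \<in> VU U" if "X \<in> VU U" "Y \<in> VU U" for X Y using that by (rule VU_add)
    show "- X \<in> VU U" if "X \<in> VU U" for X using that by (rule VU_uminus)
    show "scf f X \<in> VU U" if "f \<in> SU U" "X \<in> VU U" for f X using that by (rule VU_scf)
    show "nbf U X Y \<in> VU U" if "X \<in> VU U" "Y \<in> VU U" for X Y using that by (rule nbf_VU[OF U])
    show "ipf X Y \<in> SU U" if "X \<in> VU U" "Y \<in> VU U" for X Y
      using that by (simp add: ipf_def SU_def g_smooth U VU_smooth)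
    show "derf X f \<in> SU U" if "X \<in> VU U" "f \<in> SU U" for X f
      using that smooth_vfield_apply[OF VU_smooth U] by (simp add: derf_def SU_def)
    show "(\<lambda>p. f p + k p) \<in> SU U" if "f \<in> SU U" "k \<in> SU U" for f k
      using that by (simp add: SU_def smooth_fun_add U)
    show "(\<lambda>p. - f p) \<in> SU U" if "f \<in> SU U" for f
      using that by (simp add: SU_def smooth_fun_uminus U)
    show "derf X (\<lambda>p. f p + k p) p = derf X f p + derf X k p"
      if "X \<in> VU U" "f \<in> SU U" "k \<in> SU U" for X f k p
      using that tangent_fun_add[OF VU_tangent near near]
      by (cases "p \<in> U") (auto simp: derf_def VU_out)
    show "derf X (\<lambda>p. - f p) p = - derf X f p" if "X \<in> VU U" "f \<in> SU U" for X f p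
      using that tangent_fun_uminus[OF VU_tangent near]
      by (cases "p \<in> U") (auto simp: derf_def VU_out)
    show "ipf (X + Y) Z p = ipf X Z p + ipf Y Z p" if "X \<in> VU U" "Y \<in> VU U" "Z \<in> VU U" for X Y Z p
      using that by (simp add: ipf_def g_add)
    show "ipf (scf f X) Z p = f p * ipf X Z p" if "f \<in> SU U" "X \<in> VU U" "Z \<in> VU U" for f X Z p
      using that by (simp add: ipf_def scf_def g_scale)
    show "ipf X Y = ipf Y X" if "X \<in> VU U" "Y \<in> VU U" for X Y
      using that by (simp add: ipf_def g_sym fun_eq_iff)
    show "X = 0" if "X \<in> VU U" "\<And>p. ipf X X p = 0" for X
    proof (rule ext)
      fix p
      show "X p = 0 p"
        using that(2)[of p] g_pos[OF VU_tangent[OF that(1), of p]] by (auto simp: ipf_def)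
    qed
    fix X Y Z assume X [simp]: "X \<in> VU U" and Y [simp]: "Y \<in> VU U"
    note [simp] = VU_smooth[OF X] VU_smooth[OF Y]
    show "nbf U (scf f X) Y = scf f (nbf U X Y)" if "f \<in> SU U" for f
    proof (rule ext)
      fix p
      show "nbf U (scf f X) Y p = scf f (nbf U X Y) p"
        using nab_scale[OF U der_smooth[OF that] VU_smooth[OF X] VU_smooth[OF Y], of p]
        by (cases "p \<in> U") (simp_all add: nbf_def scf_def fun_eq_iff)
    qed
    show "nbf U X (scf f Y) = scf (derf X f) Y + scf f (nbf U X Y)" if "f \<in> SU U" for f
    proof (rule ext)
      fix p
      show "nbf U X (scf f Y) p = (scf (derf X f) Y + scf f (nbf U X Y)) p"
        using nab_scale[OF U der_smooth[OF that] VU_smooth[OF X] VU_smooth[OF Y], of p]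
        by (cases "p \<in> U") (simp_all add: nbf_def scf_def derf_def VU_out[OF Y] fun_eq_iff)
    qed
    show "derf (nbf U X Y) f p - derf (nbf U Y X) f p = derf X (derf Y f) p - derf Y (derf X f) p"
      if "f \<in> SU U" for f p
    proof (cases "p \<in> U")
      case True
      then show ?thesis
        using derf_bracket[OF U X Y True near[OF that True]] by (simp add: derf_def)
    qed (simp add: derf_def VU_out[OF X] VU_out[OF Y] nbf_def)
    assume Z [simp]: "Z \<in> VU U"
    note [simp] = VU_smooth[OF Z]
    show "nbf U (X + Y) Z = nbf U X Z + nbf U Y Z"
    proof (rule ext)
      fix p
      show "nbf U (X + Y) Z p = (nbf U X Z + nbf U Y Z) p"
        using nab_add[OF U VU_smooth[OF X] VU_smooth[OF Y] VU_smooth[OF Z], of p]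
        by (cases "p \<in> U") (simp_all add: nbf_def fun_eq_iff)
    qed
    show "nbf U X (Y + Z) = nbf U X Y + nbf U X Z"
    proof (rule ext)
      fix p
      show "nbf U X (Y + Z) p = (nbf U X Y + nbf U X Z) p"
        using nab_add[OF U VU_smooth[OF X] VU_smooth[OF Y] VU_smooth[OF Z], of p]
        by (cases "p \<in> U") (simp_all add: nbf_def fun_eq_iff)
    qed
    show "derf X (ipf Y Z) p = ipf (nbf U X Y) Z p + ipf Y (nbf U X Z) p" for p
      using metric_connection[OF U VU_smooth[OF X] VU_smooth[OF Y] VU_smooth[OF Z]]
      by (cases "p \<in> U") (simp_all add: derf_def ipf_def nbf_def VU_out[OF X] VU_out[OF Y] VU_out[OF Z] g_0 tangent_0)
    show "(nbf U X (nbf U Y Z - nbf U Z Y) - nbf U (nbf U Y Z - nbf U Z Y) X) +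
      (nbf U Y (nbf U Z X - nbf U X Z) - nbf U (nbf U Z X - nbf U X Z) Y) +
      (nbf U Z (nbf U X Y - nbf U Y X) - nbf U (nbf U X Y - nbf U Y X) Z) = 0" (is "?J = 0")
    proof (rule ext, rule ext)
      fix p f
      have J: "?J \<in> VU U"
        by (intro VU_add VU_diff nbf_VU U X Y Z)
      show "?J p f = 0 p f"
      \<comment> \<open>Outside \<open>U\<close> the extended fields are zero, and on functions not
        smooth near \<open>p\<close> tangent vectors have the default value 0.\<close>
      proof (cases "p \<in> U \<and> smooth_near A p f")
        case True
        then show ?thesis
          using derf_bracket2[OF U X Y Z] derf_bracket2[OF U Y Z X] derf_bracket2[OF U Z X Y] by simp
      next
        case False
        have "?J p f = 0"
        proof (cases "p \<in> U")
          case True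
          then show ?thesis
            using False tangent_not_smooth[OF VU_tangent[OF J]] by blast
        next
          case False
          have "?J p = 0" by (rule VU_out[OF J False])
          then show ?thesis by (simp only: zero_fun_apply)
        qed
        then show ?thesis by (simp only: zero_fun_apply)
      qed
    qed
  qed
  interpret levi_civita_module "VU U" "SU U" scf ipf derf "nbf U" by (rule lc)
  have eta: "ipf X (res U \<xi>) p = \<eta> p (X p)" if "X \<in> VU U" "p \<in> U" for X p
    using that by (simp add: ipf_def eta_eq g_sym[OF xi_tangent])
  show ?thesis
  proof
    show "res U \<xi> \<in> VU U" by (rule xi)
    show "app \<phi> X \<in> VU U" if "X \<in> VU U" for X
      using that phi_smooth[OF U, of X] by (simp add: VU_def app_def phi_0)
    show "app \<phi> (X + Y) = app \<phi> X + app \<phi> Y" if "X \<in> VU U" "Y \<in> VU U" for X Y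
      by (simp add: app_def phi_add[OF VU_tangent[OF that(1)] VU_tangent[OF that(2)]] fun_eq_iff)
    show "app \<phi> (scf f X) = scf f (app \<phi> X)" if "f \<in> SU U" "X \<in> VU U" for f X
      by (simp add: app_def scf_def phi_scale[OF VU_tangent[OF that(2)]] fun_eq_iff)
    show "scf (ipf (res U \<xi>) (res U \<xi>)) X = X" if "X \<in> VU U" for X
    proof (rule ext)
      fix p
      show "scf (ipf (res U \<xi>) (res U \<xi>)) X p = X p"
        by (cases "p \<in> U") (simp_all add: scf_def ipf_def xi_unit VU_out[OF that])
    qed
    show "derf X (ipf (res U \<xi>) (res U \<xi>)) p = 0" if "X \<in> VU U" for X p
    proof (cases "p \<in> U")
      case True
      have "X p (\<lambda>q. g q (res U \<xi> q) (res U \<xi> q)) = X p (\<lambda>q. 1)"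
        by (rule tangent_cong[OF VU_tangent[OF that] U True]) (simp add: xi_unit)
      then show ?thesis
        using tangent_fun_const[OF VU_tangent[OF that]] by (simp add: derf_def ipf_def)
    qed (simp add: derf_def VU_out[OF that])
    show "app \<phi> (app \<phi> X) = - X + scf (ipf X (res U \<xi>)) (res U \<xi>)" if "X \<in> VU U" for X
    proof (rule ext)
      fix p
      show "app \<phi> (app \<phi> X) p = (- X + scf (ipf X (res U \<xi>)) (res U \<xi>)) p"
      proof (cases "p \<in> U")
        case True
        then show ?thesis
          using that by (simp add: app_def scf_def eta phi_phi fun_eq_iff)
      next
        case False
        note X0 = VU_out[OF that False]
        have "app \<phi> (app \<phi> X) p = 0"
          by (simp only: app_def X0 phi_0)
        moreover have "(- X + scf (ipf X (res U \<xi>)) (res U \<xi>)) p = 0"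
          using False by (simp add: scf_def X0 fun_eq_iff)
        ultimately show ?thesis by simp
      qed
    qed
    fix X Y p assume X [simp]: "X \<in> VU U" and Y [simp]: "Y \<in> VU U"
    show "ipf (app \<phi> X) (app \<phi> Y) p = ipf X Y p - ipf X (res U \<xi>) p * ipf Y (res U \<xi>) p"
    proof (cases "p \<in> U")
      case True
      then show ?thesis
        unfolding eta[OF X True] eta[OF Y True] by (simp add: ipf_def app_def g_phi_phi)
    qed (simp add: ipf_def app_def VU_out[OF X] VU_out[OF Y] phi_0 g_0 tangent_0)
    show "derf X (ipf (res U \<xi>) Y) p - derf Y (ipf (res U \<xi>) X) p - ipf (res U \<xi>) (nbf U X Y - nbf U Y X) p =
      2 * ipf X (app \<phi> Y) p"
    proof (cases "p \<in> U")
      case True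
      have d: "X p (\<lambda>q. g q (res U \<xi> q) (Y q)) = X p (\<lambda>q. \<eta> q (Y q))"
        if [simp]: "X \<in> VU U" "Y \<in> VU U" for X Y
        by (rule tangent_cong[OF VU_tangent[OF that(1)] U True]) (simp add: eta_eq)
      have "(nbf U X Y - nbf U Y X) p = lie_bracket A X Y p"
        using torsion[OF U VU_smooth[OF X] VU_smooth[OF Y] True] True by (simp add: nbf_def)
      moreover have "lie_bracket A X Y p \<in> tangent A p"
        unfolding calculation[symmetric] by (rule VU_tangent[of _ U]) (intro VU_diff nbf_VU U X Y)
      ultimately show ?thesis
        using contact_form[OF U VU_smooth[OF X] VU_smooth[OF Y] True] d[OF X Y] d[OF Y X] True
        by (simp add: derf_def ipf_def app_def ext_deriv_def eta_eq)
    next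
      case False
      have "(nbf U X Y - nbf U Y X) p = 0" using False by (simp add: nbf_def)
      then show ?thesis
        using False by (simp add: derf_def ipf_def app_def VU_out[OF X] VU_out[OF Y] g_0 tangent_0 phi_0)
    qed
  qed
qed

end

section \<open>Translation of the geometric operators into the module\<close>

locale contact_metric_open = contact_metric_manifold A g nab \<phi> \<xi> \<eta>
  for A :: "('m::{t2_space,second_countable_topology}, 'e::euclidean_space) atlas"
    and g nab \<phi> \<xi> \<eta> +
  fixes U :: "'m set"
  assumes U: "open U"
begin

sublocale m: contact_module "VU U" "SU U" scf ipf derf "nbf U" "app \<phi>" "res U \<xi>"
  by (rule contact_module_VU[OF U])

lemma smooth_vfield_iff: "smooth_vfield A U X \<longleftrightarrow> res U X \<in> VU U"
  using res_VU smooth_vfield_cong[of U "res U X" X] VU_smooth by auto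

lemma res_nab:
  "res U X \<in> VU U \<Longrightarrow> res U Y \<in> VU U \<Longrightarrow> res U (nab X Y) = nbf U (res U X) (res U Y)"
  unfolding nbf_def
  by (intro res_cong nab_cong[OF U]) (auto simp: smooth_vfield_iff res_res)

lemma res_app: "res U (app \<phi> X) = app \<phi> (res U X)"
  by (simp add: app_def res_def phi_0 fun_eq_iff)

lemma nab_tangent: "res U X \<in> VU U \<Longrightarrow> res U Y \<in> VU U \<Longrightarrow> p \<in> U \<Longrightarrow> nab X Y p \<in> tangent A p"
  using smooth_vfield_tangent[OF nab_smooth[OF U]] by (simp add: smooth_vfield_iff)

lemma res_nablaD:
  assumes X: "res U X \<in> VU U" and Y: "res U Y \<in> VU U"
  shows "res U (nablaD nab \<xi> \<eta> X Y) = m.C (res U X) (res U Y)"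
proof (rule ext)
  fix p
  show "res U (nablaD nab \<xi> \<eta> X Y) p = m.C (res U X) (res U Y) p"
  proof (cases "p \<in> U")
    case True
    have "nab X Y p = nbf U (res U X) (res U Y) p"
      using fun_cong[OF res_nab[OF X Y], of p] True by simp
    then show ?thesis
      using True nab_tangent[OF X Y True]
      by (intro ext) (simp add: nablaD_def projD_def m.C_def scf_def ipf_def eta_eq g_sym[OF xi_tangent])
  next
    case False
    have "m.C (res U X) (res U Y) \<in> VU U" by (intro m.DdV m.C_Dd X Y)
    from VU_out[OF this False] show ?thesis using False by (simp add: fun_eq_iff)
  qed
qed

lemma res_deriv_end_phi:
  assumes X: "res U X \<in> VU U" and Y: "res U Y \<in> VU U"
  shows "res U (deriv_end (nablaD nab \<xi> \<eta>) X (app \<phi>) Y) = m.Q (res U X) (res U Y)"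
  using assms by (simp add: deriv_end_def res_diff res_app res_nablaD m.Q_def)

lemma res_second_deriv_end:
  assumes X: "res U X \<in> VU U" and Y: "res U Y \<in> VU U"
  shows "res U (second_deriv_end nab (nablaD nab \<xi> \<eta>) X X (app \<phi>) Y) = m.M (res U X) (res U X) (res U Y)"
proof -
  let ?C = "nablaD nab \<xi> \<eta>"
  have Q: "res U (deriv_end ?C X (app \<phi>) Z) \<in> VU U" if "res U Z \<in> VU U" for Z
    using that X by (simp add: res_deriv_end_phi)
  have n: "res U (nab X X) \<in> VU U" using X by (simp add: res_nab)
  have c: "res U (?C X Y) \<in> VU U" using X Y by (simp add: res_nablaD)
  have "res U (deriv_end ?C X (deriv_end ?C X (app \<phi>)) Y) =
      m.C (res U X) (m.Q (res U X) (res U Y)) - m.Q (res U X) (m.C (res U X) (res U Y))"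
    unfolding deriv_end_def[of ?C X "deriv_end ?C X (app \<phi>)"] res_diff
      res_nablaD[OF X Q[OF Y]] res_deriv_end_phi[OF X c] res_deriv_end_phi[OF X Y] res_nablaD[OF X Y] ..
  then show ?thesis
    unfolding second_deriv_end_def res_diff m.M_def res_deriv_end_phi[OF n Y] res_nab[OF X X] by simp
qed

lemma res_curvD:
  assumes X: "res U X \<in> VU U" and Y: "res U Y \<in> VU U" and Z: "res U Z \<in> VU U"
  shows "res U (curvD nab \<xi> \<eta> X Y Z) = m.Rb (res U X) (res U Y) (res U Z)"
  using assms by (simp add: curvD_def second_deriv_def m.Rb_def res_diff res_nablaD res_nab)

lemma res_tau_J:
  assumes E: "\<And>i. i < N \<Longrightarrow> res U (E i) \<in> VU U" and Y: "res U Y \<in> VU U"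
  shows "res U (tau_J nab \<phi> \<xi> \<eta> N E Y) = m.tauJ N (\<lambda>i. res U (E i)) (res U Y)"
proof -
  have "res U (\<Sum>i<N. second_deriv_end nab (nablaD nab \<xi> \<eta>) (E i) (E i) (app \<phi>) Z) =
      (\<Sum>i<N. m.M (res U (E i)) (res U (E i)) (res U Z))" if "res U Z \<in> VU U" for Z
    unfolding res_sum using E that by (intro sum.cong refl res_second_deriv_end) auto
  moreover have "res U (app \<phi> Y) \<in> VU U" using Y by (simp add: res_app)
  ultimately show ?thesis
    using Y by (simp add: tau_J_def rough_laplacian_J_def res_diff res_app res_uminus m.tauJ_def)
qed

lemma res_T_phi:
  assumes E: "\<And>i. i < N \<Longrightarrow> res U (E i) \<in> VU U"
  shows "res U (T_phi nab \<phi> \<xi> \<eta> N E) = m.Tv N (\<lambda>i. res U (E i))"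
proof -
  have xi: "res U \<xi> \<in> VU U" by (rule m.xi_mem)
  show ?thesis
    unfolding T_phi_def m.Tv_def res_sum
  proof (intro sum.cong refl)
    fix i assume "i \<in> {..<N}"
    then have e: "res U (E i) \<in> VU U" using E by simp
    have "res U (nab (E i) \<xi>) \<in> VU U" using e xi by (simp add: res_nab)
    from res_deriv_end_phi[OF e this]
    show "res U (deriv_end (nablaD nab \<xi> \<eta>) (E i) (app \<phi>) (nab (E i) \<xi>)) =
        m.Q (res U (E i)) (nbf U (res U (E i)) (res U \<xi>))"
      by (simp only: res_nab[OF e xi])
  qed
qed

lemma tau_xi_eq:
  assumes E: "\<And>i. i < N \<Longrightarrow> res U (E i) \<in> VU U" and p: "p \<in> U"
  shows "tau_xi g nab \<xi> N E p = m.tauv N (\<lambda>i. res U (E i)) p"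
proof -
  have xi: "res U \<xi> \<in> VU U" by (rule m.xi_mem)
  have e: "second_deriv nab nab (E i) (E i) \<xi> p = (nbf U (res U (E i)) (nbf U (res U (E i)) (res U \<xi>)) -
      nbf U (nbf U (res U (E i)) (res U (E i))) (res U \<xi>)) p"
    "nab (E i) \<xi> p = nbf U (res U (E i)) (res U \<xi>) p"
    if "i < N" for i
  proof -
    note e = E[OF that]
    have a: "res U (nab (E i) \<xi>) \<in> VU U" "res U (nab (E i) (E i)) \<in> VU U" using e xi by (simp_all add: res_nab)
    have "res U (second_deriv nab nab (E i) (E i) \<xi>) = nbf U (res U (E i)) (nbf U (res U (E i)) (res U \<xi>)) -
      nbf U (nbf U (res U (E i)) (res U (E i))) (res U \<xi>)"
      unfolding second_deriv_def res_diff res_nab[OF e a(1)] res_nab[OF a(2) xi] res_nab[OF e xi] res_nab[OF e e] ..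
    from fun_cong[OF this, of p] p
    show "second_deriv nab nab (E i) (E i) \<xi> p = (nbf U (res U (E i)) (nbf U (res U (E i)) (res U \<xi>)) -
      nbf U (nbf U (res U (E i)) (res U (E i))) (res U \<xi>)) p" by simp
    show "nab (E i) \<xi> p = nbf U (res U (E i)) (res U \<xi>) p"
      using fun_cong[OF res_nab[OF e xi], of p] p by simp
  qed
  show ?thesis
    using p by (simp add: tau_xi_def m.tauv_def m.Lap_def e scf_def ipf_def sum_fun_apply fun_eq_iff)
qed

lemma res_h_op:
  assumes X: "res U X \<in> VU U"
  shows "res U (h_op A \<phi> \<xi> X) = m.hh (res U X)"
proof (rule ext)
  fix p
  show "res U (h_op A \<phi> \<xi> X) p = m.hh (res U X) p"
  proof (cases "p \<in> U")
    case True
    have xi: "res U \<xi> \<in> VU U" by (rule m.xi_mem)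
    have pX: "res U (app \<phi> X) \<in> VU U" using X by (simp add: res_app)
    note [simp] = X
    have b: "lie_bracket A \<xi> Y p = (nbf U (res U \<xi>) (res U Y) - nbf U (res U Y) (res U \<xi>)) p"
      if Y: "res U Y \<in> VU U" for Y
    proof -
      have "lie_bracket A \<xi> Y p = nab \<xi> Y p - nab Y \<xi> p"
        using torsion[OF U _ _ True, of \<xi> Y] xi Y by (simp add: smooth_vfield_iff)
      then show ?thesis
        using fun_cong[OF res_nab[OF xi Y], of p] fun_cong[OF res_nab[OF Y xi], of p] True by simp
    qed
    \<comment> \<open>The derivative of \<open>\<phi>\<close> along \<open>\<xi>\<close> is zero, so
      the Lie derivative reduces to the right-hand side of \<open>hh_eq\<close>.\<close>
    have "nbf U (res U \<xi>) (app \<phi> (res U X)) = app \<phi> (nbf U (res U \<xi>) (res U X))"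
      using m.D_xi[OF X] by (simp add: m.D_def)
    then have "(nbf U (res U \<xi>) (app \<phi> (res U X)) - nbf U (app \<phi> (res U X)) (res U \<xi>)) -
        app \<phi> (nbf U (res U \<xi>) (res U X) - nbf U (res U X) (res U \<xi>)) = m.hh (res U X) + m.hh (res U X)"
      by (simp add: m.hh_eq)
    from fun_cong[OF this, of p]
    have "lie_bracket A \<xi> (app \<phi> X) p - \<phi> p (lie_bracket A \<xi> X p) = m.hh (res U X) p + m.hh (res U X) p"
      unfolding b[OF X] b[OF pX] res_app by (simp add: app_def fun_eq_iff)
    then show ?thesis
      using True by (simp add: h_op_def tscale_def fun_eq_iff)
  next
    case False
    then show ?thesis using VU_out[OF m.hh_mem[OF X]] by simp
  qed
qed

lemma codiff_h_eq:
  assumes E: "\<And>i. i < N \<Longrightarrow> res U (E i) \<in> VU U"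
  shows "res U (codiff_h A nab \<phi> \<xi> N E) = - m.divh N (\<lambda>i. res U (E i))"
proof -
  have "res U (deriv_end nab (E i) (h_op A \<phi> \<xi>) (E i)) =
      nbf U (res U (E i)) (m.hh (res U (E i))) - m.hh (nbf U (res U (E i)) (res U (E i)))" if "i < N" for i
  proof -
    note e = E[OF that]
    have a: "res U (h_op A \<phi> \<xi> (E i)) \<in> VU U" "res U (nab (E i) (E i)) \<in> VU U"
      using e by (simp_all add: res_h_op res_nab)
    show ?thesis
      unfolding deriv_end_def res_diff res_nab[OF e a(1)] res_h_op[OF a(2)] res_nab[OF e e] res_h_op[OF e] ..
  qed
  then show ?thesis
    by (simp add: codiff_h_def res_uminus res_sum m.divh_def)
qed

lemma VU_expansion:
  assumes "\<And>i. i < N \<Longrightarrow> res U (E i) \<in> VU U" "X \<in> VU U"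
    and "\<And>p. p \<in> U \<Longrightarrow> X p = (\<Sum>i<N. g p (X p) (E i p) \<odot> E i p)"
  shows "X = (\<Sum>i<N. scf (ipf X (res U (E i))) (res U (E i)))"
proof (rule ext)
  fix p
  show "X p = (\<Sum>i<N. scf (ipf X (res U (E i))) (res U (E i))) p"
  proof (cases "p \<in> U")
    case True
    then show ?thesis using assms(3)[OF True] by (simp add: sum_fun_apply scf_def ipf_def)
  next
    case False
    then show ?thesis using VU_out[OF assms(2) False] by (simp add: sum_fun_apply scf_def fun_eq_iff)
  qed
qed

lemma frame_tangent:
  assumes "orthonormal_frame A g (tangent A) N U E"
  shows "m.frame (VU U) N (\<lambda>i. res U (E i))"
proof -
  have E: "res U (E i) \<in> VU U" if "i < N" for i
    using assms that unfolding orthonormal_frame_def smooth_section_def smooth_vfield_iff by blast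
  have "X = (\<Sum>i<N. scf (ipf X (res U (E i))) (res U (E i)))" if X: "X \<in> VU U" for X
    by (rule VU_expansion[OF E X]) (use assms VU_tangent[OF X] in \<open>auto simp: orthonormal_frame_def\<close>)
  then show ?thesis
    unfolding m.frame_def using E m.submodule_V by blast
qed

text \<open>By \<open>ph_divh_eq\<close>, phi T(phi) = - phi delta h - tau(xi). With the coefficient
  1/2 the left-hand side becomes half of tau(xi) - phi delta h.\<close>

lemma first_equation:
  assumes fr: "orthonormal_frame A g (tangent A) N U E" and p: "p \<in> U"
  shows "tau_xi g nab \<xi> N E p + (1 / 2) \<odot> \<phi> p (T_phi nab \<phi> \<xi> \<eta> N E p) = 0 \<longleftrightarrow>
    tau_xi g nab \<xi> N E p = \<phi> p (codiff_h A nab \<phi> \<xi> N E p)"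
proof -
  note fr' = frame_tangent[OF fr]
  have E: "res U (E i) \<in> VU U" if "i < N" for i using m.frame_memV[OF fr' that] .
  let ?t = "tau_xi g nab \<xi> N E p" and ?T = "\<phi> p (T_phi nab \<phi> \<xi> \<eta> N E p)"
    and ?d = "\<phi> p (codiff_h A nab \<phi> \<xi> N E p)"
  have "- app \<phi> (res U (codiff_h A nab \<phi> \<xi> N E)) = app \<phi> (res U (T_phi nab \<phi> \<xi> \<eta> N E)) + m.tauv N (\<lambda>i. res U (E i))"
    using m.ph_divh_eq[OF fr'] by (simp add: codiff_h_eq[OF E] res_T_phi[OF E] m.divh_mem[OF fr'])
  from fun_cong[OF this, of p] have "- ?d = ?T + ?t"
    using p by (simp add: app_def tau_xi_eq[OF E p] fun_eq_iff)
  then have e: "- ?d f = ?T f + ?t f" for f by (simp add: fun_eq_iff)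
  have "?t f + 1 / 2 * ?T f = 0 \<longleftrightarrow> ?t f = ?d f" for f
    using e[of f] by (simp add: field_simps) linarith
  then show ?thesis by (simp add: fun_eq_iff tscale_def)
qed

text \<open>\<open>\<phi>\<close> is injective on vectors orthogonal to \<open>\<xi>\<close>, and
  the codifferential is such a vector by \<open>divh_xi\<close>.\<close>

lemma codiff_h_eq_0_iff:
  assumes fr: "orthonormal_frame A g (tangent A) N U E" and p: "p \<in> U"
  shows "\<phi> p (codiff_h A nab \<phi> \<xi> N E p) = 0 \<longleftrightarrow> codiff_h A nab \<phi> \<xi> N E p = 0"
proof
  note fr' = frame_tangent[OF fr]
  have E: "res U (E i) \<in> VU U" if "i < N" for i using m.frame_memV[OF fr' that] .
  let ?v = "codiff_h A nab \<phi> \<xi> N E p"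
  have D: "res U (codiff_h A nab \<phi> \<xi> N E) \<in> VU U"
    by (simp add: codiff_h_eq[OF E] m.divh_mem[OF fr'])
  have v: "?v \<in> tangent A p" using VU_tangent[OF D, of p] p by simp
  have "ipf (res U (codiff_h A nab \<phi> \<xi> N E)) (res U \<xi>) p = 0"
    by (simp add: codiff_h_eq[OF E] m.divh_mem[OF fr'] m.divh_xi[OF fr'])
  then have "\<eta> p ?v = 0" using p v by (simp add: ipf_def eta_eq g_sym[OF xi_tangent])
  then have "\<phi> p (\<phi> p ?v) = - ?v" using phi_phi[OF v] by simp
  moreover assume "\<phi> p ?v = 0"
  ultimately have "- ?v = 0" by (simp only: phi_0)
  then show "?v = 0" by (simp only: neg_equal_0_iff_equal)
next
  assume "codiff_h A nab \<phi> \<xi> N E p = 0"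
  then show "\<phi> p (codiff_h A nab \<phi> \<xi> N E p) = 0" by (simp only: phi_0)
qed

lemma K_contact_vanishing:
  assumes fr: "orthonormal_frame A g (tangent A) N U E" and p: "p \<in> U" and K: "K_contact A \<phi> \<xi>"
  shows "tau_xi g nab \<xi> N E p = 0" "codiff_h A nab \<phi> \<xi> N E p = 0"
proof -
  note fr' = frame_tangent[OF fr]
  have E: "res U (E i) \<in> VU U" if "i < N" for i using m.frame_memV[OF fr' that] .
  have h: "m.hh X = 0" if "X \<in> VU U" for X
  proof (rule VU_eqI)
    show "m.hh X \<in> VU U" "0 \<in> VU U" using that by simp_all
    fix q assume q: "q \<in> U"
    have "h_op A \<phi> \<xi> X q = 0"
      using K U q VU_smooth[OF that] unfolding K_contact_def by blast
    moreover have "m.hh X q = res U (h_op A \<phi> \<xi> X) q"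
      by (subst res_h_op) (simp_all add: res_VU_id[OF that] that)
    ultimately show "m.hh X q = 0 q"
      using q by (simp add: fun_eq_iff)
  qed
  show "tau_xi g nab \<xi> N E p = 0"
    using tau_xi_eq[OF E p] m.tauv_K_contact[OF fr' h] by simp
  have "m.divh N (\<lambda>i. res U (E i)) = 0"
    unfolding m.divh_def using E by (intro sum.neutral ballI) (simp add: h)
  then show "codiff_h A nab \<phi> \<xi> N E p = 0"
    using fun_cong[OF codiff_h_eq[where N = N and E = E, OF E], of p] p by (simp add: fun_eq_iff)
qed

end

section \<open>Frames of the contact bundle\<close>

context contact_metric_manifold
begin

lemma phi_uminus: "v \<in> tangent A p \<Longrightarrow> \<phi> p (- v) = - \<phi> p v"
  using phi_scale[of v p "- 1"] by (simp add: tscale_def fun_Compl_def)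

lemma phi_xi: "\<phi> p (\<xi> p) = 0"
proof -
  have "g p (\<phi> p (\<xi> p)) (\<phi> p (\<xi> p)) = 0"
    using g_phi_phi[OF xi_tangent xi_tangent, of p] by (simp add: eta_eq xi_tangent xi_unit)
  then show ?thesis
    using g_pos[OF phi_tangent[OF xi_tangent], of p] by auto
qed

lemma g_phi_xi:
  assumes v: "v \<in> tangent A p"
  shows "g p (\<phi> p v) (\<xi> p) = 0"
proof -
  let ?h = "\<eta> p (\<phi> p v)"
  have "\<phi> p (\<phi> p (\<phi> p v)) = - \<phi> p v + ?h \<odot> \<xi> p"
    by (rule phi_phi[OF phi_tangent[OF v]])
  moreover have "\<phi> p (\<phi> p (\<phi> p v)) = - \<phi> p v"
    unfolding phi_phi[OF v] phi_add[OF tangent_uminus[OF v] tangent_scale[OF xi_tangent]]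
      phi_uminus[OF v] phi_scale[OF xi_tangent] phi_xi by simp
  ultimately have "?h \<odot> \<xi> p = 0" by (metis add_cancel_left_right)
  then have "?h * g p (\<xi> p) (\<xi> p) = 0"
    using g_scale[OF xi_tangent xi_tangent, of p ?h] g_0[OF xi_tangent, of p] by simp
  then show ?thesis
    using eta_eq[OF phi_tangent[OF v]] g_sym[OF xi_tangent phi_tangent[OF v]] by (simp add: xi_unit)
qed

text \<open>On the orthogonal complement of \<open>\<xi>\<close> the square of \<open>\<phi>\<close>
  is minus the identity, so \<open>v\<close> is the image of \<open>- \<phi> p v\<close>.\<close>

lemma contact_bundle_iff: "v \<in> contact_bundle A \<phi> p \<longleftrightarrow> v \<in> tangent A p \<and> g p v (\<xi> p) = 0"
proof
  assume "v \<in> contact_bundle A \<phi> p"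
  then show "v \<in> tangent A p \<and> g p v (\<xi> p) = 0"
    unfolding contact_bundle_def using phi_tangent g_phi_xi by blast
next
  assume v: "v \<in> tangent A p \<and> g p v (\<xi> p) = 0"
  then have "\<eta> p v = 0" using eta_eq g_sym[OF xi_tangent] by metis
  then have "\<phi> p (\<phi> p v) = - v" using phi_phi v by simp
  then have "\<phi> p (- \<phi> p v) = v" using phi_uminus[OF phi_tangent] v by simp
  then show "v \<in> contact_bundle A \<phi> p"
    unfolding contact_bundle_def using tangent_uminus[OF phi_tangent] v by (metis imageI)
qed

lemma orthonormal_frame_subset:
  assumes "orthonormal_frame A g B N U E" "open W" "W \<subseteq> U"
  shows "orthonormal_frame A g B N W E"
  using assms smooth_vfield_subset[OF _ assms(3)]
  unfolding orthonormal_frame_def smooth_section_def by blast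

lemma orthonormal_frame_append_xi:
  assumes "orthonormal_frame A g (contact_bundle A \<phi>) K U F"
  shows "orthonormal_frame A g (tangent A) (Suc K) U (\<lambda>i. if i < K then F i else \<xi>)"
proof -
  note F = assms[unfolded orthonormal_frame_def smooth_section_def contact_bundle_iff]
  have FT: "F i p \<in> tangent A p" "g p (F i p) (\<xi> p) = 0" "g p (\<xi> p) (F i p) = 0" if "i < K" "p \<in> U" for i p
    using F that g_sym[OF xi_tangent] by auto
  have "v = (\<Sum>i<Suc K. g p v ((if i < K then F i else \<xi>) p) \<odot> (if i < K then F i else \<xi>) p)"
    if p: "p \<in> U" and v: "v \<in> tangent A p" for p v
  proof -
    define u where "u = v + (- g p v (\<xi> p)) \<odot> \<xi> p"
    have sx: "(- g p v (\<xi> p)) \<odot> \<xi> p \<in> tangent A p" by (rule tangent_scale[OF xi_tangent])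
    have u: "u \<in> tangent A p" unfolding u_def by (rule tangent_add[OF v sx])
    have gu: "g p u x = g p v x - g p v (\<xi> p) * g p (\<xi> p) x" if "x \<in> tangent A p" for x
      unfolding u_def g_add[OF v sx that] g_scale[OF xi_tangent that] by simp
    have "g p u (\<xi> p) = 0" by (simp add: gu xi_tangent xi_unit)
    then have "u \<in> contact_bundle A \<phi> p"
      using u by (simp add: contact_bundle_iff)
    then have "u = (\<Sum>i<K. g p u (F i p) \<odot> F i p)"
      using F p by blast
    also have "\<dots> = (\<Sum>i<K. g p v (F i p) \<odot> F i p)"
      by (intro sum.cong refl) (simp add: gu FT p)
    finally have "v + (- g p v (\<xi> p)) \<odot> \<xi> p = (\<Sum>i<K. g p v (F i p) \<odot> F i p)"
      unfolding u_def .
    then have e: "v f - g p v (\<xi> p) * \<xi> p f = (\<Sum>i<K. g p v (F i p) \<odot> F i p) f" for f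
      by (simp add: fun_eq_iff tscale_def)
    show ?thesis
    proof (rule ext)
      fix f
      show "v f = (\<Sum>i<Suc K. g p v ((if i < K then F i else \<xi>) p) \<odot> (if i < K then F i else \<xi>) p) f"
        using e[of f] by (simp add: tscale_def sum_fun_apply)
    qed
  qed
  moreover have "open U" using F by blast
  ultimately show ?thesis
    using F unfolding orthonormal_frame_def smooth_section_def
    by (auto simp: FT xi_unit xi_smooth xi_tangent less_Suc_eq)
qed

text \<open>The reflection in the hyperplane orthogonal to \<open>w = e\<^sub>0 - s \<xi>\<close>, \<open>s\<^sup>2 = 1\<close>, maps \<open>e\<^sub>0\<close> to \<open>s \<xi>\<close>.\<close>

lemma reflected_basis:
  fixes e :: "nat \<Rightarrow> 'm tvec"
  assumes e: "\<And>i. i < Suc K \<Longrightarrow> e i \<in> tangent A p"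
    and on: "\<And>i j. i < Suc K \<Longrightarrow> j < Suc K \<Longrightarrow> g p (e i) (e j) = (if i = j then 1 else 0)"
    and ex: "\<And>v. v \<in> tangent A p \<Longrightarrow> v = (\<Sum>i<Suc K. g p v (e i) \<odot> e i)"
    and s: "s * s = 1"
    and w: "w = e 0 + (- s) \<odot> \<xi> p" and pos: "g p w w > 0"
    and f: "\<And>i. f i = e (Suc i) + (- (2 * g p (e (Suc i)) w * inverse (g p w w))) \<odot> w"
  shows "i < K \<Longrightarrow> f i \<in> contact_bundle A \<phi> p"
    and "i < K \<Longrightarrow> j < K \<Longrightarrow> g p (f i) (f j) = (if i = j then 1 else 0)"
    and "v \<in> contact_bundle A \<phi> p \<Longrightarrow> v = (\<Sum>i<K. g p v (f i) \<odot> f i)"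
proof -
  define n where "n = g p w w"
  define r where "r v = v + (- (2 * g p v w * inverse n)) \<odot> w" for v
  have n: "n > 0" using pos by (simp add: n_def)
  have wT: "w \<in> tangent A p" unfolding w using e[of 0] by (intro tangent_add tangent_scale xi_tangent) simp
  have rT: "r v \<in> tangent A p" if "v \<in> tangent A p" for v
    unfolding r_def using that wT by (intro tangent_add tangent_scale)
  have gr: "g p (r u) v = g p u v - 2 * g p u w * inverse n * g p w v"
    if "u \<in> tangent A p" "v \<in> tangent A p" for u v
    using that wT by (simp add: r_def g_add g_scale tangent_scale)
  have gr': "g p v (r u) = g p u v - 2 * g p u w * inverse n * g p w v"
    if "u \<in> tangent A p" "v \<in> tangent A p" for u v
    using gr[OF that] g_sym[OF that(2) rT[OF that(1)]] by simp
  have iso: "g p (r u) (r v) = g p u v" if u: "u \<in> tangent A p" and v: "v \<in> tangent A p" for u v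
    unfolding gr[OF u rT[OF v]] gr'[OF v u] gr'[OF v wT] n_def[symmetric]
    using n g_sym[OF u v] g_sym[OF wT u] g_sym[OF wT v] by (simp add: field_simps)
  have rr: "r (r v) = v" if v: "v \<in> tangent A p" for v
  proof -
    have "g p (r v) w = - g p v w"
      unfolding gr[OF v wT] n_def[symmetric] using n by (simp add: field_simps)
    then show ?thesis
      unfolding r_def[of "r v"] by (simp add: r_def[of v] tscale_def fun_eq_iff)
  qed
  have e0: "e 0 \<in> tangent A p" "g p (e 0) (e 0) = 1" using e[of 0] on[of 0 0] by auto
  have g0: "g p v w = g p v (e 0) - s * g p v (\<xi> p)" if "v \<in> tangent A p" for v
    using that e0 unfolding w by (simp add: g_add_right g_scale_right tangent_scale xi_tangent)
  \<comment> \<open>Both \<open>e 0\<close> and \<open>s \<odot> \<xi> p\<close> are unit vectors,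
    so the reflection subtracts \<open>w\<close> from \<open>e 0\<close> exactly once and leaves
    \<open>s \<odot> \<xi> p\<close>.\<close>
  have "n = 2 * g p (e 0) w"
    unfolding n_def g0[OF wT] using e0 s
    by (simp add: w g_add g_scale g_add_right g_scale_right tangent_scale xi_tangent xi_unit
        g_sym[OF xi_tangent] tangent_add algebra_simps)
  then have r0: "r (e 0) = s \<odot> \<xi> p"
    using n unfolding r_def by (simp add: w tscale_def fun_eq_iff)
  have fr: "f i = r (e (Suc i))" for i
    by (simp add: f r_def n_def)
  have orth: "g p (r (e (Suc i))) (\<xi> p) = 0" if "i < K" for i
  proof -
    have ei: "e (Suc i) \<in> tangent A p" using e that by simp
    have "s * g p (r (e (Suc i))) (\<xi> p) = g p (r (e (Suc i))) (r (e 0))"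
      unfolding r0 by (rule g_scale_right[OF xi_tangent rT[OF ei], symmetric])
    also have "\<dots> = 0" unfolding iso[OF ei e0(1)] using on[of "Suc i" 0] that by simp
    finally show ?thesis using s by auto
  qed
  show "f i \<in> contact_bundle A \<phi> p" if "i < K" for i
    unfolding contact_bundle_iff fr using orth[OF that] rT[OF e[of "Suc i"]] that by simp
  show "g p (f i) (f j) = (if i = j then 1 else 0)" if "i < K" "j < K" for i j
    unfolding fr using iso[OF e[of "Suc i"] e[of "Suc j"]] on[of "Suc i" "Suc j"] that by simp
  show "v = (\<Sum>i<K. g p v (f i) \<odot> f i)" if "v \<in> contact_bundle A \<phi> p"
  proof -
    have v: "v \<in> tangent A p" "g p v (\<xi> p) = 0" using that by (simp_all add: contact_bundle_iff)
    have rsum: "r (\<Sum>i<k. c i \<odot> e i) = (\<Sum>i<k. c i \<odot> r (e i)) \<and> (\<Sum>i<k. c i \<odot> e i) \<in> tangent A p"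
      if "k \<le> Suc K" for k c
      using that
    proof (induction k)
      case 0
      have "r 0 = 0" using wT by (simp add: r_def g_0)
      then show ?case
        using tangent_0[of p] by (simp only: lessThan_0 sum.empty simp_thms)
    next
      case (Suc k)
      let ?x = "\<Sum>i<k. c i \<odot> e i"
      have IH: "r ?x = (\<Sum>i<k. c i \<odot> r (e i))" and x: "?x \<in> tangent A p" and ek: "e k \<in> tangent A p"
        using Suc e by auto
      have "r (?x + c k \<odot> e k) = r ?x + c k \<odot> r (e k)"
        using g_add[OF x tangent_scale[OF ek] wT] g_scale[OF ek wT]
        by (simp add: r_def tscale_def fun_eq_iff algebra_simps)
      then show ?case
        using tangent_add[OF x tangent_scale[OF ek]] by (simp only: sum.lessThan_Suc IH simp_thms)
    qed
    \<comment> \<open>Expand \<open>r v\<close> in \<open>e\<close> and reflect back; the term of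
      \<open>e 0\<close> drops out because its image is a multiple of \<open>\<xi> p\<close>,
      orthogonal to \<open>v\<close>.\<close>
    have "v = r (r v)" by (rule rr[OF v(1), symmetric])
    also have "r v = (\<Sum>i<Suc K. g p (r v) (e i) \<odot> e i)" by (rule ex[OF rT[OF v(1)]])
    also have "r \<dots> = (\<Sum>i<Suc K. g p (r v) (e i) \<odot> r (e i))" by (rule conjunct1[OF rsum[OF order_refl]])
    also have "\<dots> = (\<Sum>i<Suc K. g p v (r (e i)) \<odot> r (e i))"
    proof (intro sum.cong refl)
      fix i assume "i \<in> {..<Suc K}"
      then have ei: "e i \<in> tangent A p" using e by simp
      show "g p (r v) (e i) \<odot> r (e i) = g p v (r (e i)) \<odot> r (e i)"
        using iso[OF rT[OF v(1)] ei] rr[OF v(1)] by simp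
    qed
    also have "\<dots> = g p v (r (e 0)) \<odot> r (e 0) + (\<Sum>i<K. g p v (f i) \<odot> f i)"
      unfolding fr by (rule sum.lessThan_Suc_shift)
    also have "g p v (r (e 0)) = 0"
      unfolding r0 using v by (simp add: g_scale_right xi_tangent)
    finally show ?thesis by (simp add: fun_eq_iff)
  qed
qed

text \<open>The reflection carries the first frame vector to a multiple of \<open>\<xi>\<close> and
  hence the others into the contact bundle. It is defined where \<open>w\<close> is not zero, so the
  frame is obtained on a neighbourhood of \<open>p\<close> only.\<close>

lemma contact_frame_near:
  assumes E: "orthonormal_frame A g (tangent A) (Suc K) U E" and p: "p \<in> U"
  obtains W F where "p \<in> W" "open W" "W \<subseteq> U" "orthonormal_frame A g (contact_bundle A \<phi>) K W F"
proof -
  note E' = E[unfolded orthonormal_frame_def smooth_section_def]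
  have U: "open U" using E' by blast
  \<comment> \<open>The sign opposite to that of the inner product, so that the squared length of
    \<open>w\<close> at \<open>p\<close> is at least 2.\<close>
  define s :: real where "s = (if g p (E 0 p) (\<xi> p) \<ge> 0 then - 1 else 1)"
  define w where "w = E 0 + (\<lambda>q. (- s) \<odot> \<xi> q)"
  have s: "s * s = 1" by (simp add: s_def)
  have w_smooth: "smooth_vfield A U w"
    unfolding w_def using E' by (intro smooth_vfield_add smooth_vfield_scale smooth_fun_const xi_smooth) auto
  define W where "W = {q \<in> U. g q (w q) (w q) > 0}"
  have n: "smooth_fun A U (\<lambda>q. g q (w q) (w q))" by (rule g_smooth[OF U w_smooth w_smooth])
  have "open (U \<inter> (\<lambda>q. g q (w q) (w q)) -` {0<..})"
    by (rule continuous_open_preimage[OF smooth_fun_continuous[OF U n] U]) simp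
  moreover have "U \<inter> (\<lambda>q. g q (w q) (w q)) -` {0<..} = W" by (auto simp: W_def)
  ultimately have W: "open W" by simp
  have WU: "W \<subseteq> U" by (auto simp: W_def)
  have "g p (w p) (w p) = 1 - 2 * (s * g p (E 0 p) (\<xi> p)) + s * s"
  proof -
    have "E 0 p \<in> tangent A p" "g p (E 0 p) (E 0 p) = 1" using E' p by auto
    then show ?thesis
      by (simp add: w_def g_add g_scale g_add_right g_scale_right tangent_scale xi_tangent xi_unit
          g_sym[OF xi_tangent] tangent_add algebra_simps)
  qed
  then have pW: "p \<in> W" using p by (simp add: W_def s_def split: if_splits)
  define F where "F i = E (Suc i) + (\<lambda>q. (- (2 * g q (E (Suc i) q) (w q) * inverse (g q (w q) (w q)))) \<odot> w q)" for i
  have basis: "i < K \<Longrightarrow> F i q \<in> contact_bundle A \<phi> q"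
    "i < K \<Longrightarrow> j < K \<Longrightarrow> g q (F i q) (F j q) = (if i = j then 1 else 0)"
    "v \<in> contact_bundle A \<phi> q \<Longrightarrow> v = (\<Sum>i<K. g q v (F i q) \<odot> F i q)" if q: "q \<in> W" for i j q v
  proof -
    have qU: "q \<in> U" and pos: "g q (w q) (w q) > 0" using q by (auto simp: W_def)
    have 1: "E i q \<in> tangent A q" if "i < Suc K" for i using E' qU that by blast
    have 2: "g q (E i q) (E j q) = (if i = j then 1 else 0)" if "i < Suc K" "j < Suc K" for i j
      using E' qU that by blast
    have 3: "v = (\<Sum>i<Suc K. g q v (E i q) \<odot> E i q)" if "v \<in> tangent A q" for v
      using E' qU that by blast
    have 4: "w q = E 0 q + (- s) \<odot> \<xi> q" by (simp add: w_def fun_eq_iff)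
    have 5: "F i q = E (Suc i) q + (- (2 * g q (E (Suc i) q) (w q) * inverse (g q (w q) (w q)))) \<odot> w q" for i
      by (simp add: F_def fun_eq_iff)
    note * = reflected_basis[where e = "\<lambda>i. E i q" and f = "\<lambda>i. F i q", OF 1 2 3 s 4 pos 5]
    show "i < K \<Longrightarrow> F i q \<in> contact_bundle A \<phi> q" by (rule *(1))
    show "i < K \<Longrightarrow> j < K \<Longrightarrow> g q (F i q) (F j q) = (if i = j then 1 else 0)" by (rule *(2))
    show "v \<in> contact_bundle A \<phi> q \<Longrightarrow> v = (\<Sum>i<K. g q v (F i q) \<odot> F i q)" by (rule *(3))
  qed
  have "smooth_vfield A W (F i)" if "i < K" for i
  proof -
    have e: "smooth_vfield A W (E (Suc i))"
      by (rule smooth_vfield_subset[OF _ WU]) (use E' that in auto)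
    have w': "smooth_vfield A W w" by (rule smooth_vfield_subset[OF w_smooth WU])
    have "smooth_fun A W (\<lambda>q. inverse (g q (w q) (w q)))"
      by (rule smooth_fun_inverse[OF W g_smooth[OF W w' w']]) (auto simp: W_def)
    then have "smooth_fun A W (\<lambda>q. - (2 * g q (E (Suc i) q) (w q) * inverse (g q (w q) (w q))))"
      by (intro smooth_fun_uminus smooth_fun_mult W smooth_fun_const g_smooth e w')
    then show ?thesis
      unfolding F_def by (intro smooth_vfield_add e smooth_vfield_scale w')
  qed
  then have "orthonormal_frame A g (contact_bundle A \<phi>) K W F"
    unfolding orthonormal_frame_def smooth_section_def using W basis by blast
  with pW W WU show ?thesis by (rule that)
qed

end

section \<open>Contact sections and contact frames in the module\<close>

context contact_metric_open
begin

lemma smooth_section_iff: "smooth_section A (contact_bundle A \<phi>) U X \<longleftrightarrow> res U X \<in> m.Dd"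
proof
  assume X: "smooth_section A (contact_bundle A \<phi>) U X"
  show "res U X \<in> m.Dd"
  proof (rule m.DdI)
    show "res U X \<in> VU U" using X by (simp add: smooth_section_def smooth_vfield_iff)
    show "ipf (res U X) (res U \<xi>) p = 0" for p
      using X by (cases "p \<in> U") (auto simp: ipf_def smooth_section_def contact_bundle_iff g_0(1)[OF tangent_0])
  qed
next
  assume X: "res U X \<in> m.Dd"
  have "smooth_vfield A U X" using X by (simp add: smooth_vfield_iff)
  moreover have "X p \<in> contact_bundle A \<phi> p" if "p \<in> U" for p
    using m.Dd_xi[OF X, of p] smooth_vfield_tangent[OF calculation that] that by (simp add: contact_bundle_iff ipf_def)
  ultimately show "smooth_section A (contact_bundle A \<phi>) U X"
    by (simp add: smooth_section_def)
qed

lemma contact_frame_res: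
  assumes F: "orthonormal_frame A g (contact_bundle A \<phi>) K U F"
  shows "contact_frame (VU U) (SU U) scf ipf derf (nbf U) (app \<phi>) (res U \<xi>) K (\<lambda>i. res U (F i))"
proof unfold_locales
  have FD: "res U (F i) \<in> m.Dd" if "i < K" for i
    using F that unfolding orthonormal_frame_def smooth_section_iff by blast
  have "X = (\<Sum>i<K. scf (ipf X (res U (F i))) (res U (F i)))" if X: "X \<in> m.Dd" for X
  proof (rule VU_expansion[OF m.DdV[OF FD] m.DdV[OF X]])
    fix p assume p: "p \<in> U"
    have "X p \<in> contact_bundle A \<phi> p"
      using m.Dd_xi[OF X, of p] VU_tangent[OF m.DdV[OF X], of p] p by (simp add: contact_bundle_iff ipf_def)
    then show "X p = (\<Sum>i<K. g p (X p) (F i p) \<odot> F i p)"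
      using F p unfolding orthonormal_frame_def by blast
  qed
  then show "m.frame m.Dd K (\<lambda>i. res U (F i))"
    unfolding m.frame_def using FD m.submodule_Dd by blast
  fix X i j p assume X: "X \<in> VU U" and ij: "i < K" "j < K"
  show "derf X (ipf (res U (F i)) (res U (F j))) p = 0"
  proof (cases "p \<in> U")
    case True
    have "X p (ipf (res U (F i)) (res U (F j))) = X p (\<lambda>q. if i = j then 1 else 0)"
    proof (rule tangent_cong[OF VU_tangent[OF X] U True])
      fix q assume "q \<in> U"
      then show "ipf (res U (F i)) (res U (F j)) q = (if i = j then 1 else 0)"
        using F ij unfolding orthonormal_frame_def ipf_def by simp
    qed
    then show ?thesis
      using tangent_fun_const[OF VU_tangent[OF X]] by (simp add: derf_def)
  qed (simp add: derf_def VU_out[OF X])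
qed

text \<open>The first conclusion permits tau(J)Y itself as the test section \<open>W\<close> in the
  second.\<close>

lemma tau_J_star_ricci:
  assumes E: "orthonormal_frame A g (tangent A) N U E"
    and F: "orthonormal_frame A g (contact_bundle A \<phi>) K U F"
    and Y: "smooth_section A (contact_bundle A \<phi>) U Y"
  shows "smooth_section A (contact_bundle A \<phi>) U (tau_J nab \<phi> \<xi> \<eta> N E Y)"
    and "smooth_section A (contact_bundle A \<phi>) U W \<Longrightarrow> p \<in> U \<Longrightarrow>
      g p (tau_J nab \<phi> \<xi> \<eta> N E Y p) (W p) =
        2 * (star_ricciD g nab \<phi> \<xi> \<eta> K F Y W p - star_ricciD g nab \<phi> \<xi> \<eta> K F W Y p)"
proof -
  interpret cf: contact_frame "VU U" "SU U" scf ipf derf "nbf U" "app \<phi>" "res U \<xi>" K "\<lambda>i. res U (F i)"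
    by (rule contact_frame_res[OF F])
  note fr = frame_tangent[OF E]
  have Yd: "res U Y \<in> m.Dd" using Y by (simp add: smooth_section_iff)
  have EV: "res U (E i) \<in> VU U" if "i < N" for i using m.frame_memV[OF fr that] .
  have tJ: "res U (tau_J nab \<phi> \<xi> \<eta> N E Y) = m.tauJ N (\<lambda>i. res U (E i)) (res U Y)"
    by (rule res_tau_J[OF EV m.DdV[OF Yd]])
  show "smooth_section A (contact_bundle A \<phi>) U (tau_J nab \<phi> \<xi> \<eta> N E Y)"
    unfolding smooth_section_iff tJ by (rule m.tauJ_Dd[OF fr m.DdV[OF Yd]])
  assume W: "smooth_section A (contact_bundle A \<phi>) U W" and p: "p \<in> U"
  then have Wd: "res U W \<in> m.Dd" by (simp add: smooth_section_iff)
  have star: "star_ricciD g nab \<phi> \<xi> \<eta> K F X Z p = cf.rho_star (res U X) (res U Z) p"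
    if X: "res U X \<in> m.Dd" for X Z
    unfolding star_ricciD_def cf.rho_star_def
  proof (intro sum.cong refl)
    fix i assume "i \<in> {..<K}"
    then have Fi: "res U (F i) \<in> VU U" using m.DdV[OF cf.F_Dd] by simp
    have "res U (curvD nab \<xi> \<eta> X (F i) (app \<phi> (F i))) = m.Rb (res U X) (res U (F i)) (app \<phi> (res U (F i)))"
      using res_curvD[OF m.DdV[OF X] Fi, of "app \<phi> (F i)"] Fi by (simp add: res_app)
    from fun_cong[OF this, of p] p
    show "g p (curvD nab \<xi> \<eta> X (F i) (app \<phi> (F i)) p) (\<phi> p (Z p)) =
        ipf (m.Rb (res U X) (res U (F i)) (app \<phi> (res U (F i)))) (app \<phi> (res U Z)) p"
      by (simp add: ipf_def app_def)
  qed
  have "g p (tau_J nab \<phi> \<xi> \<eta> N E Y p) (W p) = ipf (res U (tau_J nab \<phi> \<xi> \<eta> N E Y)) (res U W) p"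
    using p by (simp add: ipf_def)
  also have "\<dots> = ipf (m.tauJ (Suc K) cf.FX (res U Y)) (res U W) p"
    unfolding tJ m.tauJ_frame_independent[OF fr cf.frame_FX Yd] ..
  also have "\<dots> = 2 * (cf.rho_star (res U Y) (res U W) p - cf.rho_star (res U W) (res U Y) p)"
    by (rule cf.tauJ_rho_star[OF Yd Wd])
  finally show "g p (tau_J nab \<phi> \<xi> \<eta> N E Y p) (W p) =
      2 * (star_ricciD g nab \<phi> \<xi> \<eta> K F Y W p - star_ricciD g nab \<phi> \<xi> \<eta> K F W Y p)"
    by (simp only: star[OF Yd] star[OF Wd])
qed

end

section \<open>The second harmonic section equation and the three equivalences\<close>

context contact_metric_manifold
begin

lemma second_equation:
  "(\<forall>U E Y. orthonormal_frame A g (tangent A) DIM('e) U E \<longrightarrow>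
     smooth_section A (contact_bundle A \<phi>) U Y \<longrightarrow>
     (\<forall>p\<in>U. tau_J nab \<phi> \<xi> \<eta> DIM('e) E Y p = 0)) \<longleftrightarrow>
   star_ricciD_symmetric A g nab \<phi> \<xi> \<eta>" (is "?L \<longleftrightarrow> _")
proof
  \<comment> \<open>The dimension is positive, so the truncated subtraction is exact and adding
    \<open>\<xi>\<close> to a contact frame gives the right length.\<close>
  have N: "Suc (DIM('e) - 1) = DIM('e)" by simp
  assume L: ?L
  show "star_ricciD_symmetric A g nab \<phi> \<xi> \<eta>"
    unfolding star_ricciD_symmetric_def
  proof (intro allI impI ballI)
    fix U F X Y p
    assume F: "orthonormal_frame A g (contact_bundle A \<phi>) (DIM('e) - 1) U F"
      and X: "smooth_section A (contact_bundle A \<phi>) U X"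
      and Y: "smooth_section A (contact_bundle A \<phi>) U Y" and p: "p \<in> U"
    interpret contact_metric_open A g nab \<phi> \<xi> \<eta> U
      by unfold_locales (use F in \<open>simp add: orthonormal_frame_def\<close>)
    note E = orthonormal_frame_append_xi[OF F, unfolded N]
    have Y0: "Y p \<in> tangent A p" using Y p by (simp add: smooth_section_def contact_bundle_iff)
    show "star_ricciD g nab \<phi> \<xi> \<eta> (DIM('e) - 1) F X Y p = star_ricciD g nab \<phi> \<xi> \<eta> (DIM('e) - 1) F Y X p"
      using tau_J_star_ricci(2)[OF E F X Y p] L[rule_format, OF E X p] g_0(1)[OF Y0] by simp
  qed
next
  have N: "Suc (DIM('e) - 1) = DIM('e)" by simp
  assume R: "star_ricciD_symmetric A g nab \<phi> \<xi> \<eta>"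
  show ?L
  proof (intro allI impI ballI)
    fix U E Y p
    assume E: "orthonormal_frame A g (tangent A) DIM('e) U E"
      and Y: "smooth_section A (contact_bundle A \<phi>) U Y" and p: "p \<in> U"
    \<comment> \<open>The equation is pointwise, so it may be checked on a neighbourhood of
      \<open>p\<close> that carries a contact frame.\<close>
    obtain W F where W: "p \<in> W" "open W" "W \<subseteq> U"
      and F: "orthonormal_frame A g (contact_bundle A \<phi>) (DIM('e) - 1) W F"
      using contact_frame_near[of "DIM('e) - 1" U E p, unfolded N, OF E p] by blast
    interpret contact_metric_open A g nab \<phi> \<xi> \<eta> W
      by unfold_locales (rule W(2))
    note EW = orthonormal_frame_subset[OF E W(2,3)]
    have YW: "smooth_section A (contact_bundle A \<phi>) W Y"
      using Y W(3) smooth_vfield_subset[of U Y W] unfolding smooth_section_def by blast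
    let ?t = "tau_J nab \<phi> \<xi> \<eta> DIM('e) E Y"
    note t = tau_J_star_ricci(1)[OF EW F YW]
    \<comment> \<open>Symmetry is applied to \<open>Y\<close> and tau(J)Y, so that the squared
      length of tau(J)Y vanishes at \<open>p\<close>.\<close>
    have "star_ricciD g nab \<phi> \<xi> \<eta> (DIM('e) - 1) F Y ?t p = star_ricciD g nab \<phi> \<xi> \<eta> (DIM('e) - 1) F ?t Y p"
      using R F YW t W(1) unfolding star_ricciD_symmetric_def by blast
    then have "g p (?t p) (?t p) = 0"
      using tau_J_star_ricci(2)[OF EW F YW t W(1)] by simp
    moreover have "?t p \<in> tangent A p"
      using t W(1) by (simp add: smooth_section_def contact_bundle_iff)
    ultimately show "?t p = 0"
      using g_pos[of "?t p" p] by auto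
  qed
qed

theorem harmonic_characterization:
  "(harmonic_acms A g nab \<phi> \<xi> \<eta> \<longleftrightarrow>
      (\<forall>U E. orthonormal_frame A g (tangent A) DIM('e) U E \<longrightarrow>
         (\<forall>p\<in>U. tau_xi g nab \<xi> DIM('e) E p = \<phi> p (codiff_h A nab \<phi> \<xi> DIM('e) E p))) \<and>
      star_ricciD_symmetric A g nab \<phi> \<xi> \<eta>)"
  "H_contact A g nab \<xi> \<Longrightarrow> harmonic_acms A g nab \<phi> \<xi> \<eta> \<longleftrightarrow>
      h_coclosed A g nab \<phi> \<xi> \<and> star_ricciD_symmetric A g nab \<phi> \<xi> \<eta>"
  "K_contact A \<phi> \<xi> \<Longrightarrow> harmonic_acms A g nab \<phi> \<xi> \<eta> \<longleftrightarrow> star_ricciD_symmetric A g nab \<phi> \<xi> \<eta>"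
proof -
  have op: "contact_metric_open A g nab \<phi> \<xi> \<eta> U" if "orthonormal_frame A g (tangent A) N U E" for N U E
    by unfold_locales (use that in \<open>simp add: orthonormal_frame_def\<close>)
  show 1: "harmonic_acms A g nab \<phi> \<xi> \<eta> \<longleftrightarrow>
      (\<forall>U E. orthonormal_frame A g (tangent A) DIM('e) U E \<longrightarrow>
         (\<forall>p\<in>U. tau_xi g nab \<xi> DIM('e) E p = \<phi> p (codiff_h A nab \<phi> \<xi> DIM('e) E p))) \<and>
      star_ricciD_symmetric A g nab \<phi> \<xi> \<eta>"
    unfolding harmonic_acms_def second_equation
    using contact_metric_open.first_equation[OF op] by (intro conj_cong refl) blast
  show "harmonic_acms A g nab \<phi> \<xi> \<eta> \<longleftrightarrow> h_coclosed A g nab \<phi> \<xi> \<and> star_ricciD_symmetric A g nab \<phi> \<xi> \<eta>"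
    if H: "H_contact A g nab \<xi>"
  proof -
    have "tau_xi g nab \<xi> DIM('e) E p = \<phi> p (codiff_h A nab \<phi> \<xi> DIM('e) E p) \<longleftrightarrow>
        codiff_h A nab \<phi> \<xi> DIM('e) E p = 0"
      if fr: "orthonormal_frame A g (tangent A) DIM('e) U E" and p: "p \<in> U" for U E p
    proof -
      have "tau_xi g nab \<xi> DIM('e) E p = 0"
        using H fr p unfolding H_contact_def by blast
      then show ?thesis
        using contact_metric_open.codiff_h_eq_0_iff[OF op[OF fr] fr p] by auto
    qed
    then show ?thesis
      unfolding 1 h_coclosed_def by blast
  qed
  show "harmonic_acms A g nab \<phi> \<xi> \<eta> \<longleftrightarrow> star_ricciD_symmetric A g nab \<phi> \<xi> \<eta>"
    if K: "K_contact A \<phi> \<xi>"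
  proof -
    have "tau_xi g nab \<xi> DIM('e) E p = \<phi> p (codiff_h A nab \<phi> \<xi> DIM('e) E p)"
      if fr: "orthonormal_frame A g (tangent A) DIM('e) U E" and p: "p \<in> U" for U E p
      unfolding contact_metric_open.K_contact_vanishing[OF op[OF fr] fr p K] phi_0 ..
    then show ?thesis
      unfolding 1 by blast
  qed
qed

end

theorem theorem2p1:
  fixes A :: "('m::{t2_space,second_countable_topology}, 'e::euclidean_space) atlas"
    and n :: nat
    and g :: "'m metric" and nab :: "'m connection"
    and \<phi> :: "'m \<Rightarrow> 'm tvec \<Rightarrow> 'm tvec" and \<xi> :: "'m vfield" and \<eta> :: "'m \<Rightarrow> 'm tvec \<Rightarrow> real"
  assumes "smooth_manifold A"
    and "DIM('e) = 2 * n + 1"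
    and "riemannian_metric A g"
    and "levi_civita A g nab"
    and "contact_metric A g \<phi> \<xi> \<eta>"
  shows "(harmonic_acms A g nab \<phi> \<xi> \<eta> \<longleftrightarrow>
            (\<forall>U E. orthonormal_frame A g (tangent A) DIM('e) U E \<longrightarrow>
               (\<forall>p\<in>U. tau_xi g nab \<xi> DIM('e) E p = \<phi> p (codiff_h A nab \<phi> \<xi> DIM('e) E p))) \<and>
            star_ricciD_symmetric A g nab \<phi> \<xi> \<eta>) \<and>
         (H_contact A g nab \<xi> \<longrightarrow>
            (harmonic_acms A g nab \<phi> \<xi> \<eta> \<longleftrightarrow>
               h_coclosed A g nab \<phi> \<xi> \<and> star_ricciD_symmetric A g nab \<phi> \<xi> \<eta>)) \<and>
         (K_contact A \<phi> \<xi> \<longrightarrow>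
            (harmonic_acms A g nab \<phi> \<xi> \<eta> \<longleftrightarrow> star_ricciD_symmetric A g nab \<phi> \<xi> \<eta>))"
proof -
  interpret contact_metric_manifold A g nab \<phi> \<xi> \<eta>
    using assms by unfold_locales
  show ?thesis
    using harmonic_characterization by blast
qed

end
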